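(* For every $\alpha>0$ there exists a linear operator $S=S_\alpha$ between Banach spaces such that, for some constant $c>0$ and some $n_0\in\mathbb{N}$, for all $n\ge n_0$ $$\frac{e^{\mathrm{ran},\mathrm{ada}}(n,S)}{e^{\mathrm{ran},\mathrm{nonada}}(n,S)}\ \le\ c\,\frac{(\log n)^2\,(\log\log n)^{1+\alpha}}{n}$$ (in particular, the denominator is positive and finite).
   Context: Let $S\colon F\to G$ be a linear operator between Banach spaces. A randomized (possibly adaptive) algorithm $A_n$ using at most $n$ linear measurements is given by a probability space $(\Omega,\Sigma,\mathbb{P})$ and, for each $\omega\in\Omega$, a rule that on input $f\in F$ computes successively $y_i=L_i(f)$, $i=1,\ldots,n$, where $L_i=L_i^{\omega}(\,\cdot\,;y_1,\ldots,y_{i-1})\in F'$ is a continuous linear functional that may depend on $\omega$ and on the previously obtained values $y_1,\ldots,y_{i-1}$, and then returns $A_n(\omega,f)=\phi^{\omega}(y_1,\ldots,y_n)\in G$. As usual, $(\omega,f)\mapsto A_n(\omega,f)$ is assumed to be jointly measurable (with respect to the product of $\Sigma$ and the Borel $\sigma$-algebra of $F$, and the Borel $\sigma$-algebra of $G$). The algorithm is non-adaptive if the functionals $L_i=L_i^\omega$ depend on $\omega$ only and not on previously obtained values. One writes $A_n(f)=A_n(\cdot,f)$. The Monte Carlo error is $$e(A_n,S):=\sup_{\|f\|_F\le 1}\mathbb{E}\,\|A_n(f)-S(f)\|_G.$$ $e^{\mathrm{ran},\mathrm{ada}}(n,S)=e^{\mathrm{ran}}(n,S)$ is the infimum of $e(A_n,S)$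 over all (possibly adaptive) randomized algorithms using at most $n$ linear measurements, and $e^{\mathrm{ran},\mathrm{nonada}}(n,S)$ is the infimum over the non-adaptive ones only. *)

theory Defs
  imports "HOL-Analysis.Analysis" "HOL-Probability.Probability" "HOL-Library.Function_Algebras"
begin

section \<open>Real vector space structure on functions\<close>

instantiation "fun" :: (type, real_vector) real_vector
begin

definition scaleR_fun :: "real \<Rightarrow> ('a \<Rightarrow> 'b) \<Rightarrow> 'a \<Rightarrow> 'b"
  where "scaleR_fun c f = (\<lambda>x. c *\<^sub>R f x)"

instance
  by standard (simp_all add: scaleR_fun_def fun_eq_iff scaleR_add_right scaleR_add_left)

end

section \<open>Banach spaces as objects\<close>

text \<open>
  Since HOL cannot quantify existentially over types, a Banach space is a set \<open>pts\<close> of points,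
  which is a linear subspace of some ambient real vector space, together with a complete norm
  \<open>nrm\<close> on it.  The ambient space supplies only the vector space operations: the norm is
  unrelated to any norm or topology it may carry.  For the ambient type \<open>nat \<Rightarrow> real\<close>
  this covers, up to isometric isomorphism, every real Banach space whose Hamel dimension is at
  most that of the continuum, in particular every separable one.
\<close>

record 'a nspace =
  pts :: "'a set"
  nrm :: "'a \<Rightarrow> real"

text \<open>The cut-off outside \<open>pts E\<close> is there because \<open>Metric_space\<close> demands
  nonnegativity and symmetry of the distance on the whole type.\<close>

definition ndist :: "'a::real_vector nspace \<Rightarrow> 'a \<Rightarrow> 'a \<Rightarrow> real"
  where "ndist E x y = (if x \<in> pts E \<and> y \<in> pts E then nrm E (x - y) else 0)"

definition normed_space :: "'a::real_vector nspace \<Rightarrow> bool"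
  where "normed_space E \<longleftrightarrow>
    subspace (pts E) \<and>
    (\<forall>x\<in>pts E. 0 \<le> nrm E x \<and> (nrm E x = 0 \<longleftrightarrow> x = 0)) \<and>
    (\<forall>x\<in>pts E. \<forall>y\<in>pts E. nrm E (x + y) \<le> nrm E x + nrm E y) \<and>
    (\<forall>x\<in>pts E. \<forall>c. nrm E (c *\<^sub>R x) = \<bar>c\<bar> * nrm E x)"

definition banach_space :: "'a::real_vector nspace \<Rightarrow> bool"
  where "banach_space E \<longleftrightarrow> normed_space E \<and> Metric_space.mcomplete (pts E) (ndist E)"

definition norm_topology :: "'a::real_vector nspace \<Rightarrow> 'a topology"
  where "norm_topology E = Metric_space.mtopology (pts E) (ndist E)"

definition norm_borel :: "'a::real_vector nspace \<Rightarrow> 'a measure"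
  where "norm_borel E = sigma (pts E) {U. openin (norm_topology E) U}"

definition linear_between :: "'a::real_vector set \<Rightarrow> 'b::real_vector set \<Rightarrow> ('a \<Rightarrow> 'b) \<Rightarrow> bool"
  where "linear_between V W T \<longleftrightarrow>
    (\<forall>x\<in>V. T x \<in> W) \<and>
    (\<forall>x\<in>V. \<forall>y\<in>V. T (x + y) = T x + T y) \<and>
    (\<forall>x\<in>V. \<forall>c. T (c *\<^sub>R x) = c *\<^sub>R T x)"

definition linear_operator ::
    "'a::real_vector nspace \<Rightarrow> 'b::real_vector nspace \<Rightarrow> ('a \<Rightarrow> 'b) \<Rightarrow> bool"
  where "linear_operator F G S \<longleftrightarrow>
    linear_between (pts F) (pts G) S \<and> continuous_map (norm_topology F) (norm_topology G) S"

definition dual_space :: "'a::real_vector nspace \<Rightarrow> ('a \<Rightarrow> real) set"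
  where "dual_space F = {l. linear_between (pts F) UNIV l \<and>
    continuous_map (norm_topology F) euclideanreal l}"

section \<open>Randomized algorithms\<close>

text \<open>The functional measured after the values \<open>ys\<close> (in the order in which they were
  obtained) is \<open>L ys\<close>; \<open>information L n f\<close> is the list of the first \<open>n\<close> values.\<close>

primrec information :: "(real list \<Rightarrow> 'a \<Rightarrow> real) \<Rightarrow> nat \<Rightarrow> 'a \<Rightarrow> real list"
  where
    "information L 0 f = []"
  | "information L (Suc i) f = (let ys = information L i f in ys @ [L ys f])"

definition alg_output ::
    "nat \<Rightarrow> ('w \<Rightarrow> real list \<Rightarrow> 'a \<Rightarrow> real) \<Rightarrow> ('w \<Rightarrow> real list \<Rightarrow> 'b) \<Rightarrow> 'w \<Rightarrow> 'a \<Rightarrow> 'b"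
  where "alg_output n L \<phi> \<omega> f = \<phi> \<omega> (information (L \<omega>) n f)"

text \<open>Fewer than \<open>n\<close> measurements are covered: zero functionals may be measured.\<close>

definition randomized_algorithm ::
    "'a::real_vector nspace \<Rightarrow> 'b::real_vector nspace \<Rightarrow> nat \<Rightarrow> 'w measure \<Rightarrow>
     ('w \<Rightarrow> real list \<Rightarrow> 'a \<Rightarrow> real) \<Rightarrow> ('w \<Rightarrow> real list \<Rightarrow> 'b) \<Rightarrow> bool"
  where "randomized_algorithm F G n M L \<phi> \<longleftrightarrow>
    prob_space M \<and>
    (\<forall>\<omega>\<in>space M. \<forall>ys. length ys < n \<longrightarrow> L \<omega> ys \<in> dual_space F) \<and>
    (\<forall>\<omega>\<in>space M. \<forall>ys. length ys = n \<longrightarrow> \<phi> \<omega> ys \<in> pts G) \<and>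
    (\<lambda>(\<omega>, f). alg_output n L \<phi> \<omega> f) \<in> M \<Otimes>\<^sub>M norm_borel F \<rightarrow>\<^sub>M norm_borel G"

definition nonadaptive ::
    "'a nspace \<Rightarrow> nat \<Rightarrow> 'w measure \<Rightarrow> ('w \<Rightarrow> real list \<Rightarrow> 'a \<Rightarrow> real) \<Rightarrow> bool"
  where "nonadaptive F n M L \<longleftrightarrow>
    (\<forall>\<omega>\<in>space M. \<forall>ys zs. length ys = length zs \<and> length ys < n \<longrightarrow>
      (\<forall>f\<in>pts F. L \<omega> ys f = L \<omega> zs f))"

definition mc_error ::
    "'a::real_vector nspace \<Rightarrow> 'b::real_vector nspace \<Rightarrow> ('a \<Rightarrow> 'b) \<Rightarrow> nat \<Rightarrow> 'w measure \<Rightarrow>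
     ('w \<Rightarrow> real list \<Rightarrow> 'a \<Rightarrow> real) \<Rightarrow> ('w \<Rightarrow> real list \<Rightarrow> 'b) \<Rightarrow> ennreal"
  where "mc_error F G S n M L \<phi> =
    (SUP f\<in>{f \<in> pts F. nrm F f \<le> 1}.
      \<integral>\<^sup>+ \<omega>. ennreal (nrm G (alg_output n L \<phi> \<omega> f - S f)) \<partial>M)"

text \<open>
  The infima below range over all probability spaces on subsets of one fixed type of sample
  points.  This type is large enough to make that no restriction: by
  \<open>sample_space_universal\<close> below, every algorithm on any probability space whatsoever has a
  counterpart with the same error on this type.
\<close>

type_synonym 'b sample = "('b set \<times> nat) set"

definition e_ran_ada ::
    "'a::real_vector nspace \<Rightarrow> 'b::real_vector nspace \<Rightarrow> ('a \<Rightarrow> 'b) \<Rightarrow> nat \<Rightarrow> ennreal"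
  where "e_ran_ada F G S n =
    Inf {mc_error F G S n M L \<phi> | (M :: 'b sample measure) L \<phi>.
      randomized_algorithm F G n M L \<phi>}"

definition e_ran_nonada ::
    "'a::real_vector nspace \<Rightarrow> 'b::real_vector nspace \<Rightarrow> ('a \<Rightarrow> 'b) \<Rightarrow> nat \<Rightarrow> ennreal"
  where "e_ran_nonada F G S n =
    Inf {mc_error F G S n M L \<phi> | (M :: 'b sample measure) L \<phi>.
      randomized_algorithm F G n M L \<phi> \<and> nonadaptive F n M L}"

section \<open>Universality of the sample type\<close>

lemma Metric_space_ndist:
  assumes "normed_space E"
  shows "Metric_space (pts E) (ndist E)"
proof
  have sub: "subspace (pts E)" using assms by (simp add: normed_space_def)
  note d = subspace_diff[OF sub]
  show "0 \<le> ndist E x y" for x y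
    using assms d by (auto simp: ndist_def normed_space_def)
  show "ndist E x y = ndist E y x" for x y
  proof (cases "x \<in> pts E \<and> y \<in> pts E")
    case True
    then have "nrm E ((-1) *\<^sub>R (x - y)) = \<bar>-1\<bar> * nrm E (x - y)"
      using assms d by (meson normed_space_def)
    then show ?thesis using True by (simp add: ndist_def)
  qed (auto simp: ndist_def)
  show "(ndist E x y = 0) = (x = y)" if "x \<in> pts E" "y \<in> pts E" for x y
    using assms d[OF that] that by (auto simp: ndist_def normed_space_def)
  show "ndist E x z \<le> ndist E x y + ndist E y z"
    if "x \<in> pts E" "y \<in> pts E" "z \<in> pts E" for x y z
  proof -
    have "nrm E ((x - y) + (y - z)) \<le> nrm E (x - y) + nrm E (y - z)"
      using assms d that by (meson normed_space_def)
    then show ?thesis using that by (simp add: ndist_def)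
  qed
qed

lemma open_subset_pts:
  assumes "normed_space E" "openin (norm_topology E) U"
  shows "U \<subseteq> pts E"
  using Metric_space.topspace_mtopology[OF Metric_space_ndist[OF assms(1)]] openin_subset[OF assms(2)]
  by (simp add: norm_topology_def)

lemma space_norm_borel:
  assumes "normed_space E"
  shows "space (norm_borel E) = pts E"
  unfolding norm_borel_def
  by (rule space_measure_of) (use open_subset_pts[OF assms] in blast)

lemma sets_norm_borel_open:
  assumes "normed_space E" "openin (norm_topology E) U"
  shows "U \<in> sets (norm_borel E)"
  unfolding norm_borel_def using assms open_subset_pts[OF assms(1)]
  by (subst sets_measure_of) (auto intro: sigma_sets.Basic)

lemma nrm_diff_measurable:
  assumes E: "normed_space E" and g: "g \<in> pts E"
  shows "(\<lambda>x. nrm E (x - g)) \<in> borel_measurable (norm_borel E)"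
proof (subst borel_measurable_iff_less, intro allI)
  fix r :: real
  interpret Metric_space "pts E" "ndist E" by (rule Metric_space_ndist[OF E])
  have "ndist E g x = nrm E (x - g)" if "x \<in> pts E" for x
    using that g commute[of g x] by (simp add: ndist_def)
  then have "{x \<in> space (norm_borel E). nrm E (x - g) < r} = mball g r"
    using g by (auto simp: space_norm_borel[OF E] mball_def)
  then show "{x \<in> space (norm_borel E). nrm E (x - g) < r} \<in> sets (norm_borel E)"
    using sets_norm_borel_open[OF E, of "mball g r"] openin_mball[of g r]
    by (simp add: norm_topology_def)
qed

lemma sets_pair_countably_generated:
  assumes "X \<in> sets (M \<Otimes>\<^sub>M N)"
  shows "\<exists>a::nat \<Rightarrow> 'w set. range a \<subseteq> sets M \<and> X \<in> sets (sigma (space M) (range a) \<Otimes>\<^sub>M N)"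
proof -
  let ?Q = "\<lambda>a::nat \<Rightarrow> 'w set. sigma (space M) (range a) \<Otimes>\<^sub>M N"
  have sp: "space (?Q a) = space M \<times> space N" for a
    by (simp add: space_pair_measure space_measure_of_conv)
  have "X \<in> sigma_sets (space M \<times> space N) {a \<times> b |a b. a \<in> sets M \<and> b \<in> sets N}"
    using assms by (simp add: sets_pair_measure)
  then show ?thesis
  proof induction
    case (Basic X)
    then obtain a b where X: "X = a \<times> b" "a \<in> sets M" "b \<in> sets N" by auto
    have "a \<subseteq> space M" using X(2) by (rule sets.sets_into_space)
    then have "a \<in> sets (sigma (space M) (range (\<lambda>_::nat. a)))"
      by (subst sets_measure_of) (auto intro: sigma_sets.Basic)
    then have "X \<in> sets (?Q (\<lambda>_. a))" using X by (simp add: pair_measureI)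
    then show ?case using X(2) by (intro exI[of _ "\<lambda>_. a"]) simp
  next
    case Empty
    show ?case by (intro exI[of _ "\<lambda>_. {}"]) auto
  next
    case (Compl X)
    then obtain a where a: "range a \<subseteq> sets M" "X \<in> sets (?Q a)" by auto
    from sets.compl_sets[OF a(2)] have "space M \<times> space N - X \<in> sets (?Q a)"
      by (simp only: sp)
    with a(1) show ?case by blast
  next
    case (Union X)
    then obtain a where a: "\<And>i. range (a i) \<subseteq> sets M" "\<And>i. X i \<in> sets (?Q (a i))" by metis
    define b where "b = (\<lambda>k. case prod_decode k of (i, j) \<Rightarrow> a i j)"
    have b: "range b \<subseteq> sets M" using a(1) unfolding b_def by (force split: prod.splits)
    have ab: "range (a i) \<subseteq> range b" for i
    proof (rule image_subsetI)
      fix j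
      have "a i j = b (prod_encode (i, j))" by (simp add: b_def)
      then show "a i j \<in> range b" by blast
    qed
    have id: "(\<lambda>x. x) \<in> ?Q b \<rightarrow>\<^sub>M ?Q (a i)" for i
    proof -
      have "(\<lambda>x. x) \<in> sigma (space M) (range b) \<rightarrow>\<^sub>M sigma (space M) (range (a i))"
      proof (rule measurable_measure_of)
        show "range (a i) \<subseteq> Pow (space M)" using a(1)[of i] sets.sets_into_space by blast
        have bp: "range b \<subseteq> Pow (space M)" using b sets.sets_into_space by blast
        show "(\<lambda>x. x) \<in> space (sigma (space M) (range b)) \<rightarrow> space M"
          using bp by (simp add: space_measure_of)
        fix y assume y: "y \<in> range (a i)"
        then have "y \<in> range b" using ab by blast
        moreover have "y \<subseteq> space M" using \<open>y \<in> range b\<close> bp by blast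
        ultimately show "(\<lambda>x. x) -` y \<inter> space (sigma (space M) (range b)) \<in> sets (sigma (space M) (range b))"
          using bp by (auto simp: space_measure_of sets_measure_of Int_absorb2 intro: sigma_sets.Basic)
      qed
      from measurable_compose[OF measurable_fst this]
      have "(\<lambda>x. (fst x, snd x)) \<in> ?Q b \<rightarrow>\<^sub>M ?Q (a i)"
        by (rule measurable_Pair) measurable
      then show ?thesis by simp
    qed
    have "X i \<in> sets (?Q b)" for i
    proof -
      have "X i \<subseteq> space M \<times> space N" using sets.sets_into_space[OF a(2)] unfolding sp .
      then have "X i = (\<lambda>x. x) -` X i \<inter> space (?Q b)" unfolding sp by blast
      then show ?thesis using measurable_sets[OF id a(2)[of i]] by simp
    qed
    then show ?case using b by blast
  qed
qed

theorem sample_space_universal: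
  fixes F :: "'a::real_vector nspace" and G :: "'b::real_vector nspace" and M :: "'w measure"
  assumes F: "normed_space F" and G: "normed_space G"
    and S: "\<And>f. f \<in> pts F \<Longrightarrow> S f \<in> pts G"
    and alg: "randomized_algorithm F G n M L \<phi>"
  obtains M' :: "'b sample measure" and L' \<phi>'
  where "randomized_algorithm F G n M' L' \<phi>'"
    and "nonadaptive F n M L \<Longrightarrow> nonadaptive F n M' L'"
    and "mc_error F G S n M' L' \<phi>' = mc_error F G S n M L \<phi>"
proof -
  let ?A = "\<lambda>(\<omega>, f). alg_output n L \<phi> \<omega> f"
  let ?B = "norm_borel F"
  let ?O = "\<lambda>U. openin (norm_topology G) U"
  interpret P: prob_space M using alg by (simp add: randomized_algorithm_def)
  interpret GM: Metric_space "pts G" "ndist G" by (rule Metric_space_ndist[OF G])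
  have Am: "?A \<in> M \<Otimes>\<^sub>M ?B \<rightarrow>\<^sub>M norm_borel G" using alg by (simp add: randomized_algorithm_def)
  have spB: "space ?B = pts F" by (rule space_norm_borel[OF F])
  have AG: "alg_output n L \<phi> \<omega> f \<in> pts G" if "\<omega> \<in> space M" "f \<in> pts F" for \<omega> f
    using measurable_space[OF Am, of "(\<omega>, f)"] that
    by (simp add: space_pair_measure spB space_norm_borel[OF G])
  have "\<exists>a::nat \<Rightarrow> 'w set. range a \<subseteq> sets M \<and>
      (?O U \<longrightarrow> ?A -` U \<inter> (space M \<times> pts F) \<in> sets (sigma (space M) (range a) \<Otimes>\<^sub>M ?B))" for U
  proof (cases "?O U")
    case True
    from measurable_sets[OF Am sets_norm_borel_open[OF G True]]
    have "?A -` U \<inter> (space M \<times> pts F) \<in> sets (M \<Otimes>\<^sub>M ?B)"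
      by (simp add: space_pair_measure spB)
    from sets_pair_countably_generated[OF this] show ?thesis by blast
  qed (auto intro!: exI[of _ "\<lambda>_. {}"])
  then obtain a :: "'b set \<Rightarrow> nat \<Rightarrow> 'w set" where a: "\<And>U. range (a U) \<subseteq> sets M"
    and aU: "\<And>U. ?O U \<Longrightarrow> ?A -` U \<inter> (space M \<times> pts F) \<in> sets (sigma (space M) (range (a U)) \<Otimes>\<^sub>M ?B)"
    by metis
  define c where "c \<omega> = {(U, k). \<omega> \<in> a U k}" for \<omega>
  define N where "N = sigma (UNIV :: 'b sample set) (range (\<lambda>p. {s. p \<in> s}))"
  have spN: "space N = UNIV" by (simp add: N_def)
  have gN: "{s. p \<in> s} \<in> sets N" for p
    unfolding N_def by (subst sets_measure_of) (auto intro: sigma_sets.Basic)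
  have cN: "c \<in> M \<rightarrow>\<^sub>M N"
    unfolding N_def
  proof (rule measurable_measure_of)
    fix y :: "'b sample set" assume "y \<in> range (\<lambda>p. {s. p \<in> s})"
    then obtain U k where "y = {s. (U, k) \<in> s}" by auto
    then have "c -` y \<inter> space M = a U k \<inter> space M" by (auto simp: c_def)
    then show "c -` y \<inter> space M \<in> sets M" using a[of U] by auto
  qed auto
  let ?h = "\<lambda>(\<omega>, f). (c \<omega>, f)"
  have "\<exists>Y\<in>sets (N \<Otimes>\<^sub>M ?B). ?A -` U \<inter> (space M \<times> pts F) = ?h -` Y \<inter> (space M \<times> pts F)"
    if U: "?O U" for U
  proof -
    let ?P = "vimage_algebra (space M \<times> pts F) ?h (N \<Otimes>\<^sub>M ?B)"
    have hP: "?h \<in> ?P \<rightarrow>\<^sub>M N \<Otimes>\<^sub>M ?B"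
      by (rule measurable_vimage_algebra1) (auto simp: space_pair_measure spN spB)
    have aP: "range (a U) \<subseteq> Pow (space M)" using a[of U] sets.sets_into_space by blast
    have "fst \<in> ?P \<rightarrow>\<^sub>M sigma (space M) (range (a U))"
    proof (rule measurable_measure_of[OF aP])
      fix y assume "y \<in> range (a U)"
      then obtain k where k: "y = a U k" by auto
      have "fst -` y \<inter> space ?P = (fst \<circ> ?h) -` {s. (U, k) \<in> s} \<inter> space ?P"
        by (auto simp: k c_def)
      also have "\<dots> \<in> sets ?P"
        by (rule measurable_sets[OF measurable_comp[OF hP measurable_fst] gN])
      finally show "fst -` y \<inter> space ?P \<in> sets ?P" .
    qed auto
    moreover have "snd \<in> ?P \<rightarrow>\<^sub>M ?B"
    proof -
      have "(snd \<circ> ?h) \<in> ?P \<rightarrow>\<^sub>M ?B" by (rule measurable_comp[OF hP measurable_snd])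
      moreover have "snd \<circ> ?h = snd" by auto
      ultimately show ?thesis by metis
    qed
    ultimately have "(\<lambda>x. (fst x, snd x)) \<in> ?P \<rightarrow>\<^sub>M sigma (space M) (range (a U)) \<Otimes>\<^sub>M ?B"
      by (rule measurable_Pair)
    from measurable_sets[OF this aU[OF U]]
    have "?A -` U \<inter> (space M \<times> pts F) \<in> sets ?P" by (simp add: Int_assoc)
    then show ?thesis
      by (subst (asm) sets_vimage_algebra2) (auto simp: space_pair_measure spN spB)
  qed
  then obtain Y where Y: "\<And>U. ?O U \<Longrightarrow> Y U \<in> sets (N \<Otimes>\<^sub>M ?B)"
    and AY: "\<And>U. ?O U \<Longrightarrow> ?A -` U \<inter> (space M \<times> pts F) = ?h -` Y U \<inter> (space M \<times> pts F)"
    by metis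
  have AYm: "alg_output n L \<phi> \<omega> f \<in> U \<longleftrightarrow> (c \<omega>, f) \<in> Y U"
    if "?O U" "\<omega> \<in> space M" "f \<in> pts F" for U \<omega> f
    using AY[OF that(1)] that(2,3) by (auto simp: set_eq_iff)
  have Ac: "alg_output n L \<phi> \<omega> f = alg_output n L \<phi> \<omega>' f"
    if w: "\<omega> \<in> space M" "\<omega>' \<in> space M" "c \<omega> = c \<omega>'" "f \<in> pts F" for \<omega> \<omega>' f
  proof (rule ccontr)
    assume ne: "alg_output n L \<phi> \<omega> f \<noteq> alg_output n L \<phi> \<omega>' f"
    let ?U = "pts G - {alg_output n L \<phi> \<omega>' f}"
    have "?O ?U"
      using AG[OF w(2,4)] closedin_Hausdorff_sing_eq[OF GM.Hausdorff_space_mtopology]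
      by (auto simp: norm_topology_def closedin_def)
    from AYm[OF this w(1,4)] AYm[OF this w(2,4)] w(3) AG[OF w(1,4)] ne show False by simp
  qed
  define v where "v = inv_into (space M) c"
  define R where "R = restrict_space N (c ` space M)"
  define M' where "M' = distr M R c"
  define L' where "L' s = L (v s)" for s
  define \<phi>' where "\<phi>' s = \<phi> (v s)" for s
  have spR: "space R = c ` space M" by (simp add: R_def space_restrict_space spN)
  have spM': "space M' = c ` space M" by (simp add: M'_def spR)
  have setsM': "sets M' = sets R" by (simp add: M'_def)
  have cR: "c \<in> M \<rightarrow>\<^sub>M R" unfolding R_def by (rule measurable_restrict_space2) (use cN in auto)
  have vM: "v s \<in> space M" "c (v s) = s" if "s \<in> space M'" for s
    using that by (auto simp: v_def spM' inv_into_into f_inv_into_f)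
  have out: "alg_output n L' \<phi>' s f = alg_output n L \<phi> (v s) f" for s f
    by (simp add: alg_output_def L'_def \<phi>'_def)
  have outc: "alg_output n L' \<phi>' (c \<omega>) f = alg_output n L \<phi> \<omega> f" if "\<omega> \<in> space M" "f \<in> pts F" for \<omega> f
    using that vM[of "c \<omega>"] by (auto simp: out spM' intro!: Ac)
  let ?A' = "\<lambda>(s, f). alg_output n L' \<phi>' s f"
  have A'm: "?A' \<in> R \<Otimes>\<^sub>M ?B \<rightarrow>\<^sub>M norm_borel G"
    unfolding norm_borel_def[of G]
  proof (rule measurable_measure_of)
    show "{U. ?O U} \<subseteq> Pow (pts G)" using open_subset_pts[OF G] by auto
    show "?A' \<in> space (R \<Otimes>\<^sub>M ?B) \<rightarrow> pts G"
      using AG outc by (auto simp: space_pair_measure spR spB)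
    fix U assume "U \<in> {U. ?O U}"
    then have U: "?O U" by simp
    have "(\<lambda>x. x) \<in> R \<rightarrow>\<^sub>M N" unfolding R_def by (rule measurable_restrict_space1) simp
    then have "(\<lambda>x. (fst x, snd x)) \<in> R \<Otimes>\<^sub>M ?B \<rightarrow>\<^sub>M N \<Otimes>\<^sub>M ?B"
      by (intro measurable_Pair) (auto intro: measurable_compose[OF measurable_fst])
    from measurable_sets[OF this Y[OF U]]
    have "Y U \<inter> space (R \<Otimes>\<^sub>M ?B) \<in> sets (R \<Otimes>\<^sub>M ?B)" by simp
    moreover have "?A' -` U \<inter> space (R \<Otimes>\<^sub>M ?B) = Y U \<inter> space (R \<Otimes>\<^sub>M ?B)"
      using AYm[OF U] by (auto simp: space_pair_measure spR spB outc)
    ultimately show "?A' -` U \<inter> space (R \<Otimes>\<^sub>M ?B) \<in> sets (R \<Otimes>\<^sub>M ?B)" by simp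
  qed
  have 1: "randomized_algorithm F G n M' L' \<phi>'"
    unfolding randomized_algorithm_def
  proof (intro conjI)
    show "prob_space M'" unfolding M'_def by (rule P.prob_space_distr[OF cR])
    show "?A' \<in> M' \<Otimes>\<^sub>M ?B \<rightarrow>\<^sub>M norm_borel G"
      using A'm measurable_cong_sets[OF sets_pair_measure_cong[OF setsM' refl] refl] by blast
  qed (use alg vM in \<open>auto simp: randomized_algorithm_def L'_def \<phi>'_def\<close>)
  have 2: "nonadaptive F n M' L'" if "nonadaptive F n M L"
    using that vM unfolding nonadaptive_def L'_def by blast
  have 3: "mc_error F G S n M' L' \<phi>' = mc_error F G S n M L \<phi>"
    unfolding mc_error_def
  proof (rule SUP_cong[OF refl])
    fix f assume "f \<in> {f \<in> pts F. nrm F f \<le> 1}"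
    then have f: "f \<in> pts F" by simp
    have "(\<lambda>s. (s, f)) \<in> R \<rightarrow>\<^sub>M R \<Otimes>\<^sub>M ?B" by (rule measurable_Pair2') (simp add: f spB)
    from measurable_compose[OF this A'm]
    have "(\<lambda>s. alg_output n L' \<phi>' s f) \<in> R \<rightarrow>\<^sub>M norm_borel G" by simp
    from measurable_compose[OF this nrm_diff_measurable[OF G S[OF f]]]
    have m: "(\<lambda>s. ennreal (nrm G (alg_output n L' \<phi>' s f - S f))) \<in> borel_measurable R"
      by measurable
    then have m': "(\<lambda>s. ennreal (nrm G (alg_output n L' \<phi>' s f - S f))) \<in> borel_measurable (distr M R c)"
      by simp
    show "(\<integral>\<^sup>+ s. ennreal (nrm G (alg_output n L' \<phi>' s f - S f)) \<partial>M') =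
      (\<integral>\<^sup>+ \<omega>. ennreal (nrm G (alg_output n L \<phi> \<omega> f - S f)) \<partial>M)"
      unfolding M'_def by (subst nn_integral_distr[OF cR m']) (auto intro!: nn_integral_cong simp: outc f)
  qed
  show thesis by (rule that[OF 1 2 3])
qed

end

theory Submission
  imports Defs
begin

text \<open>
  The operator is a diagonal operator from \<open>\<ell>\<^sub>1\<close> to \<open>\<ell>\<^sub>\<infinity>\<close>, constant on blocks; the block
  \<open>j\<close> has weight \<open>2 ^ - j * (j + 1) powr - (1 + \<alpha>)\<close> and \<open>exp (exp (O(2 ^ j)))\<close> coordinates.

  A nonadaptive algorithm with \<open>n\<close> measurements cannot locate a spike in a block of
  \<open>2 ^ (42 * n\<^sup>2)\<close> coordinates.  Hide the spike in noise that is uniform on a small cube spanned by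
  \<open>4 * n\<close> random coordinates.  For most spikes the information of the spike is a bounded combination of the
  information of the noise vectors, and by pigeonhole almost all spikes share nearly the same
  coefficients with another one, so a small shift of the noise exchanges the two.

  An adaptive algorithm hashes each block into buckets in which a large coordinate dominates the rest
  in the \<open>\<ell>\<^sub>1\<close> sense, and finds it there by iterated random labelling: each round doubles the number of
  known bits of its code, so that the number of rounds is only doubly logarithmic in the block size.
  With about \<open>2 ^ k\<close> times the weight as the number of buckets and \<open>k\<close> repetitions in each block, the
  \<open>O(k * 2 ^ k)\<close> measurements yield the error \<open>O(2 ^ - k)\<close>.
\<close>

section \<open>Bounded operators and measurability\<close>


text \<open>One functional with distinct values on the unit vectors identifies a noiseless spike:
  real measurements have unlimited precision, so counting alone cannot defeat them. The noise
  destroys this precision. It has 4n coordinates because up to n columns of the information matrix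
  may resist a bounded representation by the others, and only a small fraction of the spike
  positions may be lost to them. Spikes are confused when 4n coefficients of size up to 2^n agree to
  within about n^-2; this is what forces 2^O(n^2) coordinates, and a single operator that serves all
  n needs infinitely many growing blocks. The weights balance two demands. Block j costs O(2^j)
  measurements per bucket, and the number of buckets is proportional to its weight; the factor 2^-j
  cancels that cost, and the factor (j+1)^-(1+\<alpha>) makes the sum over all j converge, which is
  how \<alpha> > 0 enters the rate. Against n measurements the hard block has 2^j of order ln n,
  hence weight at least of order 1 / (ln n (ln ln n)^(1+\<alpha>)). The adaptive error is of order
  ln n / n, and the quotient is the claimed rate.\<close>

lemma openin_norm_topology_iff:
  assumes E: "normed_space E"
  shows "openin (norm_topology E) U \<longleftrightarrow>
    U \<subseteq> pts E \<and> (\<forall>x\<in>U. \<exists>r>0. \<forall>y\<in>pts E. nrm E (y - x) < r \<longrightarrow> y \<in> U)"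
proof -
  interpret Metric_space "pts E" "ndist E" by (rule Metric_space_ndist[OF E])
  have "mball x r = {y \<in> pts E. nrm E (y - x) < r}" if "x \<in> pts E" for x r
    using that commute[of x] by (auto simp: mball_def ndist_def)
  then have *: "mball x r \<subseteq> U \<longleftrightarrow> (\<forall>y\<in>pts E. nrm E (y - x) < r \<longrightarrow> y \<in> U)" if "x \<in> pts E" for x r
    using that by auto
  show ?thesis
    unfolding norm_topology_def openin_mtopology using * by (safe; metis subsetD)
qed

lemma topspace_norm_topology:
  "normed_space E \<Longrightarrow> topspace (norm_topology E) = pts E"
  using Metric_space.topspace_mtopology[OF Metric_space_ndist] by (simp add: norm_topology_def)

lemma continuous_map_norm_topology:
  assumes E: "normed_space E" and E': "normed_space E'"
    and T: "linear_between (pts E) (pts E') T"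
    and C: "\<And>x. x \<in> pts E \<Longrightarrow> nrm E' (T x) \<le> C * nrm E x"
  shows "continuous_map (norm_topology E) (norm_topology E') T"
  unfolding continuous_map_def topspace_norm_topology[OF E] topspace_norm_topology[OF E']
proof (intro conjI allI impI)
  show "T \<in> pts E \<rightarrow> pts E'" using T by (auto simp: linear_between_def)
  fix U assume U: "openin (norm_topology E') U"
  have Tdiff: "T (y - x) = T y - T x" if "x \<in> pts E" "y \<in> pts E" for x y
  proof -
    have "- 1 *\<^sub>R x \<in> pts E"
      using E that subspace_scale by (metis normed_space_def)
    then have "T (y + - 1 *\<^sub>R x) = T y + - 1 *\<^sub>R T x"
      using T that unfolding linear_between_def by metis
    then show ?thesis by simp
  qed
  show "openin (norm_topology E) {x \<in> pts E. T x \<in> U}"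
    unfolding openin_norm_topology_iff[OF E]
  proof (intro conjI ballI)
    fix x assume x: "x \<in> {x \<in> pts E. T x \<in> U}"
    then obtain r where r: "r > 0" "\<And>z. z \<in> pts E' \<Longrightarrow> nrm E' (z - T x) < r \<Longrightarrow> z \<in> U"
      using U unfolding openin_norm_topology_iff[OF E'] by blast
    \<comment> \<open>\<open>C\<close> is an arbitrary real; \<open>\<bar>C\<bar> + 1\<close> is a
      positive bound in every case.\<close>
    define \<delta> where "\<delta> = r / (\<bar>C\<bar> + 1)"
    have "T y \<in> U" if y: "y \<in> pts E" "nrm E (y - x) < \<delta>" for y
    proof (rule r(2))
      show "T y \<in> pts E'" using T y by (auto simp: linear_between_def)
      have d: "y - x \<in> pts E" using E x y subspace_diff by (auto simp: normed_space_def)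
      then have nn: "0 \<le> nrm E (y - x)" using E by (auto simp: normed_space_def)
      have "nrm E' (T y - T x) \<le> C * nrm E (y - x)"
        using C[OF d] Tdiff x y by simp
      also have "\<dots> \<le> (\<bar>C\<bar> + 1) * nrm E (y - x)" by (intro mult_right_mono nn) simp
      also have "\<dots> < r" using y(2) by (simp add: \<delta>_def pos_less_divide_eq mult.commute)
      finally show "nrm E' (T y - T x) < r" .
    qed
    moreover have "\<delta> > 0" using r by (auto simp: \<delta>_def intro!: divide_pos_pos)
    ultimately show "\<exists>r>0. \<forall>y\<in>pts E. nrm E (y - x) < r \<longrightarrow> y \<in> {x \<in> pts E. T x \<in> U}" by auto
  qed auto
qed

text \<open>With the real line as an \<open>nspace\<close>, the continuity criterion for operators
  covers functionals too.\<close>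

definition real_space :: "real nspace"
  where "real_space = \<lparr>pts = UNIV, nrm = abs\<rparr>"

lemma normed_real_space: "normed_space real_space"
  by (auto simp: normed_space_def real_space_def abs_mult)

lemma norm_topology_real_space: "norm_topology real_space = euclideanreal"
proof -
  have "ndist real_space = dist" by (auto simp: ndist_def real_space_def dist_real_def fun_eq_iff)
  then show ?thesis by (simp add: norm_topology_def real_space_def)
qed

lemma dual_spaceI:
  assumes E: "normed_space E" and T: "linear_between (pts E) UNIV T"
    and C: "\<And>x. x \<in> pts E \<Longrightarrow> \<bar>T x\<bar> \<le> C * nrm E x"
  shows "T \<in> dual_space E"
  using continuous_map_norm_topology[OF E normed_real_space, of T C] T C
  by (simp add: dual_space_def norm_topology_real_space) (simp add: real_space_def)

lemma continuous_map_measurable_norm_borel: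
  assumes E: "normed_space E" and E': "normed_space E'"
    and T: "continuous_map (norm_topology E) (norm_topology E') T"
  shows "T \<in> norm_borel E \<rightarrow>\<^sub>M norm_borel E'"
  unfolding norm_borel_def[of E']
proof (rule measurable_measure_of)
  show "{U. openin (norm_topology E') U} \<subseteq> Pow (pts E')" using open_subset_pts[OF E'] by auto
  show "T \<in> space (norm_borel E) \<rightarrow> pts E'"
    using T by (auto simp: space_norm_borel[OF E] continuous_map_def topspace_norm_topology E E')
  fix U assume "U \<in> {U. openin (norm_topology E') U}"
  then have "openin (norm_topology E) {x \<in> pts E. T x \<in> U}"
    using T by (simp add: continuous_map_def topspace_norm_topology E)
  then have "{x \<in> pts E. T x \<in> U} \<in> sets (norm_borel E)" by (rule sets_norm_borel_open[OF E])
  moreover have "T -` U \<inter> space (norm_borel E) = {x \<in> pts E. T x \<in> U}"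
    by (auto simp: space_norm_borel[OF E])
  ultimately show "T -` U \<inter> space (norm_borel E) \<in> sets (norm_borel E)" by simp
qed

lemma dual_space_measurable:
  assumes E: "normed_space E" and T: "T \<in> dual_space E"
  shows "T \<in> borel_measurable (norm_borel E)"
proof (rule borel_measurableI)
  fix U :: "real set" assume "open U"
  then have "openin (norm_topology E) {x \<in> pts E. T x \<in> U}"
    using T by (simp add: dual_space_def continuous_map_def topspace_norm_topology E)
  then have "{x \<in> pts E. T x \<in> U} \<in> sets (norm_borel E)" by (rule sets_norm_borel_open[OF E])
  moreover have "T -` U \<inter> space (norm_borel E) = {x \<in> pts E. T x \<in> U}"
    by (auto simp: space_norm_borel[OF E])
  ultimately show "T -` U \<inter> space (norm_borel E) \<in> sets (norm_borel E)" by simp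
qed

section \<open>The sequence spaces\<close>

definition ell1 :: "(nat \<Rightarrow> real) nspace"
  where "ell1 = \<lparr>pts = {f. summable (\<lambda>i. \<bar>f i\<bar>)}, nrm = (\<lambda>f. \<Sum>i. \<bar>f i\<bar>)\<rparr>"

definition ell_inf :: "(nat \<Rightarrow> real) nspace"
  where "ell_inf = \<lparr>pts = {f. bounded (range f)}, nrm = (\<lambda>f. SUP i. \<bar>f i\<bar>)\<rparr>"

lemma pts_ell1: "f \<in> pts ell1 \<longleftrightarrow> summable (\<lambda>i. \<bar>f i\<bar>)"
  and nrm_ell1: "nrm ell1 f = (\<Sum>i. \<bar>f i\<bar>)"
  by (simp_all add: ell1_def)

lemma pts_ell_inf: "f \<in> pts ell_inf \<longleftrightarrow> (\<exists>C. \<forall>i. \<bar>f i\<bar> \<le> C)"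
  and nrm_ell_inf: "nrm ell_inf f = (SUP i. \<bar>f i\<bar>)"
  by (auto simp: ell_inf_def bounded_iff)

lemma bdd_above_ell_inf: "f \<in> pts ell_inf \<Longrightarrow> bdd_above (range (\<lambda>i. \<bar>f i\<bar>))"
  by (auto simp: pts_ell_inf bdd_above_def)

lemma abs_le_nrm_ell_inf: "f \<in> pts ell_inf \<Longrightarrow> \<bar>f i\<bar> \<le> nrm ell_inf f"
  unfolding nrm_ell_inf by (rule cSUP_upper[OF UNIV_I bdd_above_ell_inf])

lemma nrm_ell_inf_le: "(\<And>i. \<bar>f i\<bar> \<le> C) \<Longrightarrow> nrm ell_inf f \<le> C"
  unfolding nrm_ell_inf by (rule cSUP_least) auto

lemma abs_le_nrm_ell1: "f \<in> pts ell1 \<Longrightarrow> \<bar>f i\<bar> \<le> nrm ell1 f"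
  unfolding nrm_ell1 pts_ell1 using sum_le_suminf[of "\<lambda>i. \<bar>f i\<bar>" "{i}"] by simp

lemma sum_le_nrm_ell1: "f \<in> pts ell1 \<Longrightarrow> finite I \<Longrightarrow> (\<Sum>i\<in>I. \<bar>f i\<bar>) \<le> nrm ell1 f"
  unfolding nrm_ell1 pts_ell1 by (rule sum_le_suminf) auto

lemma ell1_nonneg: "f \<in> pts ell1 \<Longrightarrow> 0 \<le> nrm ell1 f"
  using sum_le_nrm_ell1[of f "{}"] by simp

lemma pts_ell1I:
  assumes "\<And>M. (\<Sum>i<M. \<bar>f i\<bar>) \<le> C"
  shows "f \<in> pts ell1" "nrm ell1 f \<le> C"
proof -
  show f: "f \<in> pts ell1" unfolding pts_ell1
    by (rule summableI_nonneg_bounded) (use assms in auto)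
  then show "nrm ell1 f \<le> C"
    unfolding pts_ell1 nrm_ell1 by (rule suminf_le_const) (rule assms)
qed

lemma normed_ell1: "normed_space ell1"
  unfolding normed_space_def
proof (intro conjI ballI allI)
  have add: "f + g \<in> pts ell1 \<and> nrm ell1 (f + g) \<le> nrm ell1 f + nrm ell1 g"
    if f: "f \<in> pts ell1" and g: "g \<in> pts ell1" for f g
  proof -
    have "(\<Sum>i<M. \<bar>(f + g) i\<bar>) \<le> nrm ell1 f + nrm ell1 g" for M
    proof -
      have "(\<Sum>i<M. \<bar>(f + g) i\<bar>) \<le> (\<Sum>i<M. \<bar>f i\<bar>) + (\<Sum>i<M. \<bar>g i\<bar>)"
        unfolding sum.distrib[symmetric] by (rule sum_mono) (simp add: plus_fun_def abs_triangle_ineq)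
      then show ?thesis using sum_le_nrm_ell1[OF f, of "{..<M}"] sum_le_nrm_ell1[OF g, of "{..<M}"]
        by simp
    qed
    then show ?thesis using pts_ell1I by metis
  qed
  have scale: "c *\<^sub>R f \<in> pts ell1" "nrm ell1 (c *\<^sub>R f) = \<bar>c\<bar> * nrm ell1 f"
    if f: "f \<in> pts ell1" for f c
    using f by (simp_all add: pts_ell1 nrm_ell1 scaleR_fun_def abs_mult summable_mult suminf_mult)
  show "subspace (pts ell1)"
    unfolding subspace_def using add scale by (auto simp: pts_ell1 zero_fun_def)
  fix f assume f: "f \<in> pts ell1"
  show "0 \<le> nrm ell1 f" using f by (rule ell1_nonneg)
  show "nrm ell1 f = 0 \<longleftrightarrow> f = 0"
    using abs_le_nrm_ell1[OF f] by (auto simp: fun_eq_iff nrm_ell1 zero_fun_def)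
  show "nrm ell1 (c *\<^sub>R f) = \<bar>c\<bar> * nrm ell1 f" for c using scale f by blast
  show "nrm ell1 (f + g) \<le> nrm ell1 f + nrm ell1 g" if "g \<in> pts ell1" for g using add f that by blast
qed

lemma normed_ell_inf: "normed_space ell_inf"
  unfolding normed_space_def
proof (intro conjI ballI allI)
  have add: "\<bar>(f + g) i\<bar> \<le> nrm ell_inf f + nrm ell_inf g"
    if f: "f \<in> pts ell_inf" and g: "g \<in> pts ell_inf" for f g i
    using abs_le_nrm_ell_inf[OF f, of i] abs_le_nrm_ell_inf[OF g, of i] by (simp add: plus_fun_def)
  have scale: "c *\<^sub>R f \<in> pts ell_inf" if f: "f \<in> pts ell_inf" for f c
    unfolding pts_ell_inf
    by (intro exI[of _ "\<bar>c\<bar> * nrm ell_inf f"] allI)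
      (auto simp: scaleR_fun_def abs_mult intro!: mult_left_mono abs_le_nrm_ell_inf[OF f])
  show "subspace (pts ell_inf)"
    unfolding subspace_def
  proof (intro conjI ballI allI)
    show "0 \<in> pts ell_inf" by (auto simp: pts_ell_inf zero_fun_def)
    show "f + g \<in> pts ell_inf" if "f \<in> pts ell_inf" "g \<in> pts ell_inf" for f g
      using add[OF that] unfolding pts_ell_inf by blast
  qed (use scale in blast)
  fix f assume f: "f \<in> pts ell_inf"
  show nn: "0 \<le> nrm ell_inf f" using abs_le_nrm_ell_inf[OF f, of 0] by linarith
  show "nrm ell_inf f = 0 \<longleftrightarrow> f = 0"
    using abs_le_nrm_ell_inf[OF f] by (auto simp: fun_eq_iff nrm_ell_inf zero_fun_def)
  show "nrm ell_inf (f + g) \<le> nrm ell_inf f + nrm ell_inf g" if "g \<in> pts ell_inf" for g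
    using add f that by (blast intro: nrm_ell_inf_le)
  have le: "nrm ell_inf (c *\<^sub>R f) \<le> \<bar>c\<bar> * nrm ell_inf f" if f: "f \<in> pts ell_inf" for f c
    by (rule nrm_ell_inf_le)
      (auto simp: scaleR_fun_def abs_mult intro!: mult_left_mono abs_le_nrm_ell_inf[OF f])
  show "nrm ell_inf (c *\<^sub>R f) = \<bar>c\<bar> * nrm ell_inf f" for c
  proof (cases "c = 0")
    case False
    \<comment> \<open>The reverse inequality is the upper bound applied to the inverse
      scaling.\<close>
    have "nrm ell_inf (inverse c *\<^sub>R (c *\<^sub>R f)) \<le> \<bar>inverse c\<bar> * nrm ell_inf (c *\<^sub>R f)"
      by (rule le[OF scale[OF f]])
    then have "\<bar>c\<bar> * nrm ell_inf f \<le> nrm ell_inf (c *\<^sub>R f)"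
      using False by (simp add: field_simps)
    then show ?thesis using le[OF f, of c] by simp
  qed (auto simp: nrm_ell_inf zero_fun_def)
qed

text \<open>Both norms are lower semicontinuous under pointwise convergence, which turns a pointwise
  limit of a Cauchy sequence into a norm limit.\<close>

lemma banach_spaceI:
  fixes E :: "(nat \<Rightarrow> real) nspace"
  assumes E: "normed_space E"
    and coord: "\<And>f i. f \<in> pts E \<Longrightarrow> \<bar>f i\<bar> \<le> nrm E f"
    and lsc: "\<And>X g C. (\<And>n. X n \<in> pts E \<and> nrm E (X n) \<le> C) \<Longrightarrow> (\<And>i. (\<lambda>n. X n i) \<longlonglongrightarrow> g i) \<Longrightarrow>
      g \<in> pts E \<and> nrm E g \<le> C"
  shows "banach_space E"
proof -
  interpret Metric_space "pts E" "ndist E" by (rule Metric_space_ndist[OF E])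
  have sub: "subspace (pts E)" using E by (simp add: normed_space_def)
  have "\<exists>g. limitin mtopology X g sequentially" if "MCauchy X" for X
  proof -
    have X: "X n \<in> pts E" for n using that by (auto simp: MCauchy_def)
    have C: "\<exists>N. \<forall>n\<ge>N. \<forall>k\<ge>N. nrm E (X n - X k) < \<epsilon>" if "\<epsilon> > 0" for \<epsilon>
      using \<open>MCauchy X\<close> that X by (fastforce simp: MCauchy_def ndist_def)
    have "Cauchy (\<lambda>n. X n i)" for i
    proof (rule metric_CauchyI)
      fix \<epsilon> :: real assume "\<epsilon> > 0"
      from C[OF this] obtain N where N: "\<And>n k. n \<ge> N \<Longrightarrow> k \<ge> N \<Longrightarrow> nrm E (X n - X k) < \<epsilon>" by blast
      have "dist (X n i) (X k i) < \<epsilon>" if "n \<ge> N" "k \<ge> N" for n k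
        using coord[OF subspace_diff[OF sub X X], of n k i] N[OF that]
        by (simp add: dist_real_def fun_diff_def)
      then show "\<exists>N. \<forall>n\<ge>N. \<forall>k\<ge>N. dist (X n i) (X k i) < \<epsilon>" by blast
    qed
    then have "\<exists>l. (\<lambda>n. X n i) \<longlonglongrightarrow> l" for i by (simp add: Cauchy_convergent_iff convergent_def)
    then obtain g where g: "\<And>i. (\<lambda>n. X n i) \<longlonglongrightarrow> g i" by metis
    \<comment> \<open>Lower semicontinuity is applied to the tail of the differences: it asks for
      the bound at every index, so the sequence is shifted by \<open>N\<close>.\<close>
    have bd: "g - X n \<in> pts E \<and> nrm E (g - X n) \<le> \<epsilon>"
      if "\<And>k. k \<ge> N \<Longrightarrow> nrm E (X k - X n) \<le> \<epsilon>" for N n \<epsilon>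
    proof (rule lsc[of "\<lambda>k. X (k + N) - X n"])
      show "X (k + N) - X n \<in> pts E \<and> nrm E (X (k + N) - X n) \<le> \<epsilon>" for k
        using that[of "k + N"] subspace_diff[OF sub X X] by simp
      show "(\<lambda>k. (X (k + N) - X n) i) \<longlonglongrightarrow> (g - X n) i" for i
        unfolding fun_diff_def by (intro tendsto_intros LIMSEQ_ignore_initial_segment g)
    qed
    have lim: "\<exists>N. \<forall>n\<ge>N. g - X n \<in> pts E \<and> nrm E (g - X n) \<le> \<epsilon>" if "\<epsilon> > 0" for \<epsilon>
    proof -
      from C[OF that] obtain N where "\<And>n k. n \<ge> N \<Longrightarrow> k \<ge> N \<Longrightarrow> nrm E (X n - X k) < \<epsilon>" by blast
      then have "g - X n \<in> pts E \<and> nrm E (g - X n) \<le> \<epsilon>" if "n \<ge> N" for n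
        using that by (intro bd[of N]) (simp add: less_imp_le)
      then show ?thesis by blast
    qed
    \<comment> \<open>So far only differences with \<open>g\<close> are known to lie in the space;
      one of them suffices to place \<open>g\<close> there.\<close>
    from lim[OF zero_less_one] obtain n where "g - X n \<in> pts E" by blast
    from subspace_add[OF sub this X[of n]] have gE: "g \<in> pts E" by simp
    have "\<exists>N. \<forall>n\<ge>N. ndist E (X n) g < \<epsilon>" if "\<epsilon> > 0" for \<epsilon>
    proof -
      have "\<epsilon> / 2 > 0" using that by simp
      from lim[OF this] obtain N where "\<And>n. n \<ge> N \<Longrightarrow> nrm E (g - X n) \<le> \<epsilon> / 2" by blast
      then have "ndist E (X n) g < \<epsilon>" if "n \<ge> N" for n
        using \<open>\<epsilon> > 0\<close> that X gE commute[of "X n" g] by (fastforce simp: ndist_def)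
      then show ?thesis by blast
    qed
    then have "limitin mtopology X g sequentially"
      using X gE by (auto simp: limitin_metric eventually_sequentially)
    then show ?thesis by blast
  qed
  then show ?thesis using E by (auto simp: banach_space_def mcomplete_def)
qed

lemma banach_ell1: "banach_space ell1"
proof (rule banach_spaceI[OF normed_ell1 abs_le_nrm_ell1])
  fix X :: "nat \<Rightarrow> nat \<Rightarrow> real" and g C
  assume X: "\<And>n. X n \<in> pts ell1 \<and> nrm ell1 (X n) \<le> C" and g: "\<And>i. (\<lambda>n. X n i) \<longlonglongrightarrow> g i"
  have "(\<Sum>i<M. \<bar>g i\<bar>) \<le> C" for M
  proof (rule LIMSEQ_le_const2)
    show "(\<lambda>n. \<Sum>i<M. \<bar>X n i\<bar>) \<longlonglongrightarrow> (\<Sum>i<M. \<bar>g i\<bar>)" by (intro tendsto_intros g)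
    show "\<exists>N. \<forall>n\<ge>N. (\<Sum>i<M. \<bar>X n i\<bar>) \<le> C"
      using X sum_le_nrm_ell1 by (meson finite_lessThan order_trans)
  qed
  then show "g \<in> pts ell1 \<and> nrm ell1 g \<le> C" using pts_ell1I by blast
qed

lemma banach_ell_inf: "banach_space ell_inf"
proof (rule banach_spaceI[OF normed_ell_inf abs_le_nrm_ell_inf])
  fix X :: "nat \<Rightarrow> nat \<Rightarrow> real" and g C
  assume X: "\<And>n. X n \<in> pts ell_inf \<and> nrm ell_inf (X n) \<le> C" and g: "\<And>i. (\<lambda>n. X n i) \<longlonglongrightarrow> g i"
  have "\<bar>g i\<bar> \<le> C" for i
  proof (rule LIMSEQ_le_const2)
    show "(\<lambda>n. \<bar>X n i\<bar>) \<longlonglongrightarrow> \<bar>g i\<bar>" by (intro tendsto_intros g)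
    show "\<exists>N. \<forall>n\<ge>N. \<bar>X n i\<bar> \<le> C" using X abs_le_nrm_ell_inf by (meson order_trans)
  qed
  then show "g \<in> pts ell_inf \<and> nrm ell_inf g \<le> C" using nrm_ell_inf_le by (auto simp: pts_ell_inf)
qed

definition diag_op :: "(nat \<Rightarrow> real) \<Rightarrow> (nat \<Rightarrow> real) \<Rightarrow> nat \<Rightarrow> real"
  where "diag_op s f = (\<lambda>i. s i * f i)"

lemma linear_operator_diag_op:
  assumes "\<And>i. \<bar>s i\<bar> \<le> C"
  shows "linear_operator ell1 ell_inf (diag_op s)"
    and "f \<in> pts ell1 \<Longrightarrow> nrm ell_inf (diag_op s f) \<le> C * nrm ell1 f"
proof -
  have le: "\<bar>diag_op s f i\<bar> \<le> C * nrm ell1 f" if "f \<in> pts ell1" for f i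
    unfolding diag_op_def abs_mult using assms abs_le_nrm_ell1[OF that, of i]
    by (intro mult_mono) (auto intro: order_trans[OF abs_ge_zero])
  then have mem: "diag_op s f \<in> pts ell_inf" if "f \<in> pts ell1" for f
    using that unfolding pts_ell_inf by blast
  show n: "nrm ell_inf (diag_op s f) \<le> C * nrm ell1 f" if "f \<in> pts ell1" for f
    using le[OF that] by (rule nrm_ell_inf_le)
  have lin: "linear_between (pts ell1) (pts ell_inf) (diag_op s)"
    unfolding linear_between_def using mem
    by (auto simp: diag_op_def fun_eq_iff plus_fun_def scaleR_fun_def algebra_simps)
  show "linear_operator ell1 ell_inf (diag_op s)"
    unfolding linear_operator_def
    using lin continuous_map_norm_topology[OF normed_ell1 normed_ell_inf lin n] by blast
qed

section \<open>Lower bound\<close>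

text \<open>Gaussian elimination with partial pivoting, one pivot per functional.\<close>

lemma pivot_representation:
  fixes a :: "nat \<Rightarrow> 'i \<Rightarrow> real"
  assumes U: "finite U"
  shows "\<exists>J\<subseteq>U. card J \<le> n \<and>
    (\<forall>u\<in>U. \<exists>c. (\<forall>k<n. a k u = (\<Sum>l\<in>J. c l * a k l)) \<and> (\<Sum>l\<in>J. \<bar>c l\<bar>) \<le> 2 ^ n - 1)"
proof (induction n arbitrary: a)
  case 0
  show ?case by (intro exI[of _ "{}"]) auto
next
  case (Suc n)
  show ?case
  proof (cases "\<forall>u\<in>U. a n u = 0")
    case True
    from Suc.IH[of a] obtain J where J: "J \<subseteq> U" "card J \<le> n"
      and c: "\<And>u. u \<in> U \<Longrightarrow> \<exists>c. (\<forall>k<n. a k u = (\<Sum>l\<in>J. c l * a k l)) \<and> (\<Sum>l\<in>J. \<bar>c l\<bar>) \<le> 2 ^ n - 1"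
      by blast
    have le: "(2::real) ^ n - 1 \<le> 2 ^ Suc n - 1" by simp
    have "\<exists>c. (\<forall>k<Suc n. a k u = (\<Sum>l\<in>J. c l * a k l)) \<and> (\<Sum>l\<in>J. \<bar>c l\<bar>) \<le> 2 ^ Suc n - 1"
      if u: "u \<in> U" for u
    proof -
      from c[OF u] obtain c where c: "\<forall>k<n. a k u = (\<Sum>l\<in>J. c l * a k l)"
        and cs: "(\<Sum>l\<in>J. \<bar>c l\<bar>) \<le> 2 ^ n - 1" by blast
      have "(\<Sum>l\<in>J. c l * a n l) = 0" using True J(1) by (intro sum.neutral) auto
      then have "\<forall>k<Suc n. a k u = (\<Sum>l\<in>J. c l * a k l)" using c True u by (simp add: less_Suc_eq)
      then show ?thesis using cs le by (blast intro: order_trans)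
    qed
    then show ?thesis using J by (intro exI[of _ J]) auto
  next
    case False
    then have "U \<noteq> {}" by auto
    then obtain p where "p \<in> U" "\<bar>a n p\<bar> = Max ((\<lambda>u. \<bar>a n u\<bar>) ` U)"
      using Max_in[of "(\<lambda>u. \<bar>a n u\<bar>) ` U"] U by fastforce
    then have p: "p \<in> U" "\<And>u. u \<in> U \<Longrightarrow> \<bar>a n u\<bar> \<le> \<bar>a n p\<bar>"
      using U by simp_all
    have p0: "a n p \<noteq> 0" using False p by fastforce
    \<comment> \<open>Subtracting \<open>\<theta> u\<close> times the pivot column makes functional
      \<open>n\<close> vanish on every column, and the maximality of the pivot keeps the multipliers
      at most 1 in modulus.\<close>
    define \<theta> where "\<theta> u = a n u / a n p" for u
    have \<theta>: "\<bar>\<theta> u\<bar> \<le> 1" if "u \<in> U" for u using p(2)[OF that] p0 by (simp add: \<theta>_def divide_le_eq_1)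
    from Suc.IH[of "\<lambda>k u. a k u - \<theta> u * a k p"] obtain J where J: "J \<subseteq> U" "card J \<le> n"
      and c: "\<And>u. u \<in> U \<Longrightarrow> \<exists>c. (\<forall>k<n. a k u - \<theta> u * a k p = (\<Sum>l\<in>J. c l * (a k l - \<theta> l * a k p))) \<and>
        (\<Sum>l\<in>J. \<bar>c l\<bar>) \<le> 2 ^ n - 1"
      by blast
    have fJ: "finite J" using J(1) U by (rule finite_subset)
    show ?thesis
    proof (intro exI[of _ "insert p J"] conjI ballI)
      show "insert p J \<subseteq> U" using p J by simp
      show "card (insert p J) \<le> Suc n" using J(2) fJ by (simp add: card_insert_if)
      fix u assume u: "u \<in> U"
      from c[OF u] obtain c where c: "\<And>k. k < n \<Longrightarrow> a k u - \<theta> u * a k p = (\<Sum>l\<in>J. c l * (a k l - \<theta> l * a k p))"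
        and cs: "(\<Sum>l\<in>J. \<bar>c l\<bar>) \<le> 2 ^ n - 1" by blast
      \<comment> \<open>The pivot coefficient that makes functional \<open>n\<close> match. Since
        \<open>\<bar>d\<bar>\<close> is at most 1 plus the old coefficient sum s, the new sum is at
        most 2 s + 1, whence the bound \<open>2 ^ n - 1\<close>. The pivot may already be in
        \<open>J\<close>, so \<open>c'\<close> adds the two contributions.\<close>
      define d where "d = \<theta> u - (\<Sum>l\<in>J. c l * \<theta> l)"
      define c' where "c' l = (if l \<in> J then c l else 0) + (if l = p then d else 0)" for l
      have sum_c': "(\<Sum>l\<in>insert p J. c' l * b l) = (\<Sum>l\<in>J. c l * b l) + d * b p" for b :: "'i \<Rightarrow> real"
      proof -
        have "(\<Sum>l\<in>insert p J. c' l * b l) =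
          (\<Sum>l\<in>insert p J. (if l \<in> J then c l * b l else 0)) + (\<Sum>l\<in>insert p J. if l = p then d * b l else 0)"
          unfolding sum.distrib[symmetric] by (rule sum.cong) (auto simp: c'_def algebra_simps)
        also have "(\<Sum>l\<in>insert p J. (if l \<in> J then c l * b l else 0)) = (\<Sum>l\<in>J. c l * b l)"
          using fJ by (intro sum.mono_neutral_cong_right) auto
        also have "(\<Sum>l\<in>insert p J. if l = p then d * b l else 0) = d * b p"
          using fJ by (subst sum.delta) auto
        finally show ?thesis .
      qed
      have "\<bar>\<Sum>l\<in>J. c l * \<theta> l\<bar> \<le> (\<Sum>l\<in>J. \<bar>c l\<bar>)"
        using \<theta> J(1) by (intro order_trans[OF sum_abs] sum_mono) (auto simp: abs_mult intro!: mult_left_le)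
      then have d: "\<bar>d\<bar> \<le> 2 ^ n" using \<theta>[OF u] cs unfolding d_def by linarith
      have "(\<Sum>l\<in>insert p J. \<bar>c' l\<bar>) \<le>
          (\<Sum>l\<in>insert p J. (if l \<in> J then \<bar>c l\<bar> else 0)) + (\<Sum>l\<in>insert p J. if l = p then \<bar>d\<bar> else 0)"
        unfolding sum.distrib[symmetric] by (rule sum_mono) (auto simp: c'_def)
      also have "(\<Sum>l\<in>insert p J. (if l \<in> J then \<bar>c l\<bar> else 0)) = (\<Sum>l\<in>J. \<bar>c l\<bar>)"
        using fJ by (intro sum.mono_neutral_cong_right) auto
      also have "(\<Sum>l\<in>insert p J. if l = p then \<bar>d\<bar> else 0) = \<bar>d\<bar>"
        using fJ by (subst sum.delta) auto
      finally have "(\<Sum>l\<in>insert p J. \<bar>c' l\<bar>) \<le> 2 ^ Suc n - 1" using cs d by simp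
      moreover have "a k u = (\<Sum>l\<in>insert p J. c' l * a k l)" if "k < Suc n" for k
      proof (cases "k = n")
        case True
        have "(\<Sum>l\<in>J. c l * a n l) = (\<Sum>l\<in>J. c l * \<theta> l) * a n p"
          using p0 by (simp add: \<theta>_def sum_distrib_right)
        then show ?thesis unfolding sum_c' True using p0 by (simp add: d_def \<theta>_def left_diff_distrib)
      next
        case False
        then have "k < n" using that by simp
        from c[OF this] show ?thesis unfolding sum_c'
          by (simp add: d_def algebra_simps sum_subtractf sum_distrib_left)
      qed
      ultimately show "\<exists>c. (\<forall>k<Suc n. a k u = (\<Sum>l\<in>insert p J. c l * a k l)) \<and>
          (\<Sum>l\<in>insert p J. \<bar>c l\<bar>) \<le> 2 ^ Suc n - 1" by blast
    qed
  qed
qed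

definition bounded_combination ::
    "nat \<Rightarrow> (nat \<Rightarrow> 'i \<Rightarrow> real) \<Rightarrow> 'i set \<Rightarrow> 'i \<Rightarrow> ('i \<Rightarrow> real) \<Rightarrow> bool"
  where "bounded_combination n a I u c \<longleftrightarrow>
    (\<forall>k<n. a k u = (\<Sum>l\<in>I. c l * a k l)) \<and> (\<forall>l. \<bar>c l\<bar> \<le> 2 ^ n)"

text \<open>Only the pivots, at most \<open>n\<close> of them, can fail: for every other column the
  pivots all lie in \<open>U - {u}\<close>.\<close>

lemma card_not_bounded_combination:
  fixes a :: "nat \<Rightarrow> 'i \<Rightarrow> real"
  assumes U: "finite U"
  shows "card {u\<in>U. \<nexists>c. bounded_combination n a (U - {u}) u c} \<le> n"
proof -
  from pivot_representation[OF U, of n a] obtain J where J: "J \<subseteq> U" "card J \<le> n"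
    and c: "\<And>u. u \<in> U \<Longrightarrow> \<exists>c. (\<forall>k<n. a k u = (\<Sum>l\<in>J. c l * a k l)) \<and> (\<Sum>l\<in>J. \<bar>c l\<bar>) \<le> 2 ^ n - 1"
    by blast
  have fJ: "finite J" using J(1) U by (rule finite_subset)
  have "\<exists>c. bounded_combination n a (U - {u}) u c" if u: "u \<in> U" "u \<notin> J" for u
  proof -
    from c[OF u(1)] obtain c where c: "\<And>k. k < n \<Longrightarrow> a k u = (\<Sum>l\<in>J. c l * a k l)"
      and cs: "(\<Sum>l\<in>J. \<bar>c l\<bar>) \<le> 2 ^ n - 1" by blast
    define c' where "c' l = (if l \<in> J then c l else 0)" for l
    have "(\<Sum>l\<in>U - {u}. c' l * a k l) = (\<Sum>l\<in>J. c l * a k l)" for k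
      using U J(1) u(2) by (intro sum.mono_neutral_cong_right) (auto simp: c'_def)
    moreover have "\<bar>c' l\<bar> \<le> 2 ^ n" for l
    proof (cases "l \<in> J")
      case True
      have "\<bar>c l\<bar> \<le> (\<Sum>l\<in>J. \<bar>c l\<bar>)" using True fJ by (intro member_le_sum) auto
      then show ?thesis using cs True by (simp add: c'_def)
    qed (simp add: c'_def)
    ultimately show ?thesis using c by (auto simp: bounded_combination_def intro!: exI[of _ c'])
  qed
  then have "{u\<in>U. \<nexists>c. bounded_combination n a (U - {u}) u c} \<subseteq> J" by blast
  then show ?thesis by (rule order_trans[OF card_mono[OF fJ] J(2)])
qed

section \<open>Lebesgue measure on small cubes and its translations\<close>

abbreviation lebesgue_on_fun :: "nat set \<Rightarrow> (nat \<Rightarrow> real) measure"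
  where "lebesgue_on_fun I \<equiv> Pi\<^sub>M I (\<lambda>_. lborel)"

abbreviation cube :: "nat set \<Rightarrow> real \<Rightarrow> (nat \<Rightarrow> real) set"
  where "cube I h \<equiv> Pi\<^sub>E I (\<lambda>_. {-h..h})"

interpretation lborel_product: product_sigma_finite "\<lambda>_ :: nat. lborel :: real measure"
  by standard

lemma emeasure_cube:
  assumes "finite I" "0 \<le> h"
  shows "emeasure (lebesgue_on_fun I) (cube I h) = ennreal ((2 * h) ^ card I)"
  using assms by (subst lborel_product.emeasure_PiM) (auto simp: ennreal_power)

lemma measurable_shift:
  "(\<lambda>g. \<lambda>i\<in>I. g i + v i) \<in> lebesgue_on_fun I \<rightarrow>\<^sub>M lebesgue_on_fun I"
  by (rule measurable_restrict) measurable

lemma distr_shift: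
  assumes I: "finite I"
  shows "distr (lebesgue_on_fun I) (lebesgue_on_fun I) (\<lambda>g. \<lambda>i\<in>I. g i + v i) = lebesgue_on_fun I"
proof (rule lborel_product.PiM_eqI[OF I])
  fix A :: "nat \<Rightarrow> real set" assume A: "\<And>i. i \<in> I \<Longrightarrow> A i \<in> sets lborel"
  have shift: "(\<lambda>x. x + v i) -` A i \<in> sets lborel" if "i \<in> I" for i
  proof -
    have "(\<lambda>x. x + v i) \<in> lborel \<rightarrow>\<^sub>M lborel" by measurable
    from measurable_sets[OF this A[OF that]] show ?thesis by simp
  qed
  have eq: "emeasure lborel ((\<lambda>x. x + v i) -` A i) = emeasure lborel (A i)" if "i \<in> I" for i
  proof -
    have "emeasure lborel (A i) = emeasure (distr lborel borel ((+) (v i))) (A i)"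
      using lborel_distr_plus[of "v i"] by simp
    also have "\<dots> = emeasure lborel ((+) (v i) -` A i)"
      using A[OF that] by (subst emeasure_distr) auto
    finally show ?thesis by (simp add: add.commute vimage_def)
  qed
  have "Pi\<^sub>E I A \<in> sets (lebesgue_on_fun I)" using A I by (intro sets_PiM_I_finite) auto
  then have "emeasure (distr (lebesgue_on_fun I) (lebesgue_on_fun I) (\<lambda>g. \<lambda>i\<in>I. g i + v i)) (Pi\<^sub>E I A) =
    emeasure (lebesgue_on_fun I) ((\<lambda>g. \<lambda>i\<in>I. g i + v i) -` Pi\<^sub>E I A \<inter> space (lebesgue_on_fun I))"
    by (rule emeasure_distr[OF measurable_shift])
  also have "(\<lambda>g. \<lambda>i\<in>I. g i + v i) -` Pi\<^sub>E I A \<inter> space (lebesgue_on_fun I) =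
      Pi\<^sub>E I (\<lambda>i. (\<lambda>x. x + v i) -` A i)"
    by (auto simp: space_PiM PiE_iff extensional_def)
  also have "emeasure (lebesgue_on_fun I) \<dots> = (\<Prod>i\<in>I. emeasure lborel (A i))"
    using I shift eq by (subst lborel_product.emeasure_PiM) auto
  finally show "emeasure (distr (lebesgue_on_fun I) (lebesgue_on_fun I) (\<lambda>g. \<lambda>i\<in>I. g i + v i)) (Pi\<^sub>E I A) =
    (\<Prod>i\<in>I. emeasure lborel (A i))" .
qed simp

definition cube_integral :: "nat set \<Rightarrow> real \<Rightarrow> ((nat \<Rightarrow> real) \<Rightarrow> ennreal) \<Rightarrow> ennreal"
  where "cube_integral I h D = (\<integral>\<^sup>+ g. indicator (cube I h) g * D g \<partial>lebesgue_on_fun I)"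

lemma cube_in_sets: "finite I \<Longrightarrow> cube I h \<in> sets (lebesgue_on_fun I)"
  by (rule sets_PiM_I_finite) auto

text \<open>If \<open>D1\<close> at a point and \<open>D2\<close> at the shifted point cannot both
  be small, then neither can the two integrals: translation preserves the measure, and every point
  of the cube of half-width \<open>h - r\<close> stays inside the large cube after the
  shift.\<close>

lemma cube_integral_shift_ge:
  assumes I: "finite I" and r: "r \<le> h"
    and D1: "D1 \<in> borel_measurable (lebesgue_on_fun I)" and D2: "D2 \<in> borel_measurable (lebesgue_on_fun I)"
    and v: "\<And>i. i \<in> I \<Longrightarrow> \<bar>v i\<bar> \<le> r"
    and c: "\<And>g. g \<in> cube I h \<Longrightarrow> (\<lambda>i\<in>I. g i + v i) \<in> cube I h \<Longrightarrow> c \<le> D1 g + D2 (\<lambda>i\<in>I. g i + v i)"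
  shows "c * ennreal ((2 * (h - r)) ^ card I) \<le> cube_integral I h D1 + cube_integral I h D2"
proof -
  let ?s = "\<lambda>g. \<lambda>i\<in>I. g i + v i"
  have m1: "(\<lambda>g. indicator (cube I h) g * D1 g) \<in> borel_measurable (lebesgue_on_fun I)"
    and m2: "(\<lambda>g. indicator (cube I h) g * D2 g) \<in> borel_measurable (lebesgue_on_fun I)"
    using D1 D2 cube_in_sets[OF I, of h] by measurable
  note m2' = measurable_compose[OF measurable_shift m2, of v]
  have "cube_integral I h D2 =
      (\<integral>\<^sup>+ g. indicator (cube I h) g * D2 g \<partial>distr (lebesgue_on_fun I) (lebesgue_on_fun I) ?s)"
    unfolding cube_integral_def distr_shift[OF I] ..
  also have "\<dots> = (\<integral>\<^sup>+ g. indicator (cube I h) (?s g) * D2 (?s g) \<partial>lebesgue_on_fun I)"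
    by (rule nn_integral_distr[OF measurable_shift]) (use m2 in simp)
  finally have 2: "cube_integral I h D2 = \<dots>" .
  have "c * ennreal ((2 * (h - r)) ^ card I) = (\<integral>\<^sup>+ g. c * indicator (cube I (h - r)) g \<partial>lebesgue_on_fun I)"
    using r emeasure_cube[OF I, of "h - r"] by (subst nn_integral_cmult_indicator[OF cube_in_sets[OF I]]) simp
  also have "\<dots> \<le> (\<integral>\<^sup>+ g. indicator (cube I h) g * D1 g + indicator (cube I h) (?s g) * D2 (?s g) \<partial>lebesgue_on_fun I)"
  proof (rule nn_integral_mono)
    fix g
    show "c * indicator (cube I (h - r)) g \<le> indicator (cube I h) g * D1 g + indicator (cube I h) (?s g) * D2 (?s g)"
    proof (cases "g \<in> cube I (h - r)")
      case True
      have "g i \<in> {-h..h} \<and> g i + v i \<in> {-h..h}" if "i \<in> I" for i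
        using PiE_mem[OF True that] v[OF that] by auto
      then have "g \<in> cube I h" "?s g \<in> cube I h" using True by (simp_all add: PiE_iff)
      then show ?thesis using c True by simp
    qed simp
  qed
  also have "\<dots> = cube_integral I h D1 + (\<integral>\<^sup>+ g. indicator (cube I h) (?s g) * D2 (?s g) \<partial>lebesgue_on_fun I)"
    unfolding cube_integral_def by (rule nn_integral_add[OF m1 m2'])
  finally show ?thesis unfolding 2 .
qed

section \<open>Counting the spikes that can be recovered\<close>

text \<open>Double counting: unrepresentable spikes are counted over the positions for a fixed
  placement \<open>\<tau>\<close>, recoverable ones over the placements for a fixed
  position.\<close>

lemma card_Collect_pairs:
  assumes "finite A" "finite B"
  shows "card {(p, q). p \<in> A \<and> q \<in> B \<and> P p q} = (\<Sum>p\<in>A. card {q\<in>B. P p q})"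
    and "card {(p, q). p \<in> A \<and> q \<in> B \<and> P p q} = (\<Sum>q\<in>B. card {p\<in>A. P p q})"
proof -
  have "{(p, q). p \<in> A \<and> q \<in> B \<and> P p q} = (SIGMA p:A. {q\<in>B. P p q})" by auto
  then show "card {(p, q). p \<in> A \<and> q \<in> B \<and> P p q} = (\<Sum>p\<in>A. card {q\<in>B. P p q})"
    using assms by simp
  have "{(p, q). p \<in> A \<and> q \<in> B \<and> P p q} = prod.swap ` (SIGMA q:B. {p\<in>A. P p q})" by force
  then have "card {(p, q). p \<in> A \<and> q \<in> B \<and> P p q} = card (SIGMA q:B. {p\<in>A. P p q})"
    by (simp add: card_image)
  then show "card {(p, q). p \<in> A \<and> q \<in> B \<and> P p q} = (\<Sum>q\<in>B. card {p\<in>A. P p q})"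
    using assms by simp
qed

lemma add_less_ennreal:
  fixes a b :: ennreal
  assumes "a < ennreal c" "b < ennreal c"
  shows "a + b < ennreal c + ennreal c"
proof -
  have "c \<ge> 0" using assms(1) by (cases "c \<ge> 0") (auto simp: ennreal_neg)
  then show ?thesis
    using assms by (cases a; cases b) (auto simp: ennreal_less_iff simp flip: ennreal_plus)
qed

text \<open>The spike sits at position \<open>p\<close>, the noise \<open>g\<close> at the other positions of \<open>{..4 * n}\<close>; the
  coordinate behind each position is given by \<open>\<tau>\<close>.  If two spikes have representations by
  the noise vectors with coefficients in the same cell, then a small shift of the noise hides which of
  the two is present, so at most one spike per cell can be handled well.\<close>

lemma sum_cube_integral_ge:
  fixes a :: "nat \<Rightarrow> nat \<Rightarrow> real" and n m :: nat and c1 :: real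
  defines "t \<equiv> 4 * n" and "h \<equiv> 1 / (8 * real n)" and "r \<equiv> 1 / (64 * (real n)\<^sup>2)"
  defines "I \<equiv> \<lambda>p. {..t} - {p}"
  assumes n: "n \<ge> 1" and m: "2 ^ (42 * n\<^sup>2) \<le> m" and c1: "c1 \<ge> 0"
    and meas: "\<And>p \<tau>. p \<le> t \<Longrightarrow> \<tau> \<in> {..t} \<rightarrow>\<^sub>E {..<m} \<Longrightarrow> D p \<tau> \<in> borel_measurable (lebesgue_on_fun (I p))"
    and sep: "\<And>p \<tau> \<tau>' g g'. p \<le> t \<Longrightarrow> \<tau> \<in> {..t} \<rightarrow>\<^sub>E {..<m} \<Longrightarrow> \<tau>' \<in> {..t} \<rightarrow>\<^sub>E {..<m} \<Longrightarrow>
      (\<And>l. l \<in> I p \<Longrightarrow> \<tau> l = \<tau>' l) \<Longrightarrow> \<tau> p \<noteq> \<tau>' p \<Longrightarrow>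
      g \<in> cube (I p) h \<Longrightarrow> g' \<in> cube (I p) h \<Longrightarrow> (\<And>l. l \<in> I p \<Longrightarrow> \<bar>g l - g' l\<bar> \<le> r) \<Longrightarrow>
      (\<And>k. k < n \<Longrightarrow> a k (\<tau> p) / 2 + (\<Sum>l\<in>I p. g l * a k (\<tau> l)) =
        a k (\<tau>' p) / 2 + (\<Sum>l\<in>I p. g' l * a k (\<tau>' l))) \<Longrightarrow>
      ennreal c1 \<le> D p \<tau> g + D p \<tau>' g'"
  shows "ennreal (c1 * (2 * h) ^ t / 8 * (real (t + 1) * real m ^ (t + 1))) \<le>
    (\<Sum>p\<le>t. \<Sum>\<tau>\<in>{..t} \<rightarrow>\<^sub>E {..<m}. cube_integral (I p) h (D p \<tau>))"
proof -
  let ?T = "{..t} \<rightarrow>\<^sub>E {..<m}"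
  let ?B = "\<lambda>p \<tau>. cube_integral (I p) h (D p \<tau>)"
  \<comment> \<open>The threshold for a small error: two values below it add up to less than half of
    \<open>c1 * (2 * h) ^ t\<close>, which contradicts the shift estimate.\<close>
  define c2 where "c2 = c1 * (2 * h) ^ t / 4"
  have h0: "h > 0" and r0: "r > 0" using n by (auto simp: h_def r_def)
  have c20: "c2 \<ge> 0" using c1 h0 by (simp add: c2_def)
  have fT: "finite ?T" by (intro finite_PiE) auto
  have cT: "card ?T = m ^ (t + 1)" by (simp add: card_PiE)
  have fI: "finite (I p)" and cI: "p \<le> t \<Longrightarrow> card (I p) = t" for p by (auto simp: I_def)
  have rh: "r = h / (2 * real t)" using n by (simp add: r_def h_def t_def power2_eq_square)
  have t1: "real t \<ge> 1" using n by (simp add: t_def)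
  have "r \<le> h" using h0 t1 by (simp add: rh field_simps)
  \<comment> \<open>The choice \<open>r = h / (2 * t)\<close> is made for this: by Bernoulli's
    inequality the shrunken cube keeps at least half of the volume.\<close>
  have vol: "2 * c2 \<le> c1 * (2 * (h - r)) ^ t"
  proof -
    have "1 + real t * (- (1 / (2 * real t))) \<le> (1 + - (1 / (2 * real t))) ^ t"
      by (rule Bernoulli_inequality) (use t1 in \<open>simp add: field_simps\<close>)
    then have "1 / 2 \<le> (1 - 1 / (2 * real t)) ^ t" using t1 by simp
    then have "(2 * h) ^ t * (1 / 2) \<le> (2 * h) ^ t * (1 - 1 / (2 * real t)) ^ t"
      using h0 by (intro mult_left_mono) auto
    also have "\<dots> = (2 * (h - r)) ^ t"
      unfolding power_mult_distrib[symmetric] by (simp add: rh algebra_simps)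
    finally have "c1 * ((2 * h) ^ t * (1 / 2)) \<le> c1 * (2 * (h - r)) ^ t"
      using c1 by (intro mult_left_mono)
    then show ?thesis by (simp add: c2_def power_mult_distrib mult_ac)
  qed
  let ?rep = "\<lambda>p \<tau> c. bounded_combination n (\<lambda>k l. a k (\<tau> l)) (I p) p c"
  have pair: False
    if p: "p \<le> t" and \<tau>: "\<tau> \<in> ?T" and \<tau>': "\<tau>' \<in> ?T" and eq: "\<And>l. l \<in> I p \<Longrightarrow> \<tau> l = \<tau>' l"
      and ne: "\<tau> p \<noteq> \<tau>' p" and c: "?rep p \<tau> c" and c': "?rep p \<tau>' c'"
      and cc: "\<And>l. l \<in> I p \<Longrightarrow> \<bar>c l - c' l\<bar> \<le> 2 * r"
      and small: "?B p \<tau> < c2" "?B p \<tau>' < c2" for p \<tau> \<tau>' c c'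
  proof -
    \<comment> \<open>The spike has height 1/2, so half the difference of the coefficients is the
      shift of the noise that compensates for exchanging the two spikes.\<close>
    define v where "v l = (c l - c' l) / 2" for l
    have "ennreal c1 * ennreal ((2 * (h - r)) ^ card (I p)) \<le> ?B p \<tau> + ?B p \<tau>'"
    proof (rule cube_integral_shift_ge[OF fI \<open>r \<le> h\<close> meas[OF p \<tau>] meas[OF p \<tau>'], of v])
      show "\<bar>v l\<bar> \<le> r" if "l \<in> I p" for l using cc[OF that] by (simp add: v_def)
      fix g assume g: "g \<in> cube (I p) h" and g': "(\<lambda>l\<in>I p. g l + v l) \<in> cube (I p) h"
      show "ennreal c1 \<le> D p \<tau> g + D p \<tau>' (\<lambda>l\<in>I p. g l + v l)"
      proof (rule sep[OF p \<tau> \<tau>' eq ne g g'])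
        show "\<bar>g l - (\<lambda>l\<in>I p. g l + v l) l\<bar> \<le> r" if "l \<in> I p" for l
          using cc[OF that] that by (simp add: v_def abs_minus_commute)
        fix k assume k: "k < n"
        have 1: "a k (\<tau> p) = (\<Sum>l\<in>I p. c l * a k (\<tau> l))" and 2: "a k (\<tau>' p) = (\<Sum>l\<in>I p. c' l * a k (\<tau>' l))"
          using c c' k by (auto simp: bounded_combination_def)
        show "a k (\<tau> p) / 2 + (\<Sum>l\<in>I p. g l * a k (\<tau> l)) =
          a k (\<tau>' p) / 2 + (\<Sum>l\<in>I p. (\<lambda>l\<in>I p. g l + v l) l * a k (\<tau>' l))"
          unfolding 1 2 sum_divide_distrib sum.distrib[symmetric]
          by (rule sum.cong) (auto simp: v_def eq field_simps)
      qed
    qed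
    then have "ennreal (c1 * (2 * (h - r)) ^ t) \<le> ?B p \<tau> + ?B p \<tau>'"
      using c1 \<open>r \<le> h\<close> cI[OF p] by (subst ennreal_mult) auto
    moreover have "?B p \<tau> + ?B p \<tau>' < ennreal c2 + ennreal c2"
      using small by (rule add_less_ennreal)
    moreover have "ennreal c2 + ennreal c2 \<le> ennreal (c1 * (2 * (h - r)) ^ t)"
      using vol c1 h0 by (subst ennreal_plus[symmetric]) (auto simp: c2_def intro!: ennreal_leI)
    ultimately show False by (meson leD order_trans le_less_trans)
  qed
  \<comment> \<open>Coefficients are at most \<open>2 ^ n\<close> in modulus and cells have width
    \<open>2 * r\<close>, so the cell indices lie between \<open>-K\<close> and \<open>K\<close>;
    \<open>Q\<close> is their number.\<close>
  define K :: int where "K = 2 ^ n * (32 * (int n)\<^sup>2)"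
  define Q where "Q = nat (2 * K + 1)"
  \<comment> \<open>Every pair of a position and a placement is unrepresentable, or representable
    with small error, or has large error. Each of the first two kinds makes up at most a quarter of
    all pairs.\<close>
  let ?bad = "{(p, \<tau>). p \<in> {..t} \<and> \<tau> \<in> ?T \<and> (\<nexists>c. ?rep p \<tau> c)}"
  let ?hit = "{(p, \<tau>). p \<in> {..t} \<and> \<tau> \<in> ?T \<and> ((\<exists>c. ?rep p \<tau> c) \<and> ?B p \<tau> < c2)}"
  let ?large = "{(p, \<tau>). p \<in> {..t} \<and> \<tau> \<in> ?T \<and> c2 \<le> ?B p \<tau>}"
  have bad: "card ?bad \<le> n * m ^ (t + 1)"
  proof -
    have "card ?bad = (\<Sum>\<tau>\<in>?T. card {p\<in>{..t}. \<nexists>c. ?rep p \<tau> c})"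
      by (rule card_Collect_pairs(2)) (use fT in auto)
    also have "\<dots> \<le> (\<Sum>\<tau>\<in>?T. n)"
      unfolding I_def by (intro sum_mono card_not_bounded_combination) auto
    finally show ?thesis by (simp add: cT mult.commute)
  qed
  have hit1: "card {\<tau>\<in>?T. (\<exists>c. ?rep p \<tau> c) \<and> ?B p \<tau> < c2} \<le> m ^ t * Q ^ t" (is "card ?H \<le> _")
    if p: "p \<le> t" for p
  proof -
    define w where "w \<tau> = (SOME c. ?rep p \<tau> c)" for \<tau>
    have w: "?rep p \<tau> (w \<tau>)" if "\<tau> \<in> ?H" for \<tau>
    proof -
      from that have "\<exists>c. ?rep p \<tau> c" by blast
      then show ?thesis unfolding w_def by (rule someI_ex)
    qed
    \<comment> \<open>The encoding forgets the coordinate of the spike and keeps the cells of its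
      coefficients. It is injective by \<open>pair\<close>, so the \<open>m\<close> choices of that
      coordinate are replaced by \<open>Q ^ t\<close> choices of cells.\<close>
    define \<psi> where "\<psi> \<tau> = (restrict \<tau> (I p), \<lambda>l\<in>I p. \<lfloor>w \<tau> l / (2 * r)\<rfloor>)" for \<tau>
    have "inj_on \<psi> ?H"
    proof (rule inj_onI, rule ccontr)
      fix \<tau> \<tau>' assume H: "\<tau> \<in> ?H" "\<tau>' \<in> ?H" "\<psi> \<tau> = \<psi> \<tau>'" "\<tau> \<noteq> \<tau>'"
      have \<psi>1: "restrict \<tau> (I p) = restrict \<tau>' (I p)"
        and \<psi>2: "(\<lambda>l\<in>I p. \<lfloor>w \<tau> l / (2 * r)\<rfloor>) = (\<lambda>l\<in>I p. \<lfloor>w \<tau>' l / (2 * r)\<rfloor>)"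
        using H(3) by (simp_all only: \<psi>_def prod.inject)
      have eq: "\<tau> l = \<tau>' l" if "l \<in> I p" for l
        using fun_cong[OF \<psi>1, of l] that by simp
      have ne: "\<tau> p \<noteq> \<tau>' p"
      proof
        assume "\<tau> p = \<tau>' p"
        then have "\<tau> l = \<tau>' l" if "l \<le> t" for l using eq that by (cases "l = p") (auto simp: I_def)
        then have "\<tau> = \<tau>'" using H(1,2) by (intro PiE_ext[of \<tau> "{..t}" "\<lambda>_. {..<m}"]) auto
        then show False using H(4) by simp
      qed
      show False
      proof (rule pair[of p \<tau> \<tau>' "w \<tau>" "w \<tau>'"])
        show "?rep p \<tau> (w \<tau>)" by (rule w[OF H(1)])
        show "?rep p \<tau>' (w \<tau>')" by (rule w[OF H(2)])
        show "\<tau> l = \<tau>' l" if "l \<in> I p" for l by (rule eq[OF that])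
        fix l assume "l \<in> I p"
        then have "\<lfloor>w \<tau> l / (2 * r)\<rfloor> = \<lfloor>w \<tau>' l / (2 * r)\<rfloor>"
          using fun_cong[OF \<psi>2, of l] by simp
        then have "\<bar>w \<tau> l / (2 * r) - w \<tau>' l / (2 * r)\<bar> < 1" by linarith
        then have "\<bar>w \<tau> l - w \<tau>' l\<bar> / (2 * r) < 1" using r0 by (simp flip: diff_divide_distrib)
        then show "\<bar>w \<tau> l - w \<tau>' l\<bar> \<le> 2 * r" using r0 by simp
      qed (use p ne H in auto)
    qed
    moreover have "\<psi> ` ?H \<subseteq> (I p \<rightarrow>\<^sub>E {..<m}) \<times> (I p \<rightarrow>\<^sub>E {-K..K})"
    proof (intro image_subsetI)
      fix \<tau> assume \<tau>: "\<tau> \<in> ?H"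
      have "\<lfloor>w \<tau> l / (2 * r)\<rfloor> \<in> {-K..K}" for l
      proof -
        have "\<bar>w \<tau> l\<bar> \<le> 2 ^ n" using w[OF \<tau>] by (auto simp: bounded_combination_def)
        then have "\<bar>w \<tau> l\<bar> * (32 * (real n)\<^sup>2) \<le> 2 ^ n * (32 * (real n)\<^sup>2)" by (intro mult_right_mono) auto
        moreover have "w \<tau> l / (2 * r) = w \<tau> l * (32 * (real n)\<^sup>2)" by (simp add: r_def)
        ultimately have "\<bar>w \<tau> l / (2 * r)\<bar> \<le> real_of_int K" by (simp add: K_def abs_mult)
        then have "- real_of_int K \<le> w \<tau> l / (2 * r)" "w \<tau> l / (2 * r) \<le> real_of_int K"
          by (simp_all only: abs_le_iff minus_le_iff)
        then show ?thesis unfolding atLeastAtMost_iff by linarith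
      qed
      then show "\<psi> \<tau> \<in> (I p \<rightarrow>\<^sub>E {..<m}) \<times> (I p \<rightarrow>\<^sub>E {-K..K})"
        using \<tau> by (auto simp: \<psi>_def I_def)
    qed
    ultimately have "card ?H \<le> card ((I p \<rightarrow>\<^sub>E {..<m}) \<times> (I p \<rightarrow>\<^sub>E {-K..K}))"
      by (rule card_inj_on_le) (intro finite_cartesian_product finite_PiE, auto simp: fI)
    also have "\<dots> = m ^ t * Q ^ t"
      using cI[OF p] fI[of p] by (simp add: card_cartesian_product card_PiE Q_def)
    finally show ?thesis .
  qed
  have hit: "card ?hit \<le> (t + 1) * (m ^ t * Q ^ t)"
  proof -
    have "card ?hit = (\<Sum>p\<in>{..t}. card {\<tau>\<in>?T. (\<exists>c. ?rep p \<tau> c) \<and> ?B p \<tau> < c2})"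
      by (rule card_Collect_pairs(1)) (use fT in auto)
    also have "\<dots> \<le> (\<Sum>p\<in>{..t}. m ^ t * Q ^ t)" by (intro sum_mono hit1) auto
    finally show ?thesis by simp
  qed
  \<comment> \<open>The origin of the exponent 42: \<open>Q\<close> is at most
    \<open>2 ^ (10 * n)\<close>, its power \<open>t = 4 * n\<close> contributes 40 n^2 to the
    exponent, and the factor 4 at most 2 n^2.\<close>
  have Qm: "4 * Q ^ t \<le> m"
  proof -
    have n2: "n \<le> 2 ^ n" by (simp add: less_imp_le)
    have n1: "1 \<le> n\<^sup>2" using n by simp
    have "int Q = 2 * K + 1" by (simp add: Q_def K_def)
    then have "int Q = int (2 ^ n * (64 * n\<^sup>2) + 1)" by (simp add: K_def)
    then have "Q = 2 ^ n * (64 * n\<^sup>2) + 1" by linarith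
    also have "\<dots> \<le> 2 ^ n * (128 * n\<^sup>2)" using n by (simp add: Suc_le_eq)
    also have "\<dots> \<le> 2 ^ n * (2 ^ 7 * (2 ^ n)\<^sup>2)" using n2 by (intro mult_le_mono power_mono) auto
    also have "\<dots> = 2 ^ (3 * n + 7)" by (simp add: power_add power_mult mult.commute[of 3] power3_eq_cube power2_eq_square)
    also have "\<dots> \<le> 2 ^ (10 * n)" using n by (intro power_increasing) auto
    finally have "Q ^ t \<le> (2 ^ (10 * n)) ^ t" by (rule power_mono) simp
    also have "\<dots> = 2 ^ (40 * n\<^sup>2)" by (simp add: t_def power2_eq_square flip: power_mult)
    finally have "4 * Q ^ t \<le> 2 ^ (40 * n\<^sup>2 + 2)" by (simp add: power_add)
    also have "\<dots> \<le> 2 ^ (42 * n\<^sup>2)" using n1 by (intro power_increasing) auto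
    also note m
    finally show ?thesis .
  qed
  have "{..t} \<times> ?T \<subseteq> ?bad \<union> ?hit \<union> ?large" by force
  moreover have fin: "finite ?bad" "finite ?hit" "finite ?large"
    by (rule finite_subset[of _ "{..t} \<times> ?T"]; use fT in auto)+
  ultimately have "card ({..t} \<times> ?T) \<le> card (?bad \<union> ?hit \<union> ?large)" by (intro card_mono) auto
  also have "\<dots> \<le> card ?bad + card ?hit + card ?large"
    by (meson card_Un_le add_right_mono order_trans)
  finally have tot: "(t + 1) * m ^ (t + 1) \<le> card ?bad + card ?hit + card ?large"
    by (simp add: cT card_cartesian_product)
  have "4 * card ?hit \<le> (t + 1) * m ^ (t + 1)"
    using mult_le_mono2[OF hit, of 4] mult_le_mono2[OF Qm, of "(t + 1) * m ^ t"]
    by (simp add: algebra_simps)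
  moreover have "4 * card ?bad \<le> (t + 1) * m ^ (t + 1)"
    using mult_le_mono2[OF bad, of 4] by (simp add: t_def algebra_simps)
  ultimately have large: "(t + 1) * m ^ (t + 1) \<le> 2 * card ?large" using tot by linarith
  have "real ((t + 1) * m ^ (t + 1)) \<le> real (2 * card ?large)" using large by (rule of_nat_mono)
  then have "real (t + 1) * real m ^ (t + 1) / 2 \<le> real (card ?large)"
    unfolding of_nat_mult of_nat_power by linarith
  then have "c2 * (real (t + 1) * real m ^ (t + 1) / 2) \<le> c2 * real (card ?large)"
    using c1 h0 by (intro mult_left_mono) (auto simp: c2_def)
  then have "ennreal (c1 * (2 * h) ^ t / 8 * (real (t + 1) * real m ^ (t + 1))) \<le> ennreal (c2 * real (card ?large))"
    by (intro ennreal_leI) (simp add: c2_def mult_ac)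
  also have "\<dots> = (\<Sum>(p, \<tau>)\<in>?large. ennreal c2)"
    using c20 by (simp add: ennreal_mult mult.commute ennreal_of_nat_eq_real_of_nat)
  also have "\<dots> \<le> (\<Sum>(p, \<tau>)\<in>?large. ?B p \<tau>)" by (rule sum_mono) auto
  also have "\<dots> \<le> (\<Sum>(p, \<tau>)\<in>{..t} \<times> ?T. ?B p \<tau>)" using fT by (intro sum_mono2) auto
  also have "\<dots> = (\<Sum>p\<le>t. \<Sum>\<tau>\<in>?T. ?B p \<tau>)" by (simp add: sum.cartesian_product)
  finally show ?thesis .
qed

section \<open>Noisy spikes as inputs of a nonadaptive algorithm\<close>

text \<open>The functional depends on the past only through its length, so any list of length
  \<open>i\<close>, here the zero list, names the functional number \<open>i\<close>.\<close>

lemma information_nonadaptive: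
  assumes "nonadaptive F n M L" "\<omega> \<in> space M" "f \<in> pts F" "k \<le> n"
  shows "information (L \<omega>) k f = map (\<lambda>i. L \<omega> (replicate i 0) f) [0..<k]"
  using assms(4)
proof (induction k)
  case (Suc k)
  have "L \<omega> (map (\<lambda>i. L \<omega> (replicate i 0) f) [0..<k]) f = L \<omega> (replicate k 0) f"
    using assms(1-3) Suc.prems by (auto simp: nonadaptive_def)
  then show ?case using Suc by (simp add: Let_def)
qed simp

lemma length_information [simp]: "length (information L n f) = n"
  by (induction n) (auto simp: Let_def)

lemma coordinate_dual:
  "(\<lambda>f. f i) \<in> dual_space ell1" "(\<lambda>f. f i) \<in> dual_space ell_inf"
  by (rule dual_spaceI[OF normed_ell1, where C = 1] dual_spaceI[OF normed_ell_inf, where C = 1];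
      auto simp: linear_between_def plus_fun_def scaleR_fun_def abs_le_nrm_ell1 abs_le_nrm_ell_inf)+

lemma nrm_ell_inf_eq_SUP:
  assumes f: "f \<in> pts ell_inf"
  shows "ennreal (nrm ell_inf f) = (SUP i. ennreal \<bar>f i\<bar>)"
proof (rule antisym)
  show "(SUP i. ennreal \<bar>f i\<bar>) \<le> ennreal (nrm ell_inf f)"
    by (intro SUP_least ennreal_leI abs_le_nrm_ell_inf f)
  show "ennreal (nrm ell_inf f) \<le> (SUP i. ennreal \<bar>f i\<bar>)"
  proof (cases "SUP i. ennreal \<bar>f i\<bar>" rule: ennreal_cases)
    case (real u)
    have "\<bar>f i\<bar> \<le> u" for i
      using SUP_upper[of i UNIV "\<lambda>i. ennreal \<bar>f i\<bar>"] real by simp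
    then have "nrm ell_inf f \<le> u" by (rule nrm_ell_inf_le)
    then show ?thesis unfolding real(2) by (rule ennreal_leI)
  qed (simp only: top_greatest)
qed

text \<open>\<open>ell_inf\<close> is not separable, so measurability of a difference of measurable
  maps is no matter of course. The norm of the difference is nevertheless a countable supremum over
  coordinates, each of which is measurable.\<close>

lemma nrm_ell_inf_measurable:
  assumes A: "A \<in> N \<rightarrow>\<^sub>M norm_borel ell_inf" and B: "B \<in> N \<rightarrow>\<^sub>M norm_borel ell_inf"
  shows "(\<lambda>z. ennreal (nrm ell_inf (A z - B z))) \<in> borel_measurable N"
proof -
  have coord: "(\<lambda>z. X z i) \<in> borel_measurable N" if "X \<in> N \<rightarrow>\<^sub>M norm_borel ell_inf" for X i
    by (rule measurable_compose[OF that dual_space_measurable[OF normed_ell_inf coordinate_dual(2)]])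
  have "(\<lambda>z. SUP i. ennreal \<bar>A z i - B z i\<bar>) \<in> borel_measurable N"
    using coord[OF A] coord[OF B] by measurable
  moreover have "ennreal (nrm ell_inf (A z - B z)) = (SUP i. ennreal \<bar>A z i - B z i\<bar>)"
    if "z \<in> space N" for z
  proof -
    have "A z - B z \<in> pts ell_inf"
      using measurable_space[OF A that] measurable_space[OF B that] normed_ell_inf
      by (auto simp: space_norm_borel normed_space_def subspace_diff)
    from nrm_ell_inf_eq_SUP[OF this] show ?thesis by (simp add: fun_diff_def)
  qed
  ultimately show ?thesis by (subst measurable_cong) auto
qed

lemma normed_space_sum:
  assumes E: "normed_space E" and v: "\<And>l. l \<in> I \<Longrightarrow> v l \<in> pts E"
  shows "(\<Sum>l\<in>I. v l) \<in> pts E" "nrm E (\<Sum>l\<in>I. v l) \<le> (\<Sum>l\<in>I. nrm E (v l))"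
proof -
  have sub: "subspace (pts E)" using E by (simp add: normed_space_def)
  show 1: "(\<Sum>l\<in>I. v l) \<in> pts E" using v by (rule subspace_sum[OF sub])
  show "nrm E (\<Sum>l\<in>I. v l) \<le> (\<Sum>l\<in>I. nrm E (v l))"
    using v
  proof (induction I rule: infinite_finite_induct)
    case (insert l I)
    have "nrm E (v l + (\<Sum>l\<in>I. v l)) \<le> nrm E (v l) + nrm E (\<Sum>l\<in>I. v l)"
      using E insert.prems subspace_sum[OF sub, of I v] by (auto simp: normed_space_def)
    then show ?case using insert by simp
  qed (use E subspace_0[OF sub] in \<open>auto simp: normed_space_def\<close>)
qed

lemma linear_between_sum:
  assumes T: "linear_between V W T" and V: "subspace V" and v: "\<And>l. l \<in> I \<Longrightarrow> v l \<in> V"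
  shows "T (\<Sum>l\<in>I. v l) = (\<Sum>l\<in>I. T (v l))"
proof -
  have "T (0 *\<^sub>R 0) = 0 *\<^sub>R T 0"
    using T subspace_0[OF V] unfolding linear_between_def by blast
  then have T0: "T 0 = 0" by simp
  show ?thesis using v
  proof (induction I rule: infinite_finite_induct)
    case (insert l I)
    have "T (v l + (\<Sum>l\<in>I. v l)) = T (v l) + T (\<Sum>l\<in>I. v l)"
      using T insert.prems subspace_sum[OF V, of I v] by (auto simp: linear_between_def)
    then show ?case using insert by simp
  qed (use T0 in auto)
qed

text \<open>Only finitely many real parameters occur, so preimages of open sets are open for the
  product topology of the parameters, hence Borel.\<close>

lemma measurable_linear_combination:
  fixes I :: "nat set"
  assumes E: "normed_space E" and I: "finite I" and c: "c \<in> pts E" and v: "\<And>l. l \<in> I \<Longrightarrow> v l \<in> pts E"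
  shows "(\<lambda>g. c + (\<Sum>l\<in>I. g l *\<^sub>R v l)) \<in> lebesgue_on_fun I \<rightarrow>\<^sub>M norm_borel E"
  unfolding norm_borel_def
proof (rule measurable_measure_of)
  let ?x = "\<lambda>g. c + (\<Sum>l\<in>I. g l *\<^sub>R v l)"
  have sub: "subspace (pts E)" using E by (simp add: normed_space_def)
  have x: "?x g \<in> pts E" for g
    using v by (intro subspace_add[OF sub c] subspace_sum[OF sub] subspace_scale[OF sub])
  show "{U. openin (norm_topology E) U} \<subseteq> Pow (pts E)" using open_subset_pts[OF E] by auto
  show "?x \<in> space (lebesgue_on_fun I) \<rightarrow> pts E" using x by auto
  fix U assume "U \<in> {U. openin (norm_topology E) U}"
  then have U: "openin (norm_topology E) U" by simp
  have "open {g. ?x g \<in> U}"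
  proof (rule Topological_Spaces.openI)
    fix g assume "g \<in> {g. ?x g \<in> U}"
    then obtain \<rho> where \<rho>: "\<rho> > 0" "\<And>y. y \<in> pts E \<Longrightarrow> nrm E (y - ?x g) < \<rho> \<Longrightarrow> y \<in> U"
      using U unfolding openin_norm_topology_iff[OF E] by blast
    define S where "S = (\<Sum>l\<in>I. nrm E (v l))"
    have S: "S \<ge> 0" unfolding S_def using E v by (intro sum_nonneg) (auto simp: normed_space_def)
    define \<delta> where "\<delta> = \<rho> / (S + 1)"
    have \<delta>: "\<delta> > 0" "\<delta> * S < \<rho>" using \<rho> S by (auto simp: \<delta>_def field_simps)
    define T where "T = (\<Inter>l\<in>I. (\<lambda>g::nat \<Rightarrow> real. g l) -` ball (g l) \<delta>)"
    have "open T" unfolding T_def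
      by (intro open_INT I ballI open_vimage open_ball continuous_on_product_coordinates)
    moreover have "g \<in> T" using \<delta> by (simp add: T_def)
    moreover have "T \<subseteq> {g. ?x g \<in> U}"
    proof
      fix g' assume g': "g' \<in> T"
      have "?x g' - ?x g = (\<Sum>l\<in>I. (g' l - g l) *\<^sub>R v l)"
        by (simp add: scaleR_diff_left sum_subtractf)
      also have "nrm E \<dots> \<le> (\<Sum>l\<in>I. nrm E ((g' l - g l) *\<^sub>R v l))"
        using v by (intro normed_space_sum[OF E] subspace_scale[OF sub])
      also have "\<dots> \<le> (\<Sum>l\<in>I. \<delta> * nrm E (v l))"
      proof (rule sum_mono)
        fix l assume l: "l \<in> I"
        have "nrm E ((g' l - g l) *\<^sub>R v l) = \<bar>g' l - g l\<bar> * nrm E (v l)" "0 \<le> nrm E (v l)"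
          using E v[OF l] by (auto simp: normed_space_def)
        moreover have "\<bar>g' l - g l\<bar> \<le> \<delta>" using g' l by (auto simp: T_def dist_real_def abs_minus_commute)
        ultimately show "nrm E ((g' l - g l) *\<^sub>R v l) \<le> \<delta> * nrm E (v l)" by (simp add: mult_right_mono)
      qed
      also have "\<dots> = \<delta> * S" by (simp add: S_def sum_distrib_left)
      also note \<delta>(2)
      finally show "g' \<in> {g. ?x g \<in> U}" using \<rho>(2) x by blast
    qed
    ultimately show "\<exists>T. open T \<and> g \<in> T \<and> T \<subseteq> {g. ?x g \<in> U}" by blast
  qed
  then have "{g. ?x g \<in> U} \<in> sets (Pi\<^sub>M UNIV (\<lambda>_. borel))" unfolding sets_PiM_equal_borel by simp
  \<comment> \<open>The product measure lives on functions restricted to \<open>I\<close>, the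
    topology on all functions; extension by 0 mediates between them.\<close>
  moreover have "(\<lambda>g l. if l \<in> I then g l else 0) \<in> lebesgue_on_fun I \<rightarrow>\<^sub>M Pi\<^sub>M UNIV (\<lambda>_::nat. borel :: real measure)"
  proof (rule measurable_PiM_single'[where f = "\<lambda>l g. if l \<in> I then g l else 0"])
    show "(\<lambda>g. if l \<in> I then g l else 0) \<in> borel_measurable (lebesgue_on_fun I)" for l
    proof (cases "l \<in> I")
      case True
      then have "(\<lambda>g. g l) \<in> lebesgue_on_fun I \<rightarrow>\<^sub>M lborel" by (rule measurable_component_singleton)
      then show ?thesis using True by simp
    qed simp
  qed auto
  ultimately have "(\<lambda>g l. if l \<in> I then g l else 0) -` {g. ?x g \<in> U} \<inter> space (lebesgue_on_fun I)
      \<in> sets (lebesgue_on_fun I)"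
    by (rule measurable_sets[rotated])
  moreover have "?x (\<lambda>l. if l \<in> I then g l else 0) = ?x g" for g
    by (intro arg_cong2[of _ _ _ _ "(+)"] sum.cong) auto
  ultimately show "?x -` U \<inter> space (lebesgue_on_fun I) \<in> sets (lebesgue_on_fun I)"
    by (simp add: vimage_def)
qed

definition unit_seq :: "nat \<Rightarrow> nat \<Rightarrow> real"
  where "unit_seq i = (\<lambda>k. if k = i then 1 else 0)"

lemma unit_seq_ell1: "unit_seq i \<in> pts ell1" "nrm ell1 (unit_seq i) = 1"
proof -
  have *: "(\<lambda>k. \<bar>unit_seq i k\<bar>) sums 1"
    using sums_single[of i "\<lambda>_. 1 :: real"] by (simp add: unit_seq_def if_distrib[of abs] cong: if_cong)
  show "unit_seq i \<in> pts ell1" using * by (auto simp: pts_ell1 sums_iff)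
  show "nrm ell1 (unit_seq i) = 1" using * by (simp add: nrm_ell1 sums_iff)
qed

lemma sum_fun_apply: "(\<Sum>l\<in>I. v l) k = (\<Sum>l\<in>I. v l (k::nat) :: real)"
  by (induction I rule: infinite_finite_induct) (auto simp: zero_fun_def plus_fun_def)

text \<open>The spike takes one half of the unit ball and leaves the other half to the noise.
  \<open>\<tau>\<close> need not be injective; contributions to a common coordinate add up.\<close>

definition spike_noise :: "nat set \<Rightarrow> nat \<Rightarrow> (nat \<Rightarrow> nat) \<Rightarrow> (nat \<Rightarrow> real) \<Rightarrow> nat \<Rightarrow> real"
  where "spike_noise I p \<tau> g = (1 / 2) *\<^sub>R unit_seq (\<tau> p) + (\<Sum>l\<in>I. g l *\<^sub>R unit_seq (\<tau> l))"

lemma subspace_ell1: "subspace (pts ell1)"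
  using normed_ell1 by (simp add: normed_space_def)

lemma nrm_scaleR: "normed_space E \<Longrightarrow> x \<in> pts E \<Longrightarrow> nrm E (c *\<^sub>R x) = \<bar>c\<bar> * nrm E x"
  by (simp add: normed_space_def)

lemma nrm_triangle:
  "normed_space E \<Longrightarrow> x \<in> pts E \<Longrightarrow> y \<in> pts E \<Longrightarrow> nrm E (x + y) \<le> nrm E x + nrm E y"
  by (simp add: normed_space_def)

lemma spike_noise_ell1:
  shows "spike_noise I p \<tau> g \<in> pts ell1"
    and "nrm ell1 (spike_noise I p \<tau> g) \<le> 1 / 2 + (\<Sum>l\<in>I. \<bar>g l\<bar>)"
proof -
  let ?s = "\<Sum>l\<in>I. g l *\<^sub>R unit_seq (\<tau> l)"
  have u: "c *\<^sub>R unit_seq i \<in> pts ell1" for c i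
    by (intro subspace_scale[OF subspace_ell1] unit_seq_ell1)
  have s: "?s \<in> pts ell1" by (intro subspace_sum[OF subspace_ell1] u)
  show "spike_noise I p \<tau> g \<in> pts ell1"
    unfolding spike_noise_def by (intro subspace_add[OF subspace_ell1] u s)
  have "nrm ell1 (spike_noise I p \<tau> g) \<le> nrm ell1 ((1 / 2) *\<^sub>R unit_seq (\<tau> p)) + nrm ell1 ?s"
    unfolding spike_noise_def by (rule nrm_triangle[OF normed_ell1 u s])
  also have "nrm ell1 ?s \<le> (\<Sum>l\<in>I. nrm ell1 (g l *\<^sub>R unit_seq (\<tau> l)))"
    by (rule normed_space_sum[OF normed_ell1 u])
  finally show "nrm ell1 (spike_noise I p \<tau> g) \<le> 1 / 2 + (\<Sum>l\<in>I. \<bar>g l\<bar>)"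
    by (simp add: nrm_scaleR[OF normed_ell1] unit_seq_ell1)
qed

lemma dual_spike_noise:
  assumes T: "T \<in> dual_space ell1"
  shows "T (spike_noise I p \<tau> g) = T (unit_seq (\<tau> p)) / 2 + (\<Sum>l\<in>I. g l * T (unit_seq (\<tau> l)))"
proof -
  have lin: "linear_between (pts ell1) UNIV T" using T by (simp add: dual_space_def)
  have u: "c *\<^sub>R unit_seq i \<in> pts ell1" for c i
    by (intro subspace_scale[OF subspace_ell1] unit_seq_ell1)
  have sc: "T (c *\<^sub>R unit_seq i) = c * T (unit_seq i)" for c i
    using lin unit_seq_ell1 by (auto simp: linear_between_def)
  have "T (x + y) = T x + T y" if "x \<in> pts ell1" "y \<in> pts ell1" for x y
    using lin that by (simp add: linear_between_def)
  then have "T (spike_noise I p \<tau> g) =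
      T ((1 / 2) *\<^sub>R unit_seq (\<tau> p)) + T (\<Sum>l\<in>I. g l *\<^sub>R unit_seq (\<tau> l))"
    unfolding spike_noise_def using u subspace_sum[OF subspace_ell1 u] by blast
  then show ?thesis
    by (simp add: linear_between_sum[OF lin subspace_ell1 u] sc)
qed

text \<open>Two inputs that share their information share the output, so the errors add up to the distance
  of the solutions.\<close>

lemma nonadaptive_error_pair:
  assumes alg: "randomized_algorithm ell1 ell_inf n M L \<phi>" and na: "nonadaptive ell1 n M L"
    and \<omega>: "\<omega> \<in> space M" and s: "\<And>i. \<bar>s i\<bar> \<le> C"
    and f: "f \<in> pts ell1" and g: "g \<in> pts ell1"
    and eq: "\<And>k. k < n \<Longrightarrow> L \<omega> (replicate k 0) f = L \<omega> (replicate k 0) g"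
    and c: "c \<le> \<bar>s i * (f i - g i)\<bar>"
  shows "ennreal c \<le> ennreal (nrm ell_inf (alg_output n L \<phi> \<omega> f - diag_op s f)) +
    ennreal (nrm ell_inf (alg_output n L \<phi> \<omega> g - diag_op s g))"
proof -
  let ?A = "alg_output n L \<phi> \<omega> f"
  have "map (\<lambda>i. L \<omega> (replicate i 0) g) [0..<n] = map (\<lambda>i. L \<omega> (replicate i 0) f) [0..<n]"
    by (rule map_cong) (auto simp: eq)
  then have same: "alg_output n L \<phi> \<omega> g = ?A"
    by (simp only: alg_output_def information_nonadaptive[OF na \<omega> f order_refl]
        information_nonadaptive[OF na \<omega> g order_refl])
  have A: "?A \<in> pts ell_inf" using alg \<omega> by (simp add: alg_output_def randomized_algorithm_def)
  have S: "diag_op s h \<in> pts ell_inf" if "h \<in> pts ell1" for h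
    using linear_operator_diag_op(1)[OF s] that by (auto simp: linear_operator_def linear_between_def)
  have D: "?A - diag_op s h \<in> pts ell_inf" if "h \<in> pts ell1" for h
    using normed_ell_inf A S[OF that] by (simp add: normed_space_def subspace_diff)
  have "c \<le> \<bar>(?A - diag_op s f) i\<bar> + \<bar>(?A - diag_op s g) i\<bar>"
    using c by (simp add: fun_diff_def diag_op_def right_diff_distrib)
  also have "\<dots> \<le> nrm ell_inf (?A - diag_op s f) + nrm ell_inf (?A - diag_op s g)"
    by (intro add_mono abs_le_nrm_ell_inf D f g)
  finally have "ennreal c \<le> ennreal (nrm ell_inf (?A - diag_op s f) + nrm ell_inf (?A - diag_op s g))"
    by (rule ennreal_leI)
  then show ?thesis
    unfolding same using normed_ell_inf D[OF f] D[OF g] by (simp add: normed_space_def)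
qed

text \<open>From average to worst case: for each fixed \<omega> the error summed over placements and
  integrated over the noise is large, whereas each single input lies in the unit ball and has
  expected error at most the Monte Carlo error. Fubini connects the two.\<close>

theorem nonadaptive_error_ge:
  fixes M :: "'w measure" and m :: nat
  assumes alg: "randomized_algorithm ell1 ell_inf n M L \<phi>" and na: "nonadaptive ell1 n M L"
    and n: "n \<ge> 1" and m: "2 ^ (42 * n\<^sup>2) \<le> m" and E: "inj_on E {..<m}"
    and sE: "\<And>b. b < m \<Longrightarrow> s (E b) = \<sigma>" and \<sigma>: "\<sigma> \<ge> 0" and s: "\<And>i. \<bar>s i\<bar> \<le> C"
  shows "ennreal (\<sigma> / 32) \<le> mc_error ell1 ell_inf (diag_op s) n M L \<phi>" (is "_ \<le> ?e")
proof -
  define t where "t = 4 * n"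
  \<comment> \<open>\<open>t\<close> noise coordinates of modulus at most \<open>h\<close> have
    total mass at most 1/2.\<close>
  define h where "h = 1 / (8 * real n)"
  define r where "r = 1 / (64 * (real n)\<^sup>2)"
  define I where "I p = {..t} - {p}" for p
  let ?T = "{..t} \<rightarrow>\<^sub>E {..<m}"
  let ?x = "\<lambda>p \<tau>. spike_noise (I p) p (E \<circ> \<tau>)"
  define D where "D \<omega> p \<tau> g =
    ennreal (nrm ell_inf (alg_output n L \<phi> \<omega> (?x p \<tau> g) - diag_op s (?x p \<tau> g)))" for \<omega> p \<tau> g
  interpret P: prob_space M using alg by (simp add: randomized_algorithm_def)
  have fI: "finite (I p)" and cI: "p \<le> t \<Longrightarrow> card (I p) = t" for p by (auto simp: I_def)
  have fT: "finite ?T" by (intro finite_PiE) auto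
  have h0: "h > 0" using n by (simp add: h_def)
  have Am: "(\<lambda>(\<omega>, f). alg_output n L \<phi> \<omega> f) \<in> M \<Otimes>\<^sub>M norm_borel ell1 \<rightarrow>\<^sub>M norm_borel ell_inf"
    using alg by (simp add: randomized_algorithm_def)
  have Sm: "diag_op s \<in> norm_borel ell1 \<rightarrow>\<^sub>M norm_borel ell_inf"
    using linear_operator_diag_op(1)[OF s]
    by (intro continuous_map_measurable_norm_borel normed_ell1 normed_ell_inf) (simp add: linear_operator_def)
  have xm: "?x p \<tau> \<in> lebesgue_on_fun (I p) \<rightarrow>\<^sub>M norm_borel ell1" for p \<tau>
    unfolding spike_noise_def
    by (intro measurable_linear_combination normed_ell1 fI subspace_scale[OF subspace_ell1] unit_seq_ell1)
  have Dm: "(\<lambda>(\<omega>, g). D \<omega> p \<tau> g) \<in> borel_measurable (M \<Otimes>\<^sub>M lebesgue_on_fun (I p))" for p \<tau>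
  proof -
    have "(\<lambda>z. (fst z, ?x p \<tau> (snd z))) \<in> M \<Otimes>\<^sub>M lebesgue_on_fun (I p) \<rightarrow>\<^sub>M M \<Otimes>\<^sub>M norm_borel ell1"
      by (intro measurable_Pair measurable_fst measurable_compose[OF measurable_snd xm])
    from measurable_compose[OF this Am]
    have 1: "(\<lambda>z. alg_output n L \<phi> (fst z) (?x p \<tau> (snd z))) \<in> M \<Otimes>\<^sub>M lebesgue_on_fun (I p) \<rightarrow>\<^sub>M norm_borel ell_inf"
      by simp
    have 2: "(\<lambda>z. diag_op s (?x p \<tau> (snd z))) \<in> M \<Otimes>\<^sub>M lebesgue_on_fun (I p) \<rightarrow>\<^sub>M norm_borel ell_inf"
      by (intro measurable_compose[OF measurable_compose[OF measurable_snd xm] Sm])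
    show ?thesis
      using nrm_ell_inf_measurable[OF 1 2] by (simp add: D_def case_prod_unfold)
  qed
  have iDm: "(\<lambda>(\<omega>, g). indicator (cube (I p) h) g * D \<omega> p \<tau> g) \<in> borel_measurable (M \<Otimes>\<^sub>M lebesgue_on_fun (I p))" for p \<tau>
    unfolding case_prod_unfold
  proof (rule borel_measurable_times_ennreal)
    show "(\<lambda>z. indicator (cube (I p) h) (snd z)) \<in> borel_measurable (M \<Otimes>\<^sub>M lebesgue_on_fun (I p))"
      by (intro measurable_compose[OF measurable_snd] borel_measurable_indicator cube_in_sets fI)
    show "(\<lambda>z. D (fst z) p \<tau> (snd z)) \<in> borel_measurable (M \<Otimes>\<^sub>M lebesgue_on_fun (I p))"
      using Dm by (simp add: case_prod_unfold)
  qed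
  have key: "ennreal (\<sigma> / 4 * (2 * h) ^ t / 8 * (real (t + 1) * real m ^ (t + 1))) \<le>
    (\<Sum>p\<le>t. \<Sum>\<tau>\<in>?T. cube_integral (I p) h (D \<omega> p \<tau>))" if \<omega>: "\<omega> \<in> space M" for \<omega>
    unfolding t_def h_def I_def
  proof (rule sum_cube_integral_ge[OF n m, where a = "\<lambda>k b. L \<omega> (replicate k 0) (unit_seq (E b))"],
      fold t_def h_def r_def I_def)
    show "0 \<le> \<sigma> / 4" using \<sigma> by simp
    show "D \<omega> p \<tau> \<in> borel_measurable (lebesgue_on_fun (I p))" for p \<tau>
      using measurable_Pair2[OF Dm \<omega>] by simp
    fix p \<tau> \<tau>' g g'
    assume p: "p \<le> t" and \<tau>: "\<tau> \<in> ?T" and \<tau>': "\<tau>' \<in> ?T" and eq: "\<And>l. l \<in> I p \<Longrightarrow> \<tau> l = \<tau>' l"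
      and ne: "\<tau> p \<noteq> \<tau>' p" and gg: "\<And>l. l \<in> I p \<Longrightarrow> \<bar>g l - g' l\<bar> \<le> r"
      and info: "\<And>k. k < n \<Longrightarrow> L \<omega> (replicate k 0) (unit_seq (E (\<tau> p))) / 2 +
          (\<Sum>l\<in>I p. g l * L \<omega> (replicate k 0) (unit_seq (E (\<tau> l)))) =
        L \<omega> (replicate k 0) (unit_seq (E (\<tau>' p))) / 2 +
          (\<Sum>l\<in>I p. g' l * L \<omega> (replicate k 0) (unit_seq (E (\<tau>' l))))"
    show "ennreal (\<sigma> / 4) \<le> D \<omega> p \<tau> g + D \<omega> p \<tau>' g'"
      unfolding D_def
    proof (rule nonadaptive_error_pair[OF alg na \<omega> s spike_noise_ell1(1) spike_noise_ell1(1), where i = "E (\<tau> p)"])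
      fix k assume "k < n"
      then have "L \<omega> (replicate k 0) \<in> dual_space ell1"
        using alg \<omega> by (simp add: randomized_algorithm_def)
      then show "L \<omega> (replicate k 0) (?x p \<tau> g) = L \<omega> (replicate k 0) (?x p \<tau>' g')"
        using info[OF \<open>k < n\<close>] by (simp add: dual_spike_noise)
    next
      have \<tau>p: "\<tau> p < m" "\<tau>' p < m" using \<tau> \<tau>' p by (auto simp: PiE_iff)
      then have "E (\<tau> p) \<noteq> E (\<tau>' p)" using E ne by (auto simp: inj_on_def)
      \<comment> \<open>Noise may hit the coordinate of the spike as well, but there the two noise
        parts differ by at most \<open>t * r\<close>, so at least 1/4 of the spike's 1/2 survives in
        the difference of the inputs.\<close>
      let ?w = "\<lambda>l. if E (\<tau> p) = E (\<tau> l) then g l - g' l else 0"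
      have "?x p \<tau> g (E (\<tau> p)) - ?x p \<tau>' g' (E (\<tau> p)) = 1 / 2 +
        ((\<Sum>l\<in>I p. g l * unit_seq (E (\<tau> l)) (E (\<tau> p))) - (\<Sum>l\<in>I p. g' l * unit_seq (E (\<tau>' l)) (E (\<tau> p))))"
        using \<open>E (\<tau> p) \<noteq> E (\<tau>' p)\<close>
        by (simp add: spike_noise_def plus_fun_def scaleR_fun_def sum_fun_apply unit_seq_def)
      also have "\<dots> = 1 / 2 + (\<Sum>l\<in>I p. ?w l)"
        unfolding sum_subtractf[symmetric]
        by (intro arg_cong2[of _ _ _ _ "(+)"] sum.cong refl) (auto simp: unit_seq_def eq)
      finally have diff: "?x p \<tau> g (E (\<tau> p)) - ?x p \<tau>' g' (E (\<tau> p)) = 1 / 2 + (\<Sum>l\<in>I p. ?w l)" .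
      have "\<bar>\<Sum>l\<in>I p. ?w l\<bar> \<le> (\<Sum>l\<in>I p. r)"
        using gg by (intro order_trans[OF sum_abs] sum_mono) (auto simp: r_def)
      also have "\<dots> = real t * r" using cI[OF p] by simp
      also have "\<dots> \<le> 1 / 4" using n by (simp add: t_def r_def power2_eq_square field_simps)
      finally have "1 / 4 \<le> ?x p \<tau> g (E (\<tau> p)) - ?x p \<tau>' g' (E (\<tau> p))"
        unfolding diff by linarith
      then have "\<sigma> * (1 / 4) \<le> \<sigma> * (?x p \<tau> g (E (\<tau> p)) - ?x p \<tau>' g' (E (\<tau> p)))"
        using \<sigma> by (rule mult_left_mono)
      then show "\<sigma> / 4 \<le> \<bar>s (E (\<tau> p)) * (?x p \<tau> g (E (\<tau> p)) - ?x p \<tau>' g' (E (\<tau> p)))\<bar>"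
        unfolding sE[OF \<tau>p(1)] by simp
    qed
  qed
  have up: "(\<integral>\<^sup>+ \<omega>. cube_integral (I p) h (D \<omega> p \<tau>) \<partial>M) \<le> ?e * ennreal ((2 * h) ^ t)" if p: "p \<le> t" for p \<tau>
  proof -
    interpret lborel_product: finite_product_sigma_finite "\<lambda>_ :: nat. lborel :: real measure" "I p"
      by standard (rule fI)
    interpret pair_sigma_finite M "lebesgue_on_fun (I p)"
      by (intro pair_sigma_finite.intro P.sigma_finite_measure_axioms lborel_product.sigma_finite_measure_axioms)
    have "(\<integral>\<^sup>+ \<omega>. cube_integral (I p) h (D \<omega> p \<tau>) \<partial>M) =
        (\<integral>\<^sup>+ g. (\<integral>\<^sup>+ \<omega>. indicator (cube (I p) h) g * D \<omega> p \<tau> g \<partial>M) \<partial>lebesgue_on_fun (I p))"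
      unfolding cube_integral_def by (rule Fubini'[OF iDm, symmetric])
    also have "\<dots> \<le> (\<integral>\<^sup>+ g. ?e * indicator (cube (I p) h) g \<partial>lebesgue_on_fun (I p))"
    proof (rule nn_integral_mono)
      fix g
      show "(\<integral>\<^sup>+ \<omega>. indicator (cube (I p) h) g * D \<omega> p \<tau> g \<partial>M) \<le> ?e * indicator (cube (I p) h) g"
      proof (cases "g \<in> cube (I p) h")
        case True
        have "(\<Sum>l\<in>I p. \<bar>g l\<bar>) \<le> (\<Sum>l\<in>I p. h)"
        proof (rule sum_mono)
          show "\<bar>g l\<bar> \<le> h" if "l \<in> I p" for l using PiE_mem[OF True that] by auto
        qed
        also have "\<dots> = 1 / 2" using n cI[OF p] by (simp add: h_def t_def)
        finally have "nrm ell1 (?x p \<tau> g) \<le> 1" using spike_noise_ell1(2)[of "I p" p "E \<circ> \<tau>" g] by linarith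
        then have "(\<integral>\<^sup>+ \<omega>. D \<omega> p \<tau> g \<partial>M) \<le> ?e"
          unfolding mc_error_def D_def by (intro SUP_upper CollectI conjI spike_noise_ell1(1))
        then show ?thesis using True by simp
      qed simp
    qed
    also have "\<dots> = ?e * ennreal ((2 * h) ^ t)"
      using h0 cI[OF p] emeasure_cube[OF fI, of h p]
      by (subst nn_integral_cmult_indicator[OF cube_in_sets[OF fI]]) simp
    finally show ?thesis .
  qed
  have cm: "(\<lambda>\<omega>. cube_integral (I p) h (D \<omega> p \<tau>)) \<in> borel_measurable M" for p \<tau>
  proof -
    interpret lborel_product: finite_product_sigma_finite "\<lambda>_ :: nat. lborel :: real measure" "I p"
      by standard (rule fI)
    show ?thesis
      unfolding cube_integral_def by (rule lborel_product.borel_measurable_nn_integral[OF iDm])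
  qed
  \<comment> \<open>The mass that is averaged over: the volume of the cube times the number of pairs
    of a position and a placement. The final 32 is 4 from the separation times 8 from the
    counting.\<close>
  let ?X = "(2 * h) ^ t * (real (t + 1) * real m ^ (t + 1))"
  have "m > 0" using m by (metis less_le_trans zero_less_numeral zero_less_power)
  then have X: "?X > 0" using h0 by (intro mult_pos_pos zero_less_power) auto
  have "ennreal (\<sigma> / 32 * ?X) = (\<integral>\<^sup>+ \<omega>. ennreal (\<sigma> / 32 * ?X) \<partial>M)"
    by (simp add: P.emeasure_space_1)
  also have "\<dots> \<le> (\<integral>\<^sup>+ \<omega>. (\<Sum>p\<le>t. \<Sum>\<tau>\<in>?T. cube_integral (I p) h (D \<omega> p \<tau>)) \<partial>M)"
    using key by (intro nn_integral_mono) (simp add: mult_ac)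
  also have "\<dots> = (\<Sum>p\<le>t. \<Sum>\<tau>\<in>?T. \<integral>\<^sup>+ \<omega>. cube_integral (I p) h (D \<omega> p \<tau>) \<partial>M)"
    using cm by (simp add: nn_integral_sum)
  also have "\<dots> \<le> (\<Sum>p\<le>t. \<Sum>\<tau>\<in>?T. ?e * ennreal ((2 * h) ^ t))"
    by (intro sum_mono up) simp
  also have "\<dots> = ?e * ennreal ?X"
    using h0 by (simp add: card_PiE ennreal_mult ennreal_of_nat_eq_real_of_nat mult_ac)
  finally have le: "ennreal (\<sigma> / 32 * ?X) \<le> ?e * ennreal ?X" .
  show ?thesis
  proof (cases ?e rule: ennreal_cases)
    case (real e')
    have "\<sigma> / 32 * ?X \<le> e' * ?X"
      using le X real(1) unfolding real(2) by (subst (asm) ennreal_mult[symmetric]) (auto simp: ennreal_le_iff)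
    then have "\<sigma> / 32 \<le> e'" using X by (rule mult_right_le_imp_le)
    then show ?thesis unfolding real(2) by (rule ennreal_leI)
  qed simp
qed

section \<open>Upper bound\<close>

text \<open>Deterministic adaptive algorithms with results of any type: intermediate results such as
  candidate lists can then be passed on. Measurability is tracked separately.\<close>

definition queries :: "'a::real_vector nspace \<Rightarrow> nat \<Rightarrow> ('a \<Rightarrow> 'r) \<Rightarrow> bool"
  where "queries F n A \<longleftrightarrow> (\<exists>L \<phi>. (\<forall>ys. length ys < n \<longrightarrow> L ys \<in> dual_space F) \<and>
    (\<forall>f\<in>pts F. A f = \<phi> (information L n f)))"

lemma queries_const:
  assumes "normed_space F"
  shows "queries F n (\<lambda>_. r)"
proof -
  have "(\<lambda>_. 0) \<in> dual_space F"
    by (rule dual_spaceI[OF assms, where C = 0]) (auto simp: linear_between_def)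
  then show ?thesis
    unfolding queries_def by (intro exI[of _ "\<lambda>_ _. 0"] exI[of _ "\<lambda>_. r"]) simp
qed

lemma queries_functional: "T \<in> dual_space F \<Longrightarrow> queries F 1 T"
  unfolding queries_def by (intro exI[of _ "\<lambda>_. T"] exI[of _ hd]) (simp add: Let_def)

lemma queries_comp: "queries F n A \<Longrightarrow> queries F n (\<lambda>f. h (A f))"
  unfolding queries_def by (elim exE conjE) (intro exI conjI, assumption, auto)

text \<open>This is where adaptivity enters: the second phase recomputes the result of the first
  from the first \<open>n\<close> values and chooses its functionals accordingly.\<close>

lemma queries_bind:
  assumes A: "queries F n A" and B: "\<And>r. queries F m (B r)"
  shows "queries F (n + m) (\<lambda>f. B (A f) f)"
proof -
  from A obtain L \<phi> where L: "\<And>ys. length ys < n \<Longrightarrow> L ys \<in> dual_space F"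
    and \<phi>: "\<And>f. f \<in> pts F \<Longrightarrow> A f = \<phi> (information L n f)" unfolding queries_def by blast
  have "\<forall>r. \<exists>L \<phi>. (\<forall>ys. length ys < m \<longrightarrow> L ys \<in> dual_space F) \<and> (\<forall>f\<in>pts F. B r f = \<phi> (information L m f))"
    using B unfolding queries_def by blast
  then obtain L2 \<phi>2 where L2: "\<And>r ys. length ys < m \<Longrightarrow> L2 r ys \<in> dual_space F"
    and \<phi>2: "\<And>r f. f \<in> pts F \<Longrightarrow> B r f = \<phi>2 r (information (L2 r) m f)" by metis
  define L' where "L' ys = (if length ys < n then L ys else L2 (\<phi> (take n ys)) (drop n ys))" for ys
  have L'1: "L' ys = L ys" if "length ys < n" for ys using that by (simp add: L'_def)
  have L'2: "L' (ys @ zs) = L2 (\<phi> ys) zs" if "length ys = n" for ys zs using that by (simp add: L'_def)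
  have 1: "information L' k f = information L k f" if "k \<le> n" for k f
    using that by (induction k) (auto simp: Let_def L'1)
  have 2: "information L' (n + k) f = information L n f @ information (L2 (\<phi> (information L n f))) k f" for k f
    by (induction k) (auto simp: Let_def 1 L'2)
  show ?thesis
    unfolding queries_def
  proof (intro exI conjI allI impI ballI)
    show "L' ys \<in> dual_space F" if "length ys < n + m" for ys
      using that L L2 by (auto simp: L'_def)
    show "B (A f) f = (\<lambda>ys. \<phi>2 (\<phi> (take n ys)) (drop n ys)) (information L' (n + m) f)" if "f \<in> pts F" for f
      by (simp add: 2 \<phi> \<phi>2 that)
  qed
qed

text \<open>Padding with the constant algorithm, which measures zero functionals.\<close>

lemma queries_mono:
  assumes "normed_space F" "queries F n A" "n \<le> m"
  shows "queries F m A"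
  using queries_bind[OF assms(2) queries_const[OF assms(1), of "m - n"], of "\<lambda>r. r"] assms(3) by simp

lemma queries_concat:
  assumes F: "normed_space F" and A: "\<And>x. x \<in> set xs \<Longrightarrow> queries F (c x) (A x)"
  shows "queries F (\<Sum>x\<leftarrow>xs. c x) (\<lambda>f. concat (map (\<lambda>x. A x f) xs))"
  using A
proof (induction xs)
  case Nil
  show ?case using queries_const[OF F] by simp
next
  case (Cons x xs)
  from Cons have IH: "queries F (\<Sum>x\<leftarrow>xs. c x) (\<lambda>f. concat (map (\<lambda>x. A x f) xs))" by simp
  have "queries F (c x + (\<Sum>x\<leftarrow>xs. c x)) (\<lambda>f. A x f @ concat (map (\<lambda>x. A x f) xs))"
    by (rule queries_bind[where A = "A x" and B = "\<lambda>r f. r @ concat (map (\<lambda>x. A x f) xs)"])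
      (use Cons.prems queries_comp[OF IH] in auto)
  then show ?case by simp
qed

text \<open>Intermediate lists range over a countable type, so distinguishing their values preserves
  measurability.\<close>

lemma measurable_concat:
  fixes A :: "'x \<Rightarrow> 'a \<Rightarrow> 'c::countable list"
  assumes "\<And>x. x \<in> set xs \<Longrightarrow> A x \<in> M \<rightarrow>\<^sub>M count_space UNIV"
  shows "(\<lambda>f. concat (map (\<lambda>x. A x f) xs)) \<in> M \<rightarrow>\<^sub>M count_space UNIV"
  using assms
proof (induction xs)
  case (Cons x xs)
  have "(\<lambda>f. (\<lambda>r f. r @ concat (map (\<lambda>x. A x f) xs)) (A x f) f) \<in> M \<rightarrow>\<^sub>M count_space UNIV"
  proof (rule measurable_compose_countable[OF _ Cons.prems])
    show "(\<lambda>f. r @ concat (map (\<lambda>x. A x f) xs)) \<in> M \<rightarrow>\<^sub>M count_space UNIV" for r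
      using measurable_compose[OF Cons.IH[OF Cons.prems], of "\<lambda>l. r @ l" "count_space UNIV"] by simp
  qed simp
  then show ?case by simp
qed simp

section \<open>Search by rounding quotients of measurements\<close>

lemma weighted_sum_dual: "(\<lambda>f. \<Sum>i\<leftarrow>A. w i * f (E i)) \<in> dual_space ell1"
proof (rule dual_spaceI[OF normed_ell1])
  show "linear_between (pts ell1) UNIV (\<lambda>f. \<Sum>i\<leftarrow>A. w i * f (E i))"
    by (auto simp: linear_between_def plus_fun_def scaleR_fun_def sum_list_addf sum_list_const_mult
        algebra_simps simp flip: sum_list_const_mult)
  show "\<bar>\<Sum>i\<leftarrow>A. w i * f (E i)\<bar> \<le> (\<Sum>i\<leftarrow>A. \<bar>w i\<bar>) * nrm ell1 f" if "f \<in> pts ell1" for f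
  proof (induction A)
    case (Cons i A)
    have "\<bar>w i * f (E i)\<bar> \<le> \<bar>w i\<bar> * nrm ell1 f"
      unfolding abs_mult by (intro mult_left_mono abs_le_nrm_ell1 that) simp
    then show ?case using Cons by (simp add: distrib_right)
  qed simp
qed

text \<open>If \<open>x i\<close> dominates \<open>x\<close> on \<open>A\<close>, the quotient of the two measured sums is
  close to the label of \<open>i\<close>.  Larger labels narrow \<open>A\<close> down faster but tolerate less noise.\<close>

primrec search :: "(nat \<Rightarrow> nat) list \<Rightarrow> nat list \<Rightarrow> (nat \<Rightarrow> real) \<Rightarrow> nat list"
  where
    "search [] A x = A"
  | "search (lab # labs) A x = search labs
      (filter (\<lambda>i. int (lab i) = round ((\<Sum>i\<leftarrow>A. real (lab i) * x i) / (\<Sum>i\<leftarrow>A. x i))) A) x"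

text \<open>A round costs two functionals, the labelled sum and the plain sum; the next round
  depends on them only through the quotient.\<close>

lemma queries_search: "queries ell1 (2 * length labs) (\<lambda>f. search labs A (\<lambda>i. f (E i)))"
proof (induction labs arbitrary: A)
  case Nil
  show ?case using queries_const[OF normed_ell1] by simp
next
  case (Cons lab labs)
  have "queries ell1 (1 + 1) (\<lambda>f. (\<lambda>y f. y / (\<Sum>i\<leftarrow>A. 1 * f (E i))) (\<Sum>i\<leftarrow>A. real (lab i) * f (E i)) f)"
    by (rule queries_bind[OF queries_functional[OF weighted_sum_dual]],
        rule queries_comp[OF queries_functional[OF weighted_sum_dual]])
  then have "queries ell1 2 (\<lambda>f. (\<Sum>i\<leftarrow>A. real (lab i) * f (E i)) / (\<Sum>i\<leftarrow>A. f (E i)))"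
    by (simp add: numeral_2_eq_2)
  then have "queries ell1 (2 + 2 * length labs) (\<lambda>f. (\<lambda>z f. search labs (filter (\<lambda>i. int (lab i) = round z) A)
      (\<lambda>i. f (E i))) ((\<Sum>i\<leftarrow>A. real (lab i) * f (E i)) / (\<Sum>i\<leftarrow>A. f (E i))) f)"
    by (rule queries_bind) (rule Cons)
  then show ?case by simp
qed

text \<open>The list that survives a round depends on \<open>f\<close> only through one integer, so
  there are countably many cases.\<close>

lemma measurable_search: "(\<lambda>f. search labs A (\<lambda>i. f (E i))) \<in> norm_borel ell1 \<rightarrow>\<^sub>M count_space UNIV"
proof (induction labs arbitrary: A)
  case (Cons lab labs)
  have [measurable]: "(\<lambda>f. \<Sum>i\<leftarrow>A. w i * f (E i)) \<in> borel_measurable (norm_borel ell1)" for w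
    by (rule dual_space_measurable[OF normed_ell1 weighted_sum_dual])
  have "(\<lambda>f. round ((\<Sum>i\<leftarrow>A. real (lab i) * f (E i)) / (\<Sum>i\<leftarrow>A. 1 * f (E i))))
      \<in> norm_borel ell1 \<rightarrow>\<^sub>M count_space UNIV"
    unfolding round_def by measurable
  then have "(\<lambda>f. round ((\<Sum>i\<leftarrow>A. real (lab i) * f (E i)) / (\<Sum>i\<leftarrow>A. f (E i))))
      \<in> norm_borel ell1 \<rightarrow>\<^sub>M count_space UNIV" by simp
  from measurable_compose_countable[OF Cons this, of "\<lambda>z. filter (\<lambda>i. int (lab i) = z) A"]
  show ?case by simp
qed simp

text \<open>The last round labels every index by itself, and at most one index equals a given
  integer. Thus even an unsuccessful search yields at most one candidate, which bounds the cost of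
  measuring the candidates.\<close>

lemma length_search_le_1:
  assumes "distinct A"
  shows "length (search (labs @ [\<lambda>i. i]) A x) \<le> 1"
  using assms
proof (induction labs arbitrary: A)
  case Nil
  let ?z = "round ((\<Sum>i\<leftarrow>A. real i * x i) / (\<Sum>i\<leftarrow>A. x i))"
  have "set (filter (\<lambda>i. int i = ?z) A) \<subseteq> {nat ?z}" by auto
  then have "card (set (filter (\<lambda>i. int i = ?z) A)) \<le> 1"
    by (metis card.empty card_insert_disjoint card_mono empty_iff finite.emptyI finite.insertI One_nat_def)
  then show ?case using Nil by (simp add: distinct_card[symmetric] del: set_filter)
qed simp

text \<open>The numerator minus \<open>lab i\<close> times the denominator involves only the other
  entries and is at most \<open>\<bar>x i\<bar> / 4\<close>, while the denominator is at least
  \<open>3 / 4 * \<bar>x i\<bar>\<close>. The quotient is off by at most 1/3 and rounds to the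
  label.\<close>

lemma round_quotient_eq_label:
  assumes A: "distinct A" "i \<in> set A" and Q: "\<And>l. l \<in> set A \<Longrightarrow> lab l < Q"
    and dom: "4 * real Q * (\<Sum>l\<in>set A - {i}. \<bar>x l\<bar>) \<le> \<bar>x i\<bar>" and xi: "x i \<noteq> 0"
  shows "round ((\<Sum>l\<leftarrow>A. real (lab l) * x l) / (\<Sum>l\<leftarrow>A. x l)) = int (lab i)"
proof -
  define \<nu> where "\<nu> = (\<Sum>l\<in>set A - {i}. \<bar>x l\<bar>)"
  define y where "y = (\<Sum>l\<in>set A. x l)"
  have \<nu>0: "0 \<le> \<nu>" by (simp add: \<nu>_def sum_nonneg)
  have Q1: "real Q \<ge> 1" using Q[OF A(2)] by simp
  have "\<nu> \<le> real Q * \<nu>" using Q1 \<nu>0 by (simp add: mult_le_cancel_right1)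
  then have \<nu>: "4 * \<nu> \<le> \<bar>x i\<bar>" using dom by (simp add: \<nu>_def)
  have "y = x i + (\<Sum>l\<in>set A - {i}. x l)" unfolding y_def using A(2) by (simp add: sum.remove)
  moreover have "\<bar>\<Sum>l\<in>set A - {i}. x l\<bar> \<le> \<nu>" unfolding \<nu>_def by (rule sum_abs)
  ultimately have y: "\<bar>y\<bar> \<ge> 3 / 4 * \<bar>x i\<bar>" using \<nu> by linarith
  then have y0: "\<bar>y\<bar> > 0" using xi by linarith
  have "(\<Sum>l\<in>set A. real (lab l) * x l) - real (lab i) * y = (\<Sum>l\<in>set A. (real (lab l) - real (lab i)) * x l)"
    by (simp add: y_def left_diff_distrib sum_subtractf sum_distrib_left)
  also have "\<dots> = (\<Sum>l\<in>set A - {i}. (real (lab l) - real (lab i)) * x l)"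
    by (intro sum.mono_neutral_right) auto
  also have "\<bar>\<dots>\<bar> \<le> (\<Sum>l\<in>set A - {i}. real Q * \<bar>x l\<bar>)"
  proof (rule order_trans[OF sum_abs sum_mono])
    fix l assume "l \<in> set A - {i}"
    then have "\<bar>real (lab l) - real (lab i)\<bar> \<le> real Q" using Q[of l] Q[OF A(2)] by auto
    then show "\<bar>(real (lab l) - real (lab i)) * x l\<bar> \<le> real Q * \<bar>x l\<bar>"
      unfolding abs_mult by (rule mult_right_mono) simp
  qed
  also have "\<dots> = real Q * \<nu>" by (simp add: \<nu>_def sum_distrib_left)
  also have "\<dots> \<le> \<bar>x i\<bar> / 4" using dom by (simp add: \<nu>_def)
  also have "\<dots> \<le> \<bar>y\<bar> / 3" using y by simp
  finally have "\<bar>(\<Sum>l\<in>set A. real (lab l) * x l) - real (lab i) * y\<bar> / \<bar>y\<bar> \<le> 1 / 3"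
    using y0 by (simp add: divide_le_eq)
  then have "\<bar>(\<Sum>l\<in>set A. real (lab l) * x l) / y - real (lab i)\<bar> \<le> 1 / 3"
    using y0 by (simp add: diff_divide_distrib flip: abs_divide)
  then have "round ((\<Sum>l\<in>set A. real (lab l) * x l) / y) = int (lab i)"
    by (intro round_unique') simp
  then show ?thesis unfolding y_def using A(1) by (simp add: sum_list_distinct_conv_sum_set)
qed

text \<open>The noise in round \<open>t\<close> comes only from indices that agreed with
  \<open>i\<close> in all earlier rounds. This set shrinks, so the label ranges \<open>Q t\<close>
  may grow.\<close>

lemma search_eq_filter:
  assumes "distinct A" "i \<in> set A" "x i \<noteq> 0"
    and "\<And>t l. t < length labs \<Longrightarrow> l \<in> set A \<Longrightarrow> (labs ! t) l < Q t"
    and "\<And>t. t < length labs \<Longrightarrow>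
      4 * real (Q t) * (\<Sum>l\<in>{l\<in>set A. \<forall>u<t. (labs ! u) l = (labs ! u) i} - {i}. \<bar>x l\<bar>) \<le> \<bar>x i\<bar>"
  shows "search labs A x = filter (\<lambda>l. \<forall>t<length labs. (labs ! t) l = (labs ! t) i) A"
  using assms
proof (induction labs arbitrary: A Q)
  case (Cons lab labs)
  have r: "round ((\<Sum>l\<leftarrow>A. real (lab l) * x l) / (\<Sum>l\<leftarrow>A. x l)) = int (lab i)"
    by (rule round_quotient_eq_label[of _ _ _ "Q 0"])
      (use Cons.prems(1-3) Cons.prems(4)[of 0] Cons.prems(5)[of 0] in auto)
  let ?A = "filter (\<lambda>l. lab l = lab i) A"
  have "search labs ?A x = filter (\<lambda>l. \<forall>t<length labs. (labs ! t) l = (labs ! t) i) ?A"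
  proof (rule Cons.IH[of _ "\<lambda>t. Q (Suc t)"])
    fix t assume t: "t < length labs"
    have "{l \<in> set ?A. \<forall>u<t. (labs ! u) l = (labs ! u) i} =
        {l \<in> set A. \<forall>u<Suc t. ((lab # labs) ! u) l = ((lab # labs) ! u) i}"
      by (auto simp: less_Suc_eq_0_disj)
    then show "4 * real (Q (Suc t)) * (\<Sum>l\<in>{l\<in>set ?A. \<forall>u<t. (labs ! u) l = (labs ! u) i} - {i}. \<bar>x l\<bar>) \<le> \<bar>x i\<bar>"
      using Cons.prems(5)[of "Suc t"] t by simp
    show "(labs ! t) l < Q (Suc t)" if "l \<in> set ?A" for l
      using Cons.prems(4)[of "Suc t" l] t that by simp
  qed (use Cons.prems(1-3) in auto)
  moreover have "(\<lambda>l. (\<forall>t<length labs. (labs ! t) l = (labs ! t) i) \<and> lab l = lab i) =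
      (\<lambda>l. \<forall>t<length (lab # labs). ((lab # labs) ! t) l = ((lab # labs) ! t) i)"
    by (auto simp: less_Suc_eq_0_disj fun_eq_iff)
  ultimately show ?case using r by (simp add: conj_commute)
qed simp

section \<open>Measuring the candidates and randomizing over a finite set\<close>

text \<open>The exact solution on the candidates and 0 elsewhere. In the form of a diagonal operator
  with truncated weights it is bounded, and therefore measurable.\<close>

definition diag_restrict :: "(nat \<Rightarrow> real) \<Rightarrow> nat list \<Rightarrow> (nat \<Rightarrow> real) \<Rightarrow> nat \<Rightarrow> real"
  where "diag_restrict s c = diag_op (\<lambda>i. if i \<in> set c then s i else 0)"

lemma queries_diag_restrict: "queries ell1 (length c) (diag_restrict s c)"
proof -
  have "queries ell1 (\<Sum>i\<leftarrow>c. 1) (\<lambda>f. concat (map (\<lambda>i. [f i]) c))"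
    by (rule queries_concat[OF normed_ell1])
      (rule queries_comp[OF queries_functional[OF coordinate_dual(1)]])
  then have "queries ell1 (length c) (\<lambda>f. map f c)"
    by (simp add: concat_map_singleton sum_list_triv)
  from queries_comp[OF this, of "\<lambda>ys i. case map_of (zip c ys) i of None \<Rightarrow> 0 | Some y \<Rightarrow> s i * y"]
  have "queries ell1 (length c)
    (\<lambda>f i. case map_of (zip c (map f c)) i of None \<Rightarrow> 0 | Some y \<Rightarrow> s i * y)" .
  moreover have "(\<lambda>i. case map_of (zip c (map f c)) i of None \<Rightarrow> 0 | Some y \<Rightarrow> s i * y) = diag_restrict s c f" for f
    by (auto simp: fun_eq_iff map_of_zip_map diag_restrict_def diag_op_def)
  ultimately show ?thesis by simp
qed

lemma measurable_diag_restrict: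
  assumes s: "\<And>i. \<bar>s i\<bar> \<le> C"
  shows "diag_restrict s c \<in> norm_borel ell1 \<rightarrow>\<^sub>M norm_borel ell_inf"
proof -
  have "\<bar>if i \<in> set c then s i else 0\<bar> \<le> C" for i using s[of i] by auto
  from linear_operator_diag_op(1)[OF this] show ?thesis
    unfolding diag_restrict_def
    by (intro continuous_map_measurable_norm_borel normed_ell1 normed_ell_inf) (simp add: linear_operator_def)
qed

text \<open>For a uniform choice from a finite set the expectation is a plain average, and joint
  measurability reduces to that of each deterministic algorithm.
  \<open>sample_space_universal\<close> moves the choice to the prescribed sample type.\<close>

lemma e_ran_ada_le:
  assumes \<Omega>: "finite \<Omega>" "\<Omega> \<noteq> {}" and s: "\<And>i. \<bar>s i\<bar> \<le> C"
    and q: "\<And>\<omega>. \<omega> \<in> \<Omega> \<Longrightarrow> queries ell1 n (A \<omega>)"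
    and m: "\<And>\<omega>. \<omega> \<in> \<Omega> \<Longrightarrow> A \<omega> \<in> norm_borel ell1 \<rightarrow>\<^sub>M norm_borel ell_inf"
    and err: "\<And>f. f \<in> pts ell1 \<Longrightarrow> nrm ell1 f \<le> 1 \<Longrightarrow>
      (\<Sum>\<omega>\<in>\<Omega>. nrm ell_inf (A \<omega> f - diag_op s f)) \<le> c * real (card \<Omega>)"
  shows "e_ran_ada ell1 ell_inf (diag_op s) n \<le> ennreal c"
proof -
  let ?M = "uniform_count_measure \<Omega>"
  have sub: "subspace (pts ell_inf)" using normed_ell_inf by (simp add: normed_space_def)
  have S: "diag_op s f \<in> pts ell_inf" if "f \<in> pts ell1" for f
    using linear_operator_diag_op(1)[OF s] that by (auto simp: linear_operator_def linear_between_def)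
  have AG: "A \<omega> f \<in> pts ell_inf" if "\<omega> \<in> \<Omega>" "f \<in> pts ell1" for \<omega> f
    using measurable_space[OF m[OF that(1)], of f] that(2)
    by (simp add: space_norm_borel normed_ell1 normed_ell_inf)
  have "\<forall>\<omega>\<in>\<Omega>. \<exists>L \<phi>. (\<forall>ys. length ys < n \<longrightarrow> L ys \<in> dual_space ell1) \<and>
      (\<forall>f\<in>pts ell1. A \<omega> f = \<phi> (information L n f))"
    using q unfolding queries_def by blast
  then obtain L \<phi> where L: "\<And>\<omega> ys. \<omega> \<in> \<Omega> \<Longrightarrow> length ys < n \<Longrightarrow> L \<omega> ys \<in> dual_space ell1"
    and \<phi>: "\<And>\<omega> f. \<omega> \<in> \<Omega> \<Longrightarrow> f \<in> pts ell1 \<Longrightarrow> A \<omega> f = \<phi> \<omega> (information (L \<omega>) n f)"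
    by metis
  \<comment> \<open>The output rule must map every list of length \<open>n\<close> into
    \<open>ell_inf\<close>, but \<open>\<phi>\<close> is controlled only on lists that occur as
    information; 0 serves as default.\<close>
  define \<phi>' where "\<phi>' \<omega> ys = (if \<phi> \<omega> ys \<in> pts ell_inf then \<phi> \<omega> ys else 0)" for \<omega> ys
  have out: "alg_output n L \<phi>' \<omega> f = A \<omega> f" if "\<omega> \<in> \<Omega>" "f \<in> pts ell1" for \<omega> f
    using AG[OF that] \<phi>[OF that] by (simp add: alg_output_def \<phi>'_def)
  have alg: "randomized_algorithm ell1 ell_inf n ?M L \<phi>'"
    unfolding randomized_algorithm_def space_uniform_count_measure
  proof (intro conjI ballI allI impI)
    show "prob_space ?M" by (rule prob_space_uniform_count_measure) (use \<Omega> in auto)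
    show "\<phi>' \<omega> ys \<in> pts ell_inf" for \<omega> ys by (simp add: \<phi>'_def subspace_0[OF sub])
    have "(\<lambda>(\<omega>, f). alg_output n L \<phi>' \<omega> f) \<in> count_space \<Omega> \<Otimes>\<^sub>M norm_borel ell1 \<rightarrow>\<^sub>M norm_borel ell_inf"
    proof (rule measurable_pair_measure_countable1)
      show "countable \<Omega>" using \<Omega>(1) by (rule countable_finite)
      fix \<omega> assume w: "\<omega> \<in> \<Omega>"
      show "(\<lambda>y. case (\<omega>, y) of (\<omega>, f) \<Rightarrow> alg_output n L \<phi>' \<omega> f) \<in> norm_borel ell1 \<rightarrow>\<^sub>M norm_borel ell_inf"
        using m[OF w] out[OF w]
        by (subst measurable_cong[where g = "A \<omega>"]) (auto simp: space_norm_borel normed_ell1)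
    qed
    then show "(\<lambda>(\<omega>, f). alg_output n L \<phi>' \<omega> f) \<in> ?M \<Otimes>\<^sub>M norm_borel ell1 \<rightarrow>\<^sub>M norm_borel ell_inf"
      using measurable_cong_sets[OF sets_pair_measure_cong[OF sets_uniform_count_measure_count_space refl] refl]
      by blast
  qed (rule L)
  have mc: "mc_error ell1 ell_inf (diag_op s) n ?M L \<phi>' \<le> ennreal c"
    unfolding mc_error_def
  proof (rule SUP_least)
    fix f assume "f \<in> {f \<in> pts ell1. nrm ell1 f \<le> 1}"
    then have f: "f \<in> pts ell1" "nrm ell1 f \<le> 1" by auto
    have nn: "0 \<le> nrm ell_inf (A \<omega> f - diag_op s f)" if "\<omega> \<in> \<Omega>" for \<omega>
      using normed_ell_inf subspace_diff[OF sub AG[OF that f(1)] S[OF f(1)]] by (simp add: normed_space_def)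
    have "(\<integral>\<^sup>+ \<omega>. ennreal (nrm ell_inf (alg_output n L \<phi>' \<omega> f - diag_op s f)) \<partial>?M) =
        (\<Sum>\<omega>\<in>\<Omega>. ennreal (nrm ell_inf (A \<omega> f - diag_op s f)) * ennreal (1 / real (card \<Omega>)))"
      unfolding uniform_count_measure_def using \<Omega>(1) out f(1)
      by (subst nn_integral_point_measure_finite) (auto intro!: sum.cong simp: mult.commute)
    also have "\<dots> = (\<Sum>\<omega>\<in>\<Omega>. ennreal (nrm ell_inf (A \<omega> f - diag_op s f) * (1 / real (card \<Omega>))))"
      using nn by (intro sum.cong refl ennreal_mult[symmetric]) auto
    also have "\<dots> = ennreal (\<Sum>\<omega>\<in>\<Omega>. nrm ell_inf (A \<omega> f - diag_op s f) * (1 / real (card \<Omega>)))"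
      using nn by (intro sum_ennreal) auto
    also have "\<dots> \<le> ennreal c"
      using err[OF f] \<Omega> by (intro ennreal_leI)
        (simp add: card_gt_0_iff divide_le_eq flip: sum_divide_distrib)
    finally show "(\<integral>\<^sup>+ \<omega>. ennreal (nrm ell_inf (alg_output n L \<phi>' \<omega> f - diag_op s f)) \<partial>?M) \<le> ennreal c" .
  qed
  obtain M' :: "(nat \<Rightarrow> real) sample measure" and L' \<phi>'' where
    "randomized_algorithm ell1 ell_inf n M' L' \<phi>''"
    "mc_error ell1 ell_inf (diag_op s) n M' L' \<phi>'' = mc_error ell1 ell_inf (diag_op s) n ?M L \<phi>'"
    by (rule sample_space_universal[OF normed_ell1 normed_ell_inf S alg])
  then have "e_ran_ada ell1 ell_inf (diag_op s) n \<le> mc_error ell1 ell_inf (diag_op s) n ?M L \<phi>'"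
    unfolding e_ran_ada_def by (metis (mono_tags, lifting) Inf_lower mem_Collect_eq)
  then show ?thesis using mc by (rule order_trans)
qed

section \<open>Hashing by residues of random codes\<close>

lemma card_mod_class:
  fixes w q p :: nat
  assumes "p < w"
  shows "card {c\<in>{..<w * q}. c mod w = p} = q"
proof -
  have "{c\<in>{..<w * q}. c mod w = p} = (\<lambda>k. p + w * k) ` {..<q}"
  proof (intro set_eqI iffI)
    fix c assume "c \<in> {c\<in>{..<w * q}. c mod w = p}"
    then have "c = p + w * (c div w)" "c div w < q"
      using mult_div_mod_eq[of w c] by (auto simp: less_mult_imp_div_less mult.commute)
    then show "c \<in> (\<lambda>k. p + w * k) ` {..<q}" by blast
  next
    fix c assume "c \<in> (\<lambda>k. p + w * k) ` {..<q}"
    then obtain k where k: "k < q" "c = p + w * k" by auto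
    have "p + w * k < w + w * k" using assms by simp
    also have "\<dots> = w * Suc k" by simp
    also have "\<dots> \<le> w * q" using k(1) by (intro mult_le_mono2) simp
    finally show "c \<in> {c\<in>{..<w * q}. c mod w = p}" using k assms by simp
  qed
  moreover have "inj_on (\<lambda>k. p + w * k) {..<q}" using assms by (auto simp: inj_on_def)
  ultimately show ?thesis by (simp add: card_image)
qed

text \<open>Pairwise independence: as \<open>w\<close> divides the range of the codes, the residues
  of two codes are independent and uniform, so they agree with probability exactly
  \<open>1 / w\<close>.\<close>

lemma card_agree_mod:
  fixes w q :: nat
  assumes I: "finite I" "i \<in> I" "l \<in> I" "i \<noteq> l" and w: "w > 0"
  shows "card {U\<in>I \<rightarrow>\<^sub>E {..<w * q}. U l mod w = U i mod w} * w = (w * q) ^ card I"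
proof -
  let ?C = "\<lambda>p. {c\<in>{..<w * q}. c mod w = p}"
  let ?P = "\<lambda>p. Pi\<^sub>E I (\<lambda>k. if k = i \<or> k = l then ?C p else {..<w * q})"
  have "{U\<in>I \<rightarrow>\<^sub>E {..<w * q}. U l mod w = U i mod w} = (\<Union>p<w. ?P p)"
  proof (intro set_eqI iffI)
    fix U assume U: "U \<in> {U\<in>I \<rightarrow>\<^sub>E {..<w * q}. U l mod w = U i mod w}"
    then have "U \<in> ?P (U i mod w)" by (auto simp: PiE_iff)
    moreover have "U i mod w < w" using w by simp
    ultimately show "U \<in> (\<Union>p<w. ?P p)" by blast
  next
    fix U assume "U \<in> (\<Union>p<w. ?P p)"
    then obtain p where U: "U \<in> ?P p" by blast
    have "U l \<in> ?C p" "U i \<in> ?C p" using PiE_mem[OF U] I by (metis (no_types, lifting))+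
    moreover have "U \<in> I \<rightarrow>\<^sub>E {..<w * q}"
      using U by (auto simp: PiE_iff split: if_splits)
    ultimately show "U \<in> {U\<in>I \<rightarrow>\<^sub>E {..<w * q}. U l mod w = U i mod w}" by auto
  qed
  moreover have "card (\<Union>p<w. ?P p) = (\<Sum>p<w. card (?P p))"
  proof (rule card_UN_disjoint)
    show "\<forall>p\<in>{..<w}. finite (?P p)" using I(1) by (auto intro!: finite_PiE)
    show "\<forall>p\<in>{..<w}. \<forall>p'\<in>{..<w}. p \<noteq> p' \<longrightarrow> ?P p \<inter> ?P p' = {}"
      using I(2) by (fastforce simp: PiE_iff)
  qed simp
  moreover have "card (?P p) = q * q * (w * q) ^ card (I - {i, l})" if "p < w" for p
  proof -
    have "card (?P p) = (\<Prod>k\<in>I. card (if k = i \<or> k = l then ?C p else {..<w * q}))"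
      by (rule card_PiE[OF I(1)])
    also have "\<dots> = (\<Prod>k\<in>{i, l} \<union> (I - {i, l}). card (if k = i \<or> k = l then ?C p else {..<w * q}))"
      using I by (intro prod.cong) auto
    also have "\<dots> = (\<Prod>k\<in>{i, l}. q) * (\<Prod>k\<in>I - {i, l}. w * q)"
      using I(1) card_mod_class[OF that, of q]
      by (subst prod.union_disjoint) (auto intro!: arg_cong2[of _ _ _ _ "(*)"] prod.cong)
    also have "\<dots> = q * q * (w * q) ^ card (I - {i, l})" using I(4) by simp
    finally show ?thesis .
  qed
  ultimately have "card {U\<in>I \<rightarrow>\<^sub>E {..<w * q}. U l mod w = U i mod w} * w =
      w * q * (w * q) * (w * q) ^ card (I - {i, l})" by simp
  also have "\<dots> = (w * q) ^ (card (I - {i, l}) + 2)" by (simp add: power_add power2_eq_square)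
  also have "card (I - {i, l}) + 2 = card I"
  proof -
    have "card (I - {i, l}) = card I - card {i, l}" using I by (intro card_Diff_subset) auto
    moreover have "card {i, l} \<le> card I" using I by (intro card_mono) auto
    ultimately show ?thesis using I(4) by simp
  qed
  finally show ?thesis .
qed

text \<open>A code \<open>U i\<close> is read in mixed radix: the bucket is its residue modulo \<open>B\<close>,
  label \<open>t\<close> is its next digit, of base \<open>label_base t\<close>, and \<open>code_mod B t\<close> is the product of
  \<open>B\<close> and all earlier bases.  The noise left after \<open>t\<close> rounds is about
  \<open>1 / code_mod B t\<close>, which lets the number of bits per digit double from round to round.\<close>

definition label_base :: "nat \<Rightarrow> nat"
  where "label_base t = 2 ^ (2 ^ t + 1)"

definition code_mod :: "nat \<Rightarrow> nat \<Rightarrow> nat"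
  where "code_mod B t = B * 2 ^ (2 ^ t + t - 1)"

text \<open>The final label is the position itself instead of a digit. It singles out one candidate,
  and its range fits the base \<open>label_base T\<close> when the block has at most that many
  positions.\<close>

definition code_labels :: "nat \<Rightarrow> nat \<Rightarrow> (nat \<Rightarrow> nat) \<Rightarrow> (nat \<Rightarrow> nat) list"
  where "code_labels B T U =
    map (\<lambda>t a. (U a div code_mod B t) mod label_base t) [0..<T] @ [\<lambda>a. a]"

definition bucket_search :: "nat \<Rightarrow> nat \<Rightarrow> nat \<Rightarrow> (nat \<Rightarrow> nat) \<Rightarrow> (nat \<Rightarrow> real) \<Rightarrow> nat \<Rightarrow> nat list"
  where "bucket_search B T m U x b = search (code_labels B T U) (filter (\<lambda>a. U a mod B = b) [0..<m]) x"

text \<open>The exponent \<open>2 ^ t + t - 1\<close> in \<open>code_mod\<close> is the sum of the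
  digit lengths \<open>2 ^ u + 1\<close> over u < t; the subtraction never truncates.\<close>

lemma code_mod_Suc: "code_mod B (Suc t) = code_mod B t * label_base t"
proof -
  have "2 ^ Suc t + Suc t - 1 = (2 ^ t + t - 1) + (2 ^ t + 1 :: nat)" by simp
  then show ?thesis unfolding code_mod_def label_base_def by (simp only: power_add mult.assoc)
qed

lemma code_mod_0: "code_mod B 0 = B"
  by (simp add: code_mod_def)

lemma code_mod_pos: "B > 0 \<Longrightarrow> code_mod B t > 0"
  by (simp add: code_mod_def)

lemma code_mod_dvd: "t \<le> T \<Longrightarrow> code_mod B t dvd code_mod B T"
  by (induction T rule: dec_induct) (auto simp: code_mod_Suc)

text \<open>In mixed radix the bucket and the first \<open>t\<close> digits determine the residue
  modulo \<open>code_mod B t\<close>.\<close>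

lemma labels_agree_imp_mod:
  assumes "U l mod B = U i mod B" "t \<le> T"
    and "\<And>u. u < t \<Longrightarrow> (code_labels B T U ! u) l = (code_labels B T U ! u) i"
  shows "U l mod code_mod B t = U i mod code_mod B t"
  using assms(2,3)
proof (induction t)
  case (Suc t)
  have "(U l div code_mod B t) mod label_base t = (U i div code_mod B t) mod label_base t"
    using Suc.prems(1) Suc.prems(2)[of t] by (simp add: code_labels_def nth_append)
  moreover have "U l mod code_mod B t = U i mod code_mod B t" using Suc by simp
  ultimately show ?case by (simp add: code_mod_Suc mod_mult2_eq)
qed (use assms(1) in \<open>simp add: code_mod_0\<close>)

text \<open>The noise that \<open>i\<close> can meet in round \<open>t\<close>, expressed by the
  codes alone and independently of the course of the search, so that it can be averaged over
  \<open>U\<close>.\<close>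

definition collision_mass :: "nat \<Rightarrow> nat \<Rightarrow> (nat \<Rightarrow> real) \<Rightarrow> nat \<Rightarrow> nat \<Rightarrow> (nat \<Rightarrow> nat) \<Rightarrow> real"
  where "collision_mass B m x i t U =
    (\<Sum>l\<in>{..<m} - {i}. if U l mod code_mod B t = U i mod code_mod B t then \<bar>x l\<bar> else 0)"

text \<open>Indices that survive up to round \<open>t\<close> alongside \<open>i\<close> collide
  with it modulo \<open>code_mod B t\<close>. The condition includes \<open>t = T\<close> for the
  final round, in which positions serve as labels.\<close>

lemma bucket_search_finds:
  assumes i: "i < m" "x i \<noteq> 0" and m: "m \<le> label_base T"
    and dom: "\<And>t. t \<le> T \<Longrightarrow> 4 * real (label_base t) * collision_mass B m x i t U \<le> \<bar>x i\<bar>"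
  shows "i \<in> set (bucket_search B T m U x (U i mod B))"
proof -
  let ?A = "filter (\<lambda>a. U a mod B = U i mod B) [0..<m]" and ?labs = "code_labels B T U"
  have len: "length ?labs = Suc T" by (simp add: code_labels_def)
  have "search ?labs ?A x = filter (\<lambda>l. \<forall>t<length ?labs. (?labs ! t) l = (?labs ! t) i) ?A"
  proof (rule search_eq_filter)
    show "(?labs ! t) l < label_base t" if "t < length ?labs" "l \<in> set ?A" for t l
      using that m by (auto simp: code_labels_def nth_append label_base_def less_Suc_eq)
    fix t assume t: "t < length ?labs"
    let ?S = "{l \<in> set ?A. \<forall>u<t. (?labs ! u) l = (?labs ! u) i} - {i}"
    have "(\<Sum>l\<in>?S. \<bar>x l\<bar>) = (\<Sum>l\<in>?S. if U l mod code_mod B t = U i mod code_mod B t then \<bar>x l\<bar> else 0)"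
    proof (rule sum.cong[OF refl])
      fix l assume l: "l \<in> ?S"
      have "U l mod code_mod B t = U i mod code_mod B t"
        by (rule labels_agree_imp_mod[of U l B i t T]) (use l t len in auto)
      then show "\<bar>x l\<bar> = (if U l mod code_mod B t = U i mod code_mod B t then \<bar>x l\<bar> else 0)" by simp
    qed
    also have "\<dots> \<le> collision_mass B m x i t U"
      unfolding collision_mass_def by (intro sum_mono2) auto
    finally have "4 * real (label_base t) * (\<Sum>l\<in>?S. \<bar>x l\<bar>) \<le> 4 * real (label_base t) * collision_mass B m x i t U"
      by (intro mult_left_mono) auto
    also have "\<dots> \<le> \<bar>x i\<bar>" using t len by (intro dom) simp
    finally show "4 * real (label_base t) * (\<Sum>l\<in>?S. \<bar>x l\<bar>) \<le> \<bar>x i\<bar>" .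
  qed (use i in auto)
  then show ?thesis using i by (simp add: bucket_search_def)
qed

text \<open>The code range \<open>code_mod B T\<close> is a multiple of \<open>code_mod B t\<close>,
  so every other index collides with \<open>i\<close> for exactly the fraction
  \<open>1 / code_mod B t\<close> of the codes; the rest is linearity of expectation.\<close>

lemma sum_collision_mass:
  assumes i: "i < m" and B: "B > 0" and t: "t \<le> T"
  defines "\<Omega> \<equiv> {..<m} \<rightarrow>\<^sub>E {..<code_mod B T}"
  shows "(\<Sum>U\<in>\<Omega>. collision_mass B m x i t U) * real (code_mod B t) \<le> (\<Sum>l<m. \<bar>x l\<bar>) * real (card \<Omega>)"
proof -
  let ?w = "code_mod B t"
  obtain q where q: "code_mod B T = ?w * q" using code_mod_dvd[OF t, of B] by (auto simp: dvd_def)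
  have w: "?w > 0" using B by (rule code_mod_pos)
  have f: "finite \<Omega>" by (auto simp: \<Omega>_def intro!: finite_PiE)
  have c: "real (card {U\<in>\<Omega>. U l mod ?w = U i mod ?w}) * real ?w = real (card \<Omega>)"
    if "l \<in> {..<m} - {i}" for l
  proof -
    have "card {U\<in>\<Omega>. U l mod ?w = U i mod ?w} * ?w = card \<Omega>"
      using card_agree_mod[of "{..<m}" i l ?w q] that i w by (simp add: \<Omega>_def q card_PiE)
    then show ?thesis by (simp flip: of_nat_mult)
  qed
  have "(\<Sum>U\<in>\<Omega>. collision_mass B m x i t U) =
      (\<Sum>l\<in>{..<m} - {i}. \<Sum>U\<in>\<Omega>. if U l mod ?w = U i mod ?w then \<bar>x l\<bar> else 0)"
    unfolding collision_mass_def by (rule sum.swap)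
  also have "\<dots> = (\<Sum>l\<in>{..<m} - {i}. \<bar>x l\<bar> * real (card {U\<in>\<Omega>. U l mod ?w = U i mod ?w}))"
    using f by (simp add: sum.inter_filter[symmetric] mult.commute)
  finally have "(\<Sum>U\<in>\<Omega>. collision_mass B m x i t U) * real ?w =
      (\<Sum>l\<in>{..<m} - {i}. \<bar>x l\<bar> * (real (card {U\<in>\<Omega>. U l mod ?w = U i mod ?w}) * real ?w))"
    by (simp add: sum_distrib_right mult.assoc)
  also have "\<dots> = (\<Sum>l\<in>{..<m} - {i}. \<bar>x l\<bar>) * real (card \<Omega>)"
    unfolding sum_distrib_right using c by (intro sum.cong) auto
  also have "\<dots> \<le> (\<Sum>l<m. \<bar>x l\<bar>) * real (card \<Omega>)"
    by (intro mult_right_mono sum_mono2) auto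
  finally show ?thesis .
qed

text \<open>Markov's inequality in each round; the failure probabilities of the rounds form a geometric series.\<close>

lemma bucket_search_fail:
  assumes i: "i < m" and m: "m \<le> label_base T" and B: "B > 0"
    and heavy: "64 * (\<Sum>l<m. \<bar>x l\<bar>) < real B * \<bar>x i\<bar>"
  defines "\<Omega> \<equiv> {..<m} \<rightarrow>\<^sub>E {..<code_mod B T}"
  shows "2 * card {U\<in>\<Omega>. \<forall>b<B. i \<notin> set (bucket_search B T m U x b)} \<le> card \<Omega>"
proof -
  define b where "b = (\<Sum>l<m. \<bar>x l\<bar>)"
  have b0: "b \<ge> 0" by (simp add: b_def sum_nonneg)
  have xi: "\<bar>x i\<bar> > 0"
  proof (rule ccontr)
    assume "\<not> \<bar>x i\<bar> > 0"
    then have "\<bar>x i\<bar> = 0" by linarith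
    then have "64 * b < 0" using heavy unfolding b_def by simp
    then show False using b0 by linarith
  qed
  have f: "finite \<Omega>" by (auto simp: \<Omega>_def intro!: finite_PiE)
  let ?F = "\<lambda>t. {U\<in>\<Omega>. \<bar>x i\<bar> < 4 * real (label_base t) * collision_mass B m x i t U}"
  have cm0: "0 \<le> collision_mass B m x i t U" for t U
    unfolding collision_mass_def by (intro sum_nonneg) auto
  have sub: "{U\<in>\<Omega>. \<forall>b<B. i \<notin> set (bucket_search B T m U x b)} \<subseteq> (\<Union>t\<le>T. ?F t)"
  proof
    fix U assume U: "U \<in> {U\<in>\<Omega>. \<forall>b<B. i \<notin> set (bucket_search B T m U x b)}"
    then have "i \<notin> set (bucket_search B T m U x (U i mod B))" using B by simp
    then obtain t where "t \<le> T" "\<bar>x i\<bar> < 4 * real (label_base t) * collision_mass B m x i t U"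
      using bucket_search_finds[OF i _ m, of x B U] xi by fastforce
    then show "U \<in> (\<Union>t\<le>T. ?F t)" using U by auto
  qed
  have F: "real (card (?F t)) * (real B * \<bar>x i\<bar>) \<le> (16 * b * real (card \<Omega>)) * (1 / 2) ^ t" if t: "t \<le> T" for t
  proof -
    let ?w = "real (code_mod B t)" and ?Q = "real (label_base t)"
    have w: "?w > 0" using code_mod_pos[OF B] by simp
    have "real (card (?F t)) * \<bar>x i\<bar> = (\<Sum>U\<in>?F t. \<bar>x i\<bar>)" by simp
    also have "\<dots> \<le> (\<Sum>U\<in>?F t. 4 * ?Q * collision_mass B m x i t U)" by (rule sum_mono) auto
    also have "\<dots> \<le> (\<Sum>U\<in>\<Omega>. 4 * ?Q * collision_mass B m x i t U)"
      using f cm0 by (intro sum_mono2) auto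
    finally have "real (card (?F t)) * \<bar>x i\<bar> \<le> 4 * ?Q * (\<Sum>U\<in>\<Omega>. collision_mass B m x i t U)"
      by (simp add: sum_distrib_left)
    then have "real (card (?F t)) * \<bar>x i\<bar> * ?w \<le> 4 * ?Q * ((\<Sum>U\<in>\<Omega>. collision_mass B m x i t U) * ?w)"
      using w by (simp add: mult_right_mono mult.assoc)
    also have "\<dots> \<le> 4 * ?Q * (b * real (card \<Omega>))"
      unfolding b_def \<Omega>_def by (intro mult_left_mono sum_collision_mass i B t) auto
    finally have le: "real (card (?F t)) * \<bar>x i\<bar> * ?w \<le> 4 * ?Q * (b * real (card \<Omega>))" .
    \<comment> \<open>The digit base and the modulus have almost the same exponent: their quotient
      is \<open>4 / (B * 2 ^ t)\<close>. The surplus \<open>t\<close> in the exponent of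
      \<open>code_mod\<close> produces the geometric decay of the failure probabilities.\<close>
    have "2 ^ t + 1 + t = (2 ^ t + t - 1) + (2 :: nat)" by simp
    then have "(2::real) ^ (2 ^ t + 1) * 2 ^ t = 2 ^ (2 ^ t + t - 1) * 2 ^ 2"
      unfolding power_add[symmetric] by (simp only:)
    then have Qw: "?Q * 2 ^ t * real B = 4 * ?w" by (simp add: label_base_def code_mod_def)
    have "real (card (?F t)) * \<bar>x i\<bar> * ?w * (2 ^ t * real B) \<le> 4 * ?Q * (b * real (card \<Omega>)) * (2 ^ t * real B)"
      using le by (rule mult_right_mono) simp
    also have "\<dots> = 4 * (b * real (card \<Omega>)) * (?Q * 2 ^ t * real B)" by (simp only: mult_ac)
    also have "\<dots> = 16 * (b * real (card \<Omega>)) * ?w" unfolding Qw by simp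
    finally have "(real (card (?F t)) * \<bar>x i\<bar> * (2 ^ t * real B)) * ?w \<le> (16 * (b * real (card \<Omega>))) * ?w"
      by (simp only: mult_ac)
    then have "real (card (?F t)) * \<bar>x i\<bar> * (2 ^ t * real B) \<le> 16 * (b * real (card \<Omega>))"
      using w by (rule mult_right_le_imp_le)
    then show ?thesis by (simp add: field_simps)
  qed
  have "card {U\<in>\<Omega>. \<forall>b<B. i \<notin> set (bucket_search B T m U x b)} \<le> card (\<Union>t\<le>T. ?F t)"
    using f by (intro card_mono sub finite_subset[OF _ f]) auto
  also have "\<dots> \<le> (\<Sum>t\<le>T. card (?F t))" by (rule card_UN_le) simp
  finally have "real (card {U\<in>\<Omega>. \<forall>b<B. i \<notin> set (bucket_search B T m U x b)}) \<le> (\<Sum>t\<le>T. real (card (?F t)))"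
    (is "?c \<le> _") by (simp flip: of_nat_sum)
  then have "?c * (real B * \<bar>x i\<bar>) \<le> (\<Sum>t\<le>T. real (card (?F t)) * (real B * \<bar>x i\<bar>))"
    unfolding sum_distrib_right[symmetric] by (rule mult_right_mono) simp
  also have "\<dots> \<le> (\<Sum>t\<le>T. (16 * b * real (card \<Omega>)) * (1 / 2) ^ t)" by (intro sum_mono F) simp
  also have "\<dots> = (16 * b * real (card \<Omega>)) * (\<Sum>t\<le>T. (1 / 2) ^ t)" by (simp only: sum_distrib_left)
  also have "\<dots> \<le> (16 * b * real (card \<Omega>)) * 2"
  proof (rule mult_left_mono)
    have "(\<Sum>t\<le>T. (1 / 2 :: real) ^ t) \<le> 2" by (simp add: sum_gp0)
    then show "(\<Sum>t\<le>T. (1 / 2 :: real) ^ t) \<le> 2" .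
  qed (use b0 in simp)
  also have "\<dots> = (64 * b) * (real (card \<Omega>) / 2)" by simp
  also have "\<dots> \<le> (real B * \<bar>x i\<bar>) * (real (card \<Omega>) / 2)"
    using heavy by (intro mult_right_mono) (auto simp: b_def)
  finally have "?c * (real B * \<bar>x i\<bar>) \<le> (real (card \<Omega>) / 2) * (real B * \<bar>x i\<bar>)" by (simp add: mult.commute)
  then have "?c \<le> real (card \<Omega>) / 2" by (rule mult_right_le_imp_le) (use B xi in simp)
  then show ?thesis by linarith
qed

section \<open>Repetition and the complete adaptive algorithm\<close>

text \<open>Independence of the \<open>k\<close> repetitions in block \<open>j\<close>: the factor
  \<open>2 ^ k\<close> is distributed over the \<open>k\<close> components with first index
  \<open>j\<close>, each of which lies in \<open>F\<close> for at most half of its values.\<close>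

lemma card_PiE_all_fail:
  fixes k :: nat
  assumes j: "j < k" and fin: "\<And>j. finite (S j)"
    and F: "F \<subseteq> S j" "2 * card F \<le> card (S j)"
  defines "\<Omega> \<equiv> Pi\<^sub>E ({..<k} \<times> {..<k}) (\<lambda>p. S (fst p))"
  shows "2 ^ k * card {\<omega>\<in>\<Omega>. \<forall>r<k. \<omega> (j, r) \<in> F} \<le> card \<Omega>"
proof -
  let ?P = "{..<k} \<times> {..<k}"
  have "{\<omega>\<in>\<Omega>. \<forall>r<k. \<omega> (j, r) \<in> F} = Pi\<^sub>E ?P (\<lambda>p. if fst p = j then F else S (fst p))" (is "?L = ?R")
  proof (intro set_eqI iffI)
    fix \<omega> assume "\<omega> \<in> ?L"
    then show "\<omega> \<in> ?R" by (auto simp: \<Omega>_def PiE_iff)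
  next
    fix \<omega> assume "\<omega> \<in> ?R"
    then show "\<omega> \<in> ?L" using j F(1) by (auto simp: \<Omega>_def PiE_iff split: if_splits)
  qed
  then have "card {\<omega>\<in>\<Omega>. \<forall>r<k. \<omega> (j, r) \<in> F} = (\<Prod>p\<in>?P. card (if fst p = j then F else S (fst p)))"
    by (simp add: card_PiE)
  moreover have "(2::nat) ^ k = (\<Prod>p\<in>?P. if fst p = j then 2 else 1)"
  proof -
    have "?P \<inter> {p. fst p = j} = {j} \<times> {..<k}" using j by auto
    then show ?thesis by (simp add: prod.If_cases card_cartesian_product)
  qed
  ultimately have "2 ^ k * card {\<omega>\<in>\<Omega>. \<forall>r<k. \<omega> (j, r) \<in> F} =
      (\<Prod>p\<in>?P. (if fst p = j then 2 else 1) * card (if fst p = j then F else S (fst p)))"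
    by (simp only: prod.distrib)
  also have "\<dots> \<le> (\<Prod>p\<in>?P. card (S (fst p)))"
    by (rule prod_mono) (use F(2) in auto)
  also have "\<dots> = card \<Omega>" by (simp add: \<Omega>_def card_PiE)
  finally show ?thesis .
qed

text \<open>Pair encoding places all finite blocks in one sequence; pairs beyond the size of their
  block get weight 0.\<close>

definition block_weights :: "(nat \<Rightarrow> real) \<Rightarrow> (nat \<Rightarrow> nat) \<Rightarrow> nat \<Rightarrow> real"
  where "block_weights \<sigma> m i = (case prod_decode i of (j, a) \<Rightarrow> if a < m j then \<sigma> j else 0)"

lemma block_weights_encode [simp]:
  "block_weights \<sigma> m (prod_encode (j, a)) = (if a < m j then \<sigma> j else 0)"
  by (simp add: block_weights_def)

lemma length_bucket_search: "length (bucket_search B T m U x b) \<le> 1"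
  unfolding bucket_search_def code_labels_def by (rule length_search_le_1) simp

text \<open>Blocks from \<open>k\<close> on contribute at most \<open>1 / 2 ^ k\<close> by their
  weight, and light coordinates at most \<open>64 / 2 ^ k\<close>; both are covered by the 64, since
  the norm is a supremum. A heavy coordinate is missed with probability at most
  \<open>1 / 2 ^ k\<close>; weighted by the coordinates, whose sum is at most 1, this gives the
  remaining 1.\<close>

theorem adaptive_error_le:
  fixes \<sigma> :: "nat \<Rightarrow> real" and m T :: "nat \<Rightarrow> nat" and k n :: nat
  assumes \<sigma>: "\<And>j. 0 < \<sigma> j" "\<And>j. \<sigma> j \<le> (1 / 2) ^ j" and m: "\<And>j. m j \<le> label_base (T j)"
    and n: "(\<Sum>j<k. k * nat \<lceil>2 ^ k * \<sigma> j\<rceil> * (2 * T j + 3)) \<le> n"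
  shows "e_ran_ada ell1 ell_inf (diag_op (block_weights \<sigma> m)) n \<le> ennreal (65 / 2 ^ k)"
proof -
  define B where "B j = nat \<lceil>2 ^ k * \<sigma> j\<rceil>" for j
  define s where "s = block_weights \<sigma> m"
  have B0: "B j > 0" for j using \<sigma>(1)[of j] by (simp add: B_def)
  have B\<sigma>: "2 ^ k * \<sigma> j \<le> real (B j)" for j unfolding B_def by linarith
  have \<sigma>1: "\<sigma> j \<le> 1" for j using \<sigma>(2)[of j] power_le_one[of "1/2::real" j] by linarith
  have s1: "\<bar>s i\<bar> \<le> 1" for i
    using \<sigma>(1) \<sigma>1 by (auto simp: s_def block_weights_def less_imp_le split: prod.splits)
  define S where "S j = ({..<m j} \<rightarrow>\<^sub>E {..<code_mod (B j) (T j)})" for j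
  have fS: "finite (S j)" for j unfolding S_def by (rule finite_PiE) auto
  define \<Omega> where "\<Omega> = Pi\<^sub>E ({..<k} \<times> {..<k}) (\<lambda>p. S (fst p))"
  have f\<Omega>: "finite \<Omega>" unfolding \<Omega>_def by (intro finite_PiE) (auto simp: fS)
  have "{..<code_mod (B j) (T j)} \<noteq> {}" for j using code_mod_pos[OF B0, of j "T j"] by auto
  then have "S j \<noteq> {}" for j unfolding S_def by (simp add: PiE_eq_empty_iff)
  then have \<Omega>0: "\<Omega> \<noteq> {}" unfolding \<Omega>_def by (simp add: PiE_eq_empty_iff)
  \<comment> \<open>A task is a block, a repetition and a bucket. The random code depends only on
    block and repetition, so all buckets of one repetition share it.\<close>
  define X where "X = (SIGMA j:{..<k}. {..<k} \<times> {..<B j})"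
  have "finite X" by (simp add: X_def)
  then obtain tasks where tasks: "set tasks = X" "distinct tasks"
    using finite_distinct_list by blast
  have sum_tasks: "(\<Sum>p\<leftarrow>tasks. c (fst p)) = (\<Sum>j<k. k * B j * c j)" for c :: "nat \<Rightarrow> nat"
  proof -
    have "(\<Sum>p\<leftarrow>tasks. c (fst p)) = (\<Sum>(j, p)\<in>X. c j)"
      using tasks by (simp add: sum_list_distinct_conv_sum_set case_prod_unfold)
    also have "\<dots> = (\<Sum>j<k. \<Sum>p\<in>{..<k} \<times> {..<B j}. c j)"
      unfolding X_def by (rule sum.Sigma[symmetric]) auto
    finally show ?thesis by (simp add: card_cartesian_product)
  qed
  define find where "find \<omega> p f = (case p of (j, r, b) \<Rightarrow> map (\<lambda>a. prod_encode (j, a))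
    (bucket_search (B j) (T j) (m j) (\<omega> (j, r)) (\<lambda>a. f (prod_encode (j, a))) b))"
    for \<omega> :: "nat \<times> nat \<Rightarrow> nat \<Rightarrow> nat" and p :: "nat \<times> nat \<times> nat" and f :: "nat \<Rightarrow> real"
  define cand where "cand \<omega> f = concat (map (\<lambda>p. find \<omega> p f) tasks)" for \<omega> f
  define q where "q = (\<Sum>j<k. k * B j)"
  have lc: "length (cand \<omega> f) \<le> q" for \<omega> f
  proof -
    have "length (find \<omega> p f) \<le> 1" for p
      unfolding find_def case_prod_unfold length_map by (rule length_bucket_search)
    then have "length (cand \<omega> f) \<le> (\<Sum>p\<leftarrow>tasks. 1)"
      unfolding cand_def length_concat map_map comp_def by (intro sum_list_mono)
    then show ?thesis using sum_tasks[of "\<lambda>_. 1"] by (simp add: q_def)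
  qed
  have qc: "queries ell1 (\<Sum>j<k. k * B j * (2 * (T j + 1))) (cand \<omega>)" for \<omega>
  proof -
    have "queries ell1 (2 * (T (fst p) + 1)) (find \<omega> p)" for p
    proof -
      obtain j r b where p: "p = (j, r, b)" by (cases p)
      show ?thesis
        unfolding p find_def prod.case bucket_search_def fst_conv
        by (rule queries_comp)
          (use queries_search[of "code_labels (B j) (T j) (\<omega> (j, r))"] in \<open>simp add: code_labels_def\<close>)
    qed
    then show ?thesis
      unfolding cand_def sum_tasks[of "\<lambda>j. 2 * (T j + 1)", symmetric]
      by (rule queries_concat[OF normed_ell1])
  qed
  have mc: "cand \<omega> \<in> norm_borel ell1 \<rightarrow>\<^sub>M count_space UNIV" for \<omega>
    unfolding cand_def
  proof (rule measurable_concat)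
    fix p :: "nat \<times> nat \<times> nat"
    obtain j r b where p: "p = (j, r, b)" by (cases p)
    show "find \<omega> p \<in> norm_borel ell1 \<rightarrow>\<^sub>M count_space UNIV"
      unfolding p find_def prod.case bucket_search_def
      by (rule measurable_compose[OF measurable_search]) simp
  qed
  define A where "A \<omega> f = diag_restrict s (cand \<omega> f) f" for \<omega> f
  have qA: "queries ell1 n (A \<omega>)" for \<omega>
  proof (rule queries_mono[OF normed_ell1])
    show "queries ell1 ((\<Sum>j<k. k * B j * (2 * (T j + 1))) + q) (A \<omega>)"
    proof -
      \<comment> \<open>\<open>queries_bind\<close> needs a cost bound for every conceivable
        intermediate result, so overlong candidate lists, which never occur, get the output
        0.\<close>
      let ?D = "\<lambda>c f. if length c \<le> q then diag_restrict s c f else 0"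
      have "queries ell1 q (?D c)" for c
        using queries_mono[OF normed_ell1 queries_diag_restrict, of c q s] queries_const[OF normed_ell1]
        by (cases "length c \<le> q") auto
      then have "queries ell1 ((\<Sum>j<k. k * B j * (2 * (T j + 1))) + q) (\<lambda>f. ?D (cand \<omega> f) f)"
        by (rule queries_bind[OF qc])
      then show ?thesis by (simp add: A_def[abs_def] lc)
    qed
    \<comment> \<open>Per bucket: two measurements in each of the \<open>T j + 1\<close> rounds and
      one for the candidate.\<close>
    have "(\<Sum>j<k. k * B j * (2 * (T j + 1))) + q = (\<Sum>j<k. k * B j * (2 * T j + 3))"
      unfolding q_def sum.distrib[symmetric] by (rule sum.cong) (auto simp: algebra_simps)
    then show "(\<Sum>j<k. k * B j * (2 * (T j + 1))) + q \<le> n" using n by (simp add: B_def)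
  qed
  have mA: "A \<omega> \<in> norm_borel ell1 \<rightarrow>\<^sub>M norm_borel ell_inf" for \<omega>
    unfolding A_def by (rule measurable_compose_countable[OF measurable_diag_restrict[OF s1] mc])
  show ?thesis
    unfolding s_def[symmetric]
  proof (rule e_ran_ada_le[OF f\<Omega> \<Omega>0 s1 qA mA])
    fix f assume f: "f \<in> pts ell1" "nrm ell1 f \<le> 1"
    define x where "x j a = f (prod_encode (j, a))" for j a
    define b where "b j = (\<Sum>a<m j. \<bar>x j a\<bar>)" for j
    have tot: "(\<Sum>j<k. b j) \<le> 1"
    proof -
      have "(\<Sum>j<k. b j) = (\<Sum>i\<in>prod_encode ` (SIGMA j:{..<k}. {..<m j}). \<bar>f i\<bar>)"
        by (simp add: b_def x_def sum.Sigma sum.reindex[OF inj_prod_encode] case_prod_unfold)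
      also have "\<dots> \<le> nrm ell1 f" by (rule sum_le_nrm_ell1[OF f(1)]) auto
      finally show ?thesis using f(2) by linarith
    qed
    have b1: "b j \<le> 1" if "j < k" for j
    proof -
      have "b j \<le> (\<Sum>j<k. b j)" using that by (intro member_le_sum) (auto simp: b_def sum_nonneg)
      then show ?thesis using tot by linarith
    qed
    define F where "F j a = {U\<in>S j. \<forall>b<B j. a \<notin> set (bucket_search (B j) (T j) (m j) U (x j) b)}" for j a
    define heavy where "heavy j a \<longleftrightarrow> 64 * b j < real (B j) * \<bar>x j a\<bar>" for j a
    \<comment> \<open>The supremum over missed heavy coordinates is bounded by their sum, which can
      be averaged over \<omega> term by term.\<close>
    define z where "z \<omega> j a = (if heavy j a \<and> (\<forall>r<k. \<omega> (j, r) \<in> F j a) then \<bar>x j a\<bar> else 0)" for \<omega> j a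
    have z0: "z \<omega> j a \<ge> 0" for \<omega> j a by (simp add: z_def)
    have fi: "\<bar>f i\<bar> \<le> 1" for i using abs_le_nrm_ell1[OF f(1), of i] f(2) by linarith
    have err: "nrm ell_inf (A \<omega> f - diag_op s f) \<le> 64 / 2 ^ k + (\<Sum>j<k. \<Sum>a<m j. z \<omega> j a)" (is "_ \<le> ?R")
      if \<omega>: "\<omega> \<in> \<Omega>" for \<omega>
    proof (rule nrm_ell_inf_le)
      fix i
      obtain j a where i: "i = prod_encode (j, a)" by (metis prod_decode_inverse surj_pair)
      have Z: "0 \<le> (\<Sum>j<k. \<Sum>a<m j. z \<omega> j a)" by (intro sum_nonneg z0)
      have eq: "(A \<omega> f - diag_op s f) i = (if i \<in> set (cand \<omega> f) then 0 else - (s i * f i))"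
        by (simp add: A_def diag_restrict_def diag_op_def fun_diff_def)
      consider "i \<in> set (cand \<omega> f) \<or> m j \<le> a" | "k \<le> j" "a < m j" | "j < k" "a < m j" "i \<notin> set (cand \<omega> f)"
        by linarith
      then show "\<bar>(A \<omega> f - diag_op s f) i\<bar> \<le> ?R"
      proof cases
        case 1
        then have "(A \<omega> f - diag_op s f) i = 0" unfolding eq by (auto simp: s_def i)
        then show ?thesis using Z by simp
      next
        case 2
        have "\<bar>s i * f i\<bar> \<le> (1 / 2) ^ k * 1"
          unfolding abs_mult
        proof (rule mult_mono)
          have "\<sigma> j \<le> (1 / 2) ^ j" by (rule \<sigma>(2))
          also have "\<dots> \<le> (1 / 2) ^ k" using 2 by (intro power_decreasing) auto
          finally show "\<bar>s i\<bar> \<le> (1 / 2) ^ k" using \<sigma>(1)[of j] 2 by (simp add: s_def i)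
        qed (use fi in auto)
        also have "\<dots> \<le> 64 / 2 ^ k" by (simp add: power_one_over divide_right_mono)
        finally have "\<bar>s i * f i\<bar> \<le> 64 / 2 ^ k" .
        moreover have "0 \<le> (64::real) / 2 ^ k" by simp
        ultimately show ?thesis unfolding eq using Z by (auto simp del: abs_mult)
      next
        case 3
        have si: "\<bar>s i * f i\<bar> = \<sigma> j * \<bar>x j a\<bar>"
          using 3 \<sigma>(1)[of j] by (simp add: s_def i x_def abs_mult)
        have "\<bar>s i * f i\<bar> \<le> ?R"
        proof (cases "heavy j a")
          \<comment> \<open>A light coordinate may be missed:
            \<open>2 ^ k * \<sigma> j \<le> B j\<close> turns the failure of heaviness into an error
            of at most \<open>64 / 2 ^ k\<close>.\<close>
          case False
          then have "real (B j) * \<bar>x j a\<bar> \<le> 64 * b j" by (simp add: heavy_def)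
          moreover have "2 ^ k * \<sigma> j * \<bar>x j a\<bar> \<le> real (B j) * \<bar>x j a\<bar>" using B\<sigma> by (rule mult_right_mono) simp
          ultimately have "2 ^ k * (\<sigma> j * \<bar>x j a\<bar>) \<le> 64" using b1[OF 3(1)] by (simp add: mult.assoc)
          then have "\<sigma> j * \<bar>x j a\<bar> \<le> 64 / 2 ^ k" by (simp add: pos_le_divide_eq mult.commute)
          then show ?thesis using si Z by linarith
        next
          case True
          have "\<omega> (j, r) \<in> F j a" if "r < k" for r
          proof -
            have "a \<notin> set (bucket_search (B j) (T j) (m j) (\<omega> (j, r)) (x j) b')" if "b' < B j" for b'
            proof
              assume "a \<in> set (bucket_search (B j) (T j) (m j) (\<omega> (j, r)) (x j) b')"
              then have "i \<in> set (find \<omega> (j, r, b') f)" by (simp add: find_def i x_def[abs_def])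
              moreover have "(j, r, b') \<in> set tasks"
                using 3(1) \<open>r < k\<close> \<open>b' < B j\<close> by (simp add: tasks X_def)
              ultimately show False using 3(3) by (auto simp: cand_def)
            qed
            moreover have "\<omega> (j, r) \<in> S j" using \<omega> 3(1) that by (auto simp: \<Omega>_def PiE_iff)
            ultimately show ?thesis by (simp add: F_def)
          qed
          then have "z \<omega> j a = \<bar>x j a\<bar>" using True by (simp add: z_def)
          moreover have "z \<omega> j a \<le> (\<Sum>a<m j. z \<omega> j a)" using 3(2) z0 by (intro member_le_sum) auto
          moreover have "(\<Sum>a<m j. z \<omega> j a) \<le> (\<Sum>j<k. \<Sum>a<m j. z \<omega> j a)"
            using 3(1) z0 by (intro member_le_sum[of j "{..<k}" "\<lambda>j. \<Sum>a<m j. z \<omega> j a"]) (auto intro: sum_nonneg)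
          moreover have "\<sigma> j * \<bar>x j a\<bar> \<le> 1 * \<bar>x j a\<bar>" using \<sigma>1 by (rule mult_right_mono) simp
          moreover have "0 \<le> (64::real) / 2 ^ k" by simp
          ultimately show ?thesis using si by linarith
        qed
        then show ?thesis unfolding eq using 3(3) by simp
      qed
    qed
    have zs: "(\<Sum>\<omega>\<in>\<Omega>. z \<omega> j a) \<le> \<bar>x j a\<bar> * (real (card \<Omega>) / 2 ^ k)" if ja: "j < k" "a < m j" for j a
    proof (cases "heavy j a")
      case True
      have F: "F j a \<subseteq> S j" by (auto simp: F_def)
      have "2 * card (F j a) \<le> card (S j)"
        unfolding F_def S_def
        by (rule bucket_search_fail[OF ja(2) m B0]) (use True in \<open>simp add: heavy_def b_def\<close>)
      from card_PiE_all_fail[of j k S, OF ja(1) fS F this, folded \<Omega>_def]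
      have "real (2 ^ k * card {\<omega>\<in>\<Omega>. \<forall>r<k. \<omega> (j, r) \<in> F j a}) \<le> real (card \<Omega>)" by (rule of_nat_mono)
      then have le: "real (card {\<omega>\<in>\<Omega>. \<forall>r<k. \<omega> (j, r) \<in> F j a}) \<le> real (card \<Omega>) / 2 ^ k"
        by (simp add: pos_le_divide_eq mult.commute)
      have "(\<Sum>\<omega>\<in>\<Omega>. z \<omega> j a) = \<bar>x j a\<bar> * real (card {\<omega>\<in>\<Omega>. \<forall>r<k. \<omega> (j, r) \<in> F j a})"
        using True f\<Omega> by (simp add: z_def sum.inter_filter[symmetric])
      also have "\<dots> \<le> \<bar>x j a\<bar> * (real (card \<Omega>) / 2 ^ k)" using le by (rule mult_left_mono) simp
      finally show ?thesis .
    qed (simp add: z_def)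
    have "(\<Sum>\<omega>\<in>\<Omega>. nrm ell_inf (A \<omega> f - diag_op s f)) \<le>
        (\<Sum>\<omega>\<in>\<Omega>. 64 / 2 ^ k + (\<Sum>j<k. \<Sum>a<m j. z \<omega> j a))" by (intro sum_mono err)
    also have "\<dots> = 64 / 2 ^ k * real (card \<Omega>) + (\<Sum>j<k. \<Sum>a<m j. \<Sum>\<omega>\<in>\<Omega>. z \<omega> j a)"
    proof -
      have "(\<Sum>\<omega>\<in>\<Omega>. \<Sum>j<k. \<Sum>a<m j. z \<omega> j a) = (\<Sum>j<k. \<Sum>\<omega>\<in>\<Omega>. \<Sum>a<m j. z \<omega> j a)" by (rule sum.swap)
      also have "\<dots> = (\<Sum>j<k. \<Sum>a<m j. \<Sum>\<omega>\<in>\<Omega>. z \<omega> j a)" by (intro sum.cong refl sum.swap)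
      finally show ?thesis by (simp add: sum.distrib mult.commute)
    qed
    also have "(\<Sum>j<k. \<Sum>a<m j. \<Sum>\<omega>\<in>\<Omega>. z \<omega> j a) \<le> (\<Sum>j<k. \<Sum>a<m j. \<bar>x j a\<bar> * (real (card \<Omega>) / 2 ^ k))"
      by (intro sum_mono zs) auto
    also have "\<dots> = (\<Sum>j<k. b j) * (real (card \<Omega>) / 2 ^ k)" by (simp only: b_def sum_distrib_right)
    also have "\<dots> \<le> 1 * (real (card \<Omega>) / 2 ^ k)" using tot by (rule mult_right_mono) simp
    also have "64 / 2 ^ k * real (card \<Omega>) + 1 * (real (card \<Omega>) / 2 ^ k) = 65 / 2 ^ k * real (card \<Omega>)"
      by (simp add: field_simps)
    finally show "(\<Sum>\<omega>\<in>\<Omega>. nrm ell_inf (A \<omega> f - diag_op s f)) \<le> 65 / 2 ^ k * real (card \<Omega>)"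
      by (simp only: add_left_mono)
  qed
qed

section \<open>The operator\<close>

lemma e_ran_nonada_ge:
  fixes m :: nat
  assumes "n \<ge> 1" "2 ^ (42 * n\<^sup>2) \<le> m" "inj_on E {..<m}" "\<And>b. b < m \<Longrightarrow> s (E b) = \<sigma>" "\<sigma> \<ge> 0"
    "\<And>i. \<bar>s i\<bar> \<le> C"
  shows "ennreal (\<sigma> / 32) \<le> e_ran_nonada ell1 ell_inf (diag_op s) n"
  unfolding e_ran_nonada_def
proof (rule Inf_greatest, clarify)
  fix M :: "(nat \<Rightarrow> real) sample measure" and L \<phi>
  assume "randomized_algorithm ell1 ell_inf n M L \<phi>" "nonadaptive ell1 n M L"
  then show "ennreal (\<sigma> / 32) \<le> mc_error ell1 ell_inf (diag_op s) n M L \<phi>"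
    by (rule nonadaptive_error_ge[where E = E and m = m and C = C]) (use assms in auto)
qed

text \<open>Always answering 0 is nonadaptive, and its error is bounded by the weights.\<close>

lemma e_ran_nonada_finite:
  assumes s: "\<And>i. \<bar>s i\<bar> \<le> C"
  shows "e_ran_nonada ell1 ell_inf (diag_op s) n < \<infinity>"
proof -
  let ?M = "uniform_count_measure {undefined :: (nat \<Rightarrow> real) sample}"
  let ?L = "\<lambda>_ _ _. 0 :: real" and ?\<phi> = "\<lambda>_ _. 0 :: nat \<Rightarrow> real"
  have sub: "subspace (pts ell_inf)" using normed_ell_inf by (simp add: normed_space_def)
  interpret P: prob_space ?M by (rule prob_space_uniform_count_measure) auto
  have d: "(\<lambda>_. 0) \<in> dual_space ell1"
    by (rule dual_spaceI[OF normed_ell1, where C = 0]) (auto simp: linear_between_def)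
  have "randomized_algorithm ell1 ell_inf n ?M ?L ?\<phi>"
    unfolding randomized_algorithm_def alg_output_def
    using d subspace_0[OF sub] P.prob_space_axioms by (auto simp: space_norm_borel normed_ell_inf)
  moreover have "nonadaptive ell1 n ?M ?L" by (simp add: nonadaptive_def)
  ultimately have "e_ran_nonada ell1 ell_inf (diag_op s) n \<le> mc_error ell1 ell_inf (diag_op s) n ?M ?L ?\<phi>"
    unfolding e_ran_nonada_def by (intro Inf_lower) blast
  also have "\<dots> \<le> ennreal \<bar>C\<bar>"
    unfolding mc_error_def
  proof (rule SUP_least)
    fix f assume f: "f \<in> {f \<in> pts ell1. nrm ell1 f \<le> 1}"
    have "\<bar>s i * f i\<bar> \<le> \<bar>C\<bar> * 1" for i
      unfolding abs_mult using s[of i] abs_le_nrm_ell1[of f i] f by (intro mult_mono) auto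
    then have "nrm ell_inf (0 - diag_op s f) \<le> \<bar>C\<bar>"
      by (intro nrm_ell_inf_le) (simp add: fun_diff_def diag_op_def zero_fun_def)
    then have "(\<integral>\<^sup>+ \<omega>. ennreal (nrm ell_inf (alg_output n ?L ?\<phi> \<omega> f - diag_op s f)) \<partial>?M) \<le>
        (\<integral>\<^sup>+ \<omega>. ennreal \<bar>C\<bar> \<partial>?M)"
      by (intro nn_integral_mono ennreal_leI) (simp add: alg_output_def)
    then show "(\<integral>\<^sup>+ \<omega>. ennreal (nrm ell_inf (alg_output n ?L ?\<phi> \<omega> f - diag_op s f)) \<partial>?M) \<le> ennreal \<bar>C\<bar>"
      by (simp add: P.emeasure_space_1)
  qed
  finally show ?thesis by (simp add: less_top order_le_less_trans)
qed

lemma divide_ennreal_le: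
  assumes "a \<le> ennreal x" "ennreal y \<le> b" "y > 0" "x \<le> z * y" "z \<ge> 0"
  shows "a / b \<le> ennreal z"
proof (rule divide_le_posI_ennreal)
  show "b > 0" using assms(2,3) by (metis ennreal_less_zero_iff order_less_le_trans)
  have "a \<le> ennreal (y * z)"
    using assms(1,4) by (metis ennreal_leI mult.commute order_trans)
  also have "\<dots> \<le> b * ennreal z"
    using assms(2,3,5) by (simp add: ennreal_mult mult_right_mono)
  finally show "a \<le> b * ennreal z" .
qed

text \<open>Block \<open>j\<close> keeps nonadaptive algorithms with at most \<open>2 ^ 2 ^ j\<close> measurements from
  succeeding, whereas the adaptive search in it takes \<open>O(2 ^ j)\<close> measurements per bucket.\<close>

definition block_size :: "nat \<Rightarrow> nat"
  where "block_size j = 2 ^ (2 ^ (6 + 2 ^ (j + 1)))"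

definition block_weight :: "real \<Rightarrow> nat \<Rightarrow> real"
  where "block_weight \<alpha> j = (1 / 2) ^ j * real (j + 1) powr - (1 + \<alpha>)"

lemma block_weight_bounds:
  assumes "\<alpha> > 0"
  shows "0 < block_weight \<alpha> j" "block_weight \<alpha> j \<le> (1 / 2) ^ j"
proof -
  show "0 < block_weight \<alpha> j" by (simp add: block_weight_def)
  have "real (j + 1) powr - (1 + \<alpha>) \<le> real (j + 1) powr 0" using assms by (intro powr_mono) auto
  then have "real (j + 1) powr - (1 + \<alpha>) \<le> 1" by simp
  then have "(1 / 2) ^ j * real (j + 1) powr - (1 + \<alpha>) \<le> (1 / 2) ^ j * 1" by (intro mult_left_mono) auto
  then show "block_weight \<alpha> j \<le> (1 / 2) ^ j" by (simp add: block_weight_def)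
qed

abbreviation gap_weights :: "real \<Rightarrow> nat \<Rightarrow> real"
  where "gap_weights \<alpha> \<equiv> block_weights (block_weight \<alpha>) block_size"

lemma gap_weights_bounded:
  assumes "\<alpha> > 0"
  shows "\<bar>gap_weights \<alpha> i\<bar> \<le> 1"
proof -
  have "block_weight \<alpha> j \<le> 1" for j
    using block_weight_bounds(2)[OF assms, of j] power_le_one[of "1/2::real" j] by linarith
  then show ?thesis
    using block_weight_bounds(1)[OF assms] by (auto simp: block_weights_def less_imp_le split: prod.splits)
qed

section \<open>Rates of the two errors\<close>

text \<open>In the cost of block \<open>j\<close> the factor \<open>2 ^ j\<close> for the search
  cancels against the weight and leaves a convergent series; rounding up the number of buckets adds
  a geometric sum. The total is O(k 2^k), and the largest affordable \<open>k\<close> gives the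
  error O(2^-k).\<close>

lemma adaptive_rate:
  assumes \<alpha>: "\<alpha> > 0"
  obtains C where "C > 0" "\<And>n. real n \<ge> exp 1 \<Longrightarrow>
    e_ran_ada ell1 ell_inf (diag_op (gap_weights \<alpha>)) n \<le> ennreal (C * ln (real n) / real n)"
proof -
  let ?\<sigma> = "block_weight \<alpha>"
  define T where "T j = (6 + 2 ^ (j + 1) :: nat)" for j
  define Z where "Z = (\<Sum>j. real (j + 1) powr - (1 + \<alpha>))"
  have "summable (\<lambda>j. real j powr - (1 + \<alpha>))" using \<alpha> by (subst summable_real_powr_iff) auto
  then have sm: "summable (\<lambda>j. real (j + 1) powr - (1 + \<alpha>))"
    using summable_iff_shift[of "\<lambda>j. real j powr - (1 + \<alpha>)" 1] by simp
  then have Z: "(\<Sum>j<k. real (j + 1) powr - (1 + \<alpha>)) \<le> Z" for k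
    unfolding Z_def by (intro sum_le_suminf) auto
  then have Z0: "Z \<ge> 0" using Z[of 0] by simp
  \<comment> \<open>The 19 comes from \<open>2 * T j + 3 = 4 * 2 ^ j + 15\<close>, at most
    \<open>19 * 2 ^ j\<close>; \<open>Z\<close> accounts for the weights and 1 for rounding
    up.\<close>
  define K where "K = 19 * (Z + 1)"
  have K1: "K \<ge> 1" using Z0 by (simp add: K_def)
  have size: "block_size j \<le> label_base (T j)" for j
    unfolding block_size_def label_base_def T_def by (intro power_increasing) auto
  have cost: "real (\<Sum>j<k. k * nat \<lceil>2 ^ k * ?\<sigma> j\<rceil> * (2 * T j + 3)) \<le> K * real k * 2 ^ k" for k
  proof -
    have "real (\<Sum>j<k. k * nat \<lceil>2 ^ k * ?\<sigma> j\<rceil> * (2 * T j + 3)) \<le>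
        (\<Sum>j<k. 19 * real k * (2 ^ k * real (j + 1) powr - (1 + \<alpha>) + 2 ^ j))"
      unfolding of_nat_sum
    proof (rule sum_mono)
      fix j
      have B: "real (nat \<lceil>2 ^ k * ?\<sigma> j\<rceil>) \<le> 2 ^ k * ?\<sigma> j + 1"
        using block_weight_bounds(1)[OF \<alpha>, of j] by (simp add: less_imp_le)
      have "(1::real) \<le> 2 ^ j" by simp
      then have "real (2 * T j + 3) \<le> 19 * 2 ^ j" by (simp add: T_def)
      then have "real (nat \<lceil>2 ^ k * ?\<sigma> j\<rceil>) * real (2 * T j + 3) \<le> (2 ^ k * ?\<sigma> j + 1) * (19 * 2 ^ j)"
        using B block_weight_bounds(1)[OF \<alpha>, of j] by (intro mult_mono) (auto simp: less_imp_le)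
      also have "\<dots> = 19 * (2 ^ k * ((1 / 2) ^ j * 2 ^ j) * real (j + 1) powr - (1 + \<alpha>) + 2 ^ j)"
        by (simp add: block_weight_def algebra_simps)
      also have "(1 / 2) ^ j * 2 ^ j = (1::real)" by (simp flip: power_mult_distrib)
      finally have "real k * (real (nat \<lceil>2 ^ k * ?\<sigma> j\<rceil>) * real (2 * T j + 3)) \<le>
          real k * (19 * (2 ^ k * 1 * real (j + 1) powr - (1 + \<alpha>) + 2 ^ j))"
        by (rule mult_left_mono) simp
      then show "real (k * nat \<lceil>2 ^ k * ?\<sigma> j\<rceil> * (2 * T j + 3)) \<le>
          19 * real k * (2 ^ k * real (j + 1) powr - (1 + \<alpha>) + 2 ^ j)"
        by (simp only: of_nat_mult mult_ac mult_1_right mult_1_left)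
    qed
    also have "\<dots> = 19 * real k * (2 ^ k * (\<Sum>j<k. real (j + 1) powr - (1 + \<alpha>)) + (\<Sum>j<k. 2 ^ j))"
      by (simp only: sum_distrib_left sum.distrib distrib_left)
    also have "\<dots> \<le> 19 * real k * (2 ^ k * Z + 2 ^ k)"
    proof (intro mult_left_mono add_mono Z)
      show "(\<Sum>j<k. 2 ^ j) \<le> (2::real) ^ k" by (simp add: sum_gp_strict)
    qed auto
    also have "\<dots> = K * real k * 2 ^ k" by (simp add: K_def algebra_simps)
    finally show ?thesis .
  qed
  show thesis
  proof (rule that)
    show "390 * K > 0" using K1 by simp
    fix n :: nat assume n: "real n \<ge> exp 1"
    have n0: "real n > 0" using n by (meson exp_gt_zero less_le_trans)
    have "ln (exp 1) \<le> ln (real n)" using n n0 by (subst ln_le_cancel_iff) auto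
    then have ln1: "ln (real n) \<ge> 1" by simp
    let ?P = "\<lambda>k. real n < K * real k * 2 ^ k"
    have "?P (Suc n)"
    proof -
      have "real n < 2 ^ n" by (rule of_nat_less_two_power)
      also have "\<dots> \<le> 1 * 1 * 2 ^ Suc n" by simp
      also have "\<dots> \<le> K * real (Suc n) * 2 ^ Suc n" using K1 by (intro mult_mono) auto
      finally show ?thesis .
    qed
    \<comment> \<open>\<open>?P 0\<close> fails and \<open>?P (Suc n)\<close> holds, so the
      predicate switches somewhere: this \<open>k\<close> is affordable and its successor is
      not.\<close>
    have "\<exists>k. ?P (Suc k) \<and> \<not> ?P k"
    proof (rule ccontr)
      assume "\<not> ?thesis"
      then have "\<not> ?P k" for k by (induction k) (use n0 in auto)
      then show False using \<open>?P (Suc n)\<close> by blast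
    qed
    then obtain k where k: "?P (Suc k)" "\<not> ?P k" by blast
    have kn: "2 ^ k \<le> real n"
    proof (cases "k = 0")
      case False
      then have "1 * 1 * 2 ^ k \<le> K * real k * 2 ^ k" using K1 by (intro mult_mono) auto
      then show ?thesis using k(2) by linarith
    qed (use n0 in simp)
    then have "real k * ln 2 \<le> ln (real n)"
      using n0 by (metis ln_le_cancel_iff ln_realpow zero_less_numeral zero_less_power)
    moreover have "real k * (2 / 3) \<le> real k * ln 2" using ln2_ge_two_thirds by (intro mult_left_mono) auto
    ultimately have k3: "real (Suc k) \<le> 3 * ln (real n)" using ln1 unfolding of_nat_Suc by linarith
    have "e_ran_ada ell1 ell_inf (diag_op (gap_weights \<alpha>)) n \<le> ennreal (65 / 2 ^ k)"
    proof (rule adaptive_error_le[OF block_weight_bounds[OF \<alpha>] size])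
      have "real (\<Sum>j<k. k * nat \<lceil>2 ^ k * ?\<sigma> j\<rceil> * (2 * T j + 3)) \<le> real n"
        using cost[of k] k(2) by linarith
      then show "(\<Sum>j<k. k * nat \<lceil>2 ^ k * ?\<sigma> j\<rceil> * (2 * T j + 3)) \<le> n" by (simp only: of_nat_le_iff)
    qed
    \<comment> \<open>Failure at \<open>Suc k\<close> bounds \<open>2 ^ k\<close> from below; 390 is
      65 times 3 from \<open>k3\<close> times 2 from the step to \<open>Suc k\<close>.\<close>
    also have "65 / 2 ^ k \<le> 390 * K * ln (real n) / real n"
    proof -
      have "real n \<le> K * real (Suc k) * 2 ^ Suc k" using k(1) by simp
      also have "\<dots> \<le> K * (3 * ln (real n)) * 2 ^ Suc k"
        using k3 K1 by (intro mult_right_mono mult_left_mono) auto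
      finally have "65 * real n \<le> 390 * K * ln (real n) * 2 ^ k" by simp
      then show ?thesis using n0 by (simp add: field_simps)
    qed
    finally show "e_ran_ada ell1 ell_inf (diag_op (gap_weights \<alpha>)) n \<le> ennreal (390 * K * ln (real n) / real n)"
      by (simp add: ennreal_leI)
  qed
qed

text \<open>The relevant block is the first \<open>j\<close> with \<open>n \<le> 2 ^ 2 ^ j\<close>.
  Minimality bounds \<open>2 ^ j\<close> by a multiple of \<open>ln n\<close> and
  \<open>j + 1\<close> by a multiple of \<open>ln (ln n)\<close>, so the weight of this block is not
  too small.\<close>

lemma nonadaptive_rate:
  assumes \<alpha>: "\<alpha> > 0" and n: "real n \<ge> exp (exp 1)"
  shows "ennreal (1 / (96 * ln (real n) * (9 * ln (ln (real n))) powr (1 + \<alpha>))) \<le>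
    e_ran_nonada ell1 ell_inf (diag_op (gap_weights \<alpha>)) n"
proof -
  have n0: "real n > 0" using n by (meson exp_gt_zero less_le_trans)
  have "ln (exp (exp 1)) \<le> ln (real n)" using n n0 by (subst ln_le_cancel_iff) auto
  then have l1: "exp 1 \<le> ln (real n)" by simp
  then have l0: "ln (real n) > 0" by (meson exp_gt_zero less_le_trans)
  have "ln (exp 1) \<le> ln (ln (real n))" using l1 l0 by (subst ln_le_cancel_iff) auto
  then have ll1: "ln (ln (real n)) \<ge> 1" by simp
  have e2: "exp 1 \<ge> (2::real)" using exp_ge_add_one_self[of 1] by simp
  have "exp (exp 1) > (exp 1 :: real)" using e2 by simp
  then have n2: "n > 2" using n e2 by linarith
  have "n \<le> 2 ^ 2 ^ n"
    by (meson less_exp less_imp_le order_less_trans)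
  then obtain j where j: "n \<le> 2 ^ 2 ^ j" "\<And>i. i < j \<Longrightarrow> \<not> n \<le> 2 ^ 2 ^ i"
    using exists_least_iff[of "\<lambda>j. n \<le> 2 ^ 2 ^ j"] by blast
  have "j \<noteq> 0" using j(1) n2 by (intro notI) simp
  then obtain i where i: "j = Suc i" by (cases j) auto
  have "2 ^ 2 ^ i < n" using j(2)[of i] i by simp
  then have "(2::real) ^ 2 ^ i < real n" by (metis of_nat_less_iff of_nat_numeral of_nat_power)
  then have "real (2 ^ i) * ln 2 < ln (real n)"
    using n0 by (metis ln_less_cancel_iff ln_realpow zero_less_numeral zero_less_power)
  moreover have "real (2 ^ i) * (2 / 3) \<le> real (2 ^ i) * ln 2" using ln2_ge_two_thirds by (intro mult_left_mono) auto
  ultimately have "real (2 ^ i) * (2 / 3) < ln (real n)" by linarith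
  then have pj: "2 ^ j \<le> 3 * ln (real n)" by (simp add: i)
  have "real (j + 1) * ln 2 = ln (2 ^ j * 2)" by (simp add: ln_mult ln_realpow algebra_simps)
  also have "\<dots> \<le> ln (3 * ln (real n) * 2)" using pj by (subst ln_le_cancel_iff) (use l0 in auto)
  also have "\<dots> = ln 6 + ln (ln (real n))" using l0 by (simp add: ln_mult flip: ln_mult[of 3 2])
  also have "\<dots> \<le> 5 + ln (ln (real n))" using ln_le_minus_one[of "6::real"] by simp
  also have "\<dots> \<le> 6 * ln (ln (real n))" using ll1 by simp
  finally have "real (j + 1) * ln 2 \<le> 6 * ln (ln (real n))" .
  with mult_left_mono[OF ln2_ge_two_thirds, of "real (j + 1)"]
  have "real (j + 1) * (2 / 3) \<le> 6 * ln (ln (real n))" by (meson of_nat_0_le_iff order_trans)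
  then have j1: "real (j + 1) \<le> 9 * ln (ln (real n))" by simp
  \<comment> \<open>96 is 3 from \<open>pj\<close> times 32 from the error bound for a single
    block.\<close>
  have "1 / (96 * ln (real n) * (9 * ln (ln (real n))) powr (1 + \<alpha>)) \<le> block_weight \<alpha> j / 32"
  proof -
    have "2 ^ j * real (j + 1) powr (1 + \<alpha>) \<le> 3 * ln (real n) * (9 * ln (ln (real n))) powr (1 + \<alpha>)"
      using pj j1 \<alpha> l0 by (intro mult_mono powr_mono2) auto
    then have "1 / (3 * ln (real n) * (9 * ln (ln (real n))) powr (1 + \<alpha>)) \<le> 1 / (2 ^ j * real (j + 1) powr (1 + \<alpha>))"
      by (intro frac_le) auto
    also have "\<dots> = block_weight \<alpha> j"
      by (simp only: block_weight_def powr_minus power_one_over divide_inverse inverse_mult_distrib mult_1_left power_inverse)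
    finally show ?thesis by simp
  qed
  then have "ennreal (1 / (96 * ln (real n) * (9 * ln (ln (real n))) powr (1 + \<alpha>))) \<le> ennreal (block_weight \<alpha> j / 32)"
    by (rule ennreal_leI)
  also have "\<dots> \<le> e_ran_nonada ell1 ell_inf (diag_op (gap_weights \<alpha>)) n"
  proof (rule e_ran_nonada_ge[where E = "\<lambda>a. prod_encode (j, a)" and m = "block_size j"])
    \<comment> \<open>This computation dictates the form of \<open>block_size\<close>: 42 is rounded
      up to \<open>2 ^ 6\<close>, and squaring \<open>2 ^ 2 ^ j\<close> turns the exponent
      \<open>2 ^ j\<close> into \<open>2 ^ (j + 1)\<close>.\<close>
    have "42 * n\<^sup>2 \<le> 64 * (2 ^ 2 ^ j)\<^sup>2" using j(1) by (intro mult_le_mono power_mono) auto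
    also have "\<dots> = 2 ^ (6 + 2 ^ (j + 1))" by (simp add: power_add mult.commute flip: power_mult)
    finally show "2 ^ (42 * n\<^sup>2) \<le> block_size j" unfolding block_size_def by (intro power_increasing) auto
    show "inj_on (\<lambda>a. prod_encode (j, a)) {..<block_size j}" by (auto simp: inj_on_def)
    show "\<bar>gap_weights \<alpha> i\<bar> \<le> 1" for i by (rule gap_weights_bounded[OF \<alpha>])
  qed (use n2 block_weight_bounds(1)[OF \<alpha>, of j] in auto)
  finally show ?thesis .
qed

theorem corollary4p2:
  fixes \<alpha> :: real
  assumes "\<alpha> > 0"
  shows "\<exists>(F :: (nat \<Rightarrow> real) nspace) (G :: (nat \<Rightarrow> real) nspace) (S :: (nat \<Rightarrow> real) \<Rightarrow> (nat \<Rightarrow> real)).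
    banach_space F \<and> banach_space G \<and> linear_operator F G S \<and>
    (\<exists>c>0. \<exists>n0::nat. \<forall>n\<ge>n0.
      0 < e_ran_nonada F G S n \<and> e_ran_nonada F G S n < \<infinity> \<and>
      e_ran_ada F G S n / e_ran_nonada F G S n \<le>
        ennreal (c * ((ln (real n))\<^sup>2 * (ln (ln (real n))) powr (1 + \<alpha>) / real n)))"
proof -
  let ?S = "diag_op (gap_weights \<alpha>)"
  obtain C where C: "C > 0" and ada: "\<And>n. real n \<ge> exp 1 \<Longrightarrow>
      e_ran_ada ell1 ell_inf ?S n \<le> ennreal (C * ln (real n) / real n)"
    using adaptive_rate[OF assms] by blast
  \<comment> \<open>\<open>C\<close> times the constants in the denominator of the nonadaptive
    bound, which a division by that bound releases.\<close>
  define c where "c = C * 96 * 9 powr (1 + \<alpha>)"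
  \<comment> \<open>From \<open>exp (exp 1)\<close> on, \<open>ln (ln n)\<close> is at least 1, so
    both rates apply and all logarithms are positive.\<close>
  have "0 < e_ran_nonada ell1 ell_inf ?S n \<and> e_ran_nonada ell1 ell_inf ?S n < \<infinity> \<and>
      e_ran_ada ell1 ell_inf ?S n / e_ran_nonada ell1 ell_inf ?S n \<le>
        ennreal (c * ((ln (real n))\<^sup>2 * (ln (ln (real n))) powr (1 + \<alpha>) / real n))"
    if "n \<ge> nat \<lceil>exp (exp 1) :: real\<rceil>" for n
  proof (intro conjI)
    have n: "real n \<ge> exp (exp 1)" using that by linarith
    have "exp 1 \<le> (exp (exp 1) :: real)" using exp_ge_add_one_self[of "1::real"] by simp
    then have n1: "real n \<ge> exp 1" using n by linarith
    have n0: "real n > 0" using n by (meson exp_gt_zero less_le_trans)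
    have "ln (exp (exp 1)) \<le> ln (real n)" using n n0 by (subst ln_le_cancel_iff) auto
    then have l1: "exp 1 \<le> ln (real n)" by simp
    then have l0: "ln (real n) > 0" by (meson exp_gt_zero less_le_trans)
    have "ln (exp 1) \<le> ln (ln (real n))" using l1 l0 by (subst ln_le_cancel_iff) auto
    then have ll: "ln (ln (real n)) > 0" by simp
    let ?y = "1 / (96 * ln (real n) * (9 * ln (ln (real n))) powr (1 + \<alpha>))"
    have y: "?y > 0" using l0 ll by simp
    have low: "ennreal ?y \<le> e_ran_nonada ell1 ell_inf ?S n" by (rule nonadaptive_rate[OF assms n])
    then show "0 < e_ran_nonada ell1 ell_inf ?S n"
      using y by (metis ennreal_less_zero_iff order_less_le_trans)
    show "e_ran_nonada ell1 ell_inf ?S n < \<infinity>"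
      by (rule e_ran_nonada_finite[OF gap_weights_bounded[OF assms]])
    show "e_ran_ada ell1 ell_inf ?S n / e_ran_nonada ell1 ell_inf ?S n \<le>
        ennreal (c * ((ln (real n))\<^sup>2 * (ln (ln (real n))) powr (1 + \<alpha>) / real n))"
    proof (rule divide_ennreal_le[OF ada[OF n1] low y])
      have "c * ((ln (real n))\<^sup>2 * (ln (ln (real n))) powr (1 + \<alpha>) / real n) * ?y = C * ln (real n) / real n"
        using l0 ll n0 by (simp add: c_def powr_mult power2_eq_square)
      then show "C * ln (real n) / real n \<le> c * ((ln (real n))\<^sup>2 * (ln (ln (real n))) powr (1 + \<alpha>) / real n) * ?y"
        by simp
      show "0 \<le> c * ((ln (real n))\<^sup>2 * (ln (ln (real n))) powr (1 + \<alpha>) / real n)"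
        using C by (simp add: c_def)
    qed
  qed
  note rate = this
  show ?thesis
  proof (intro exI conjI allI impI)
    show "banach_space ell1" "banach_space ell_inf" by (rule banach_ell1 banach_ell_inf)+
    show "linear_operator ell1 ell_inf ?S"
      by (rule linear_operator_diag_op(1)[OF gap_weights_bounded[OF assms]])
    show "c > 0" using C by (simp add: c_def)
  qed (use rate in blast)+
qed

end
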